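(* Let $B$ be a PSIT, let $i\in\{1,2\}$, where $(\mathcal D_1,\mathcal E_1)=(\mathfrak M,\mathfrak V)$ and $(\mathcal D_2,\mathcal E_2)=(\mathcal P,\mathcal V)$. Let $H,K,\widetilde H\in(\mathcal D_i)^B$, $A,V\in(\mathcal E_i)^B$, $a,b\in\mathbb R$, and let $(\tau_n)$ be an FS for $B$. Suppose that both $H$ and $K$ are integrable on $B$ w.r.t. $A$, and that $H$ is integrable on $B$ w.r.t. $V$. Then: (1) $aH+bK$ is integrable on $B$ w.r.t. $A$, and $(aH+bK)_\bullet A=a(H_\bullet A)+b(K_\bullet A)$. Furthermore, $(aH^{\tau_n}+bK^{\tau_n}).A^{\tau_n}=a(H^{\tau_n}.A^{\tau_n})+b(K^{\tau_n}.A^{\tau_n})$ for each $n$, and $(\tau_n,(aH^{\tau_n}+bK^{\tau_n}).A^{\tau_n})$ is an FCS for $(aH+bK)_\bullet A\in(\mathcal E_i)^B$. (2) $H$ is integrable on $B$ w.r.t. $aA+bV$, and $H_\bullet(aA+bV)=a(H_\bullet A)+b(H_\bullet V)$. Furthermore, $H^{\tau_n}.(aA^{\tau_n}+bV^{\tau_n})=a(H^{\tau_n}.A^{\tau_n})+b(H^{\tau_n}.V^{\tau_n})$ for each $n$, and $(\tau_n,H^{\tau_n}.(aA^{\tau_n}+bV^{\tau_n}))$ is an FCS for $H_\bullet(aA+bV)\in(\mathcal E_i)^B$. (3) $\widetilde H$ is integrable on $B$ w.r.t. $H_\bullet A$ if and only if $\widetilde HH$ is integrable on $B$ w.r.t.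 $A$. Furthermore, in either case $(\widetilde HH)_\bullet A=\widetilde H_\bullet(H_\bullet A)$, $\widetilde H^{\tau_n}.(H^{\tau_n}.A^{\tau_n})=(\widetilde H^{\tau_n}H^{\tau_n}).A^{\tau_n}$ for each $n$, and $(\tau_n,\widetilde H^{\tau_n}.(H^{\tau_n}.A^{\tau_n}))$ is an FCS for $(\widetilde HH)_\bullet A=\widetilde H_\bullet(H_\bullet A)\in(\mathcal E_i)^B$.
   Context: Fix a probability space $(\Omega,\mathcal F,\mathbb P)$ with a filtration $\mathbb F=(\mathcal F_t)_{t\ge0}$ satisfying the usual conditions; $\mathbb R^+=[0,+\infty[$, $\mathbb N^+=\{1,2,\dots\}$. A process is a family of real random variables indexed by $\mathbb R^+$; indistinguishable processes are regarded as the same ($X=Y$ means indistinguishability). For stopping times $S,T$, $[\![S,T]\!]=\{(\omega,t)\in\Omega\times\mathbb R^+:S(\omega)\le t\le T(\omega)\}$; $[\![S,T[\![$, $]\!]S,T]\!]$, $]\!]S,T[\![$ are defined analogously with strict inequality at open ends. $T_n\uparrow T$ means that $(T_n)$ is an increasing sequence of stopping times with limit $T$. Juxtaposition of sets means intersection. If $X$ is a real function on $\widetilde C\subseteq\Omega\times\mathbb R^+$, then $XI_C$ is the function on $\Omega\times\mathbb R^+$ equal to $X$ on $C\cap\widetilde C$ and $0$ elsewhere. A set $B\subseteq\Omega\times\mathbb R^+$ is a predictable set of interval type (PSIT) if it is predictable and there is a non-negative (possibly infinite) random variable $T$ such that each section $B_\omega=\{t:(\omega,t)\in B\}$ is nonempty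 and equals $[0,T(\omega)[$ or $[0,T(\omega)]$. The debut of $B^c$ is $\omega\mapsto\inf\{t:(\omega,t)\notin B\}$. A fundamental sequence (FS) for $B$ is an increasing sequence $(\tau_n)$ of stopping times with $B=\bigcup_n[\![0,\tau_n]\!]$ (one always exists). A process on $B$ is a real function $X$ on $B$ such that $XI_B$ is a process; processes $X,Y$ on $B$ are identified ($X=Y$) if $XI_B=YI_B$. A stopping time $\tau$ is a stopping time on $B$ if $[\![0,\tau]\!]\subseteq B$; then for a process $X$ on $B$, $X^\tau:=XI_{[\![0,\tau]\!]}+X_\tau I_{]\!]\tau,+\infty[\![}$ (a process on $\Omega\times\mathbb R^+$). Let $T$ be the debut of $B^c$. A coupled sequence (CS) for a process $X$ on $B$ is a sequence $(T_n,X^{(n)})_{n\in\mathbb N^+}$ with $T_n$ stopping times, $T_n\uparrow T$, $\bigcup_n[\![0,T_n]\!]\supseteq B$, $X^{(n)}$ processes, and $XI_{B[\![0,T_n]\!]}=X^{(n)}I_{B[\![0,T_n]\!]}$ for each $n$. For a class $\mathcal D$ of processes, $\mathcal D^B$ is the set of processes $X$ on $B$ having a CS with all $X^{(n)}\in\mathcal D$; such a CS is called a fundamental coupled sequence (FCS) for $X\in\mathcal D^B$. $\mathfrak M$ (resp. $\mathcal P$) is the class of all measurable (resp. predictable) processes; $\mathfrak V$ (resp. $\mathcal V$) is the class of all (resp. adapted) processes with finite variation (c\`adl\`ag paths, of finite variation on bounded intervals). Pathwise integrals over $[0,t]$ include the mass at $0$: $\int_{[0,t]}H_s\,dA_s=H_0A_0+\int_{]0,t]}H_s\,dA_s$,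 and $\int_{[0,t]}|dA_s|$ is the variation process of $A$ (including $|A_0|$). For $H\in\mathfrak M$, $A\in\mathfrak V$, $H$ is integrable w.r.t. $A$ if $\int_{[0,t]}|H_s(\omega)||dA_s(\omega)|<+\infty$ for all $(\omega,t)\in\Omega\times\mathbb R^+$, and then $(H.A)_t(\omega)=\int_{[0,t]}H_s(\omega)\,dA_s(\omega)$. For $H\in\mathfrak M^B$, $A\in\mathfrak V^B$, $H$ is integrable on $B$ w.r.t. $A$ if $\int_{[0,t]}|H_s(\omega)||dA_s(\omega)|<+\infty$ for all $(\omega,t)\in B$, and then $H_\bullet A$ is the process on $B$ given by $(H_\bullet A)(\omega,t)=\int_{[0,t]}H_s(\omega)\,dA_s(\omega)$, $(\omega,t)\in B$. *)

theory Defs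
  imports "HOL-Probability.Probability"
begin

section \<open>Filtered probability spaces\<close>

text \<open>
  Filtrations are indexed by \<open>ennreal\<close>, so that \<^const>\<open>stopping_time\<close> is about times with values
  in \<open>[0, \<infinity>]\<close>. The additional sigma-algebra \<open>F \<infinity>\<close> plays no role: the stopping time condition
  at \<open>\<infinity>\<close> holds trivially, and everything else refers to \<open>F (ennreal t)\<close> for real \<open>t \<ge> 0\<close>.
\<close>

locale usual_filtered_space = prob_space M + complete_measure M + filtration "space M" F
  for M :: "'a measure" and F :: "ennreal \<Rightarrow> 'a measure" +
  assumes sets_F_subset: "sets (F t) \<subseteq> sets M"
    and right_continuous: "t < \<infinity> \<Longrightarrow> sets (F t) = (\<Inter>s\<in>{t<..}. sets (F s))"
    and null_sets_F: "null_sets M \<subseteq> sets (F 0)"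

definition predictable_sigma :: "'a measure \<Rightarrow> (ennreal \<Rightarrow> 'a measure) \<Rightarrow> ('a \<times> real) measure" where
  "predictable_sigma M F = sigma (space M \<times> {0..})
     ({A \<times> {0} | A. A \<in> sets (F 0)} \<union>
      {A \<times> {s<..t} | A s t. 0 \<le> s \<and> s \<le> t \<and> A \<in> sets (F (ennreal s))})"

section \<open>Processes\<close>

text \<open>
  A process is a function \<open>X \<omega> t\<close>, of which only the values for \<open>\<omega> \<in> space M\<close>, \<open>t \<ge> 0\<close> matter; for a
  process on \<open>B\<close> only the values at \<open>(\<omega>, t) \<in> B\<close> matter. Since indistinguishable processes are the
  same, \<open>=\<close> between processes is \<open>indist\<close> (\<open>indist_on\<close> for processes on \<open>B\<close>), the classes of
  processes are closed under \<open>indist\<close>, and path properties hold for almost all \<open>\<omega>\<close>.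
\<close>

type_synonym 'a process = "'a \<Rightarrow> real \<Rightarrow> real"

definition indist :: "'a measure \<Rightarrow> 'a process \<Rightarrow> 'a process \<Rightarrow> bool" where
  "indist M X Y \<longleftrightarrow> (AE \<omega> in M. \<forall>t\<ge>0. X \<omega> t = Y \<omega> t)"

definition mod_indist :: "'a measure \<Rightarrow> 'a process set \<Rightarrow> 'a process set" where
  "mod_indist M D = {X. \<exists>Y\<in>D. indist M X Y}"

definition is_process :: "'a measure \<Rightarrow> 'a process \<Rightarrow> bool" where
  "is_process M X \<longleftrightarrow> (\<forall>t\<ge>0. (\<lambda>\<omega>. X \<omega> t) \<in> borel_measurable M)"

text \<open>The process \<open>X I\<^sub>C\<close>.\<close>

definition restr :: "'a process \<Rightarrow> ('a \<times> real) set \<Rightarrow> 'a process" where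
  "restr X C = (\<lambda>\<omega> t. if (\<omega>, t) \<in> C then X \<omega> t else 0)"

definition indist_on :: "'a measure \<Rightarrow> ('a \<times> real) set \<Rightarrow> 'a process \<Rightarrow> 'a process \<Rightarrow> bool" where
  "indist_on M B X Y \<longleftrightarrow> indist M (restr X B) (restr Y B)"

definition process_on :: "'a measure \<Rightarrow> ('a \<times> real) set \<Rightarrow> 'a process \<Rightarrow> bool" where
  "process_on M B X \<longleftrightarrow> is_process M (restr X B)"

definition lin_comb :: "real \<Rightarrow> 'a process \<Rightarrow> real \<Rightarrow> 'a process \<Rightarrow> 'a process" where
  "lin_comb a X b Y = (\<lambda>\<omega> t. a * X \<omega> t + b * Y \<omega> t)"

definition proc_mult :: "'a process \<Rightarrow> 'a process \<Rightarrow> 'a process" where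
  "proc_mult X Y = (\<lambda>\<omega> t. X \<omega> t * Y \<omega> t)"

text \<open>The stopped process \<open>X\<^sup>\<tau>\<close>.\<close>

definition stopped :: "'a process \<Rightarrow> ('a \<Rightarrow> ennreal) \<Rightarrow> 'a process" where
  "stopped X \<tau> = (\<lambda>\<omega> t. if ennreal t \<le> \<tau> \<omega> then X \<omega> t else X \<omega> (enn2real (\<tau> \<omega>)))"

section \<open>Pathwise Stieltjes integrals\<close>

text \<open>The variation of \<open>f\<close> on \<open>[0, t]\<close>, including \<open>\<bar>f 0\<bar>\<close> (the jump from \<open>f (0-) = 0\<close>).\<close>

definition path_variation :: "(real \<Rightarrow> real) \<Rightarrow> real \<Rightarrow> ennreal" where
  "path_variation f t = ennreal \<bar>f 0\<bar> +
     (SUP (p, n) \<in> {(p :: nat \<Rightarrow> real, n). p 0 = 0 \<and> p n = t \<and> (\<forall>i<n. p i \<le> p (Suc i))}.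
        \<Sum>i<n. ennreal \<bar>f (p (Suc i)) - f (p i)\<bar>)"

text \<open>
  The distribution functions below vanish on \<open>]-\<infinity>, 0[\<close>, which produces the mass at \<open>0\<close>, and are
  constant from \<open>t\<close> on, so that only the values of \<open>f\<close> on \<open>[0, t]\<close> are used. For \<open>f\<close> right-continuous
  of finite variation on \<open>[0, t]\<close> they are nondecreasing and right-continuous, and the Stieltjes measure
  of \<open>f\<close> is \<open>pos_measure f t - neg_measure f t\<close> (Jordan decomposition).
\<close>

definition variation_upto :: "(real \<Rightarrow> real) \<Rightarrow> real \<Rightarrow> real \<Rightarrow> real" where
  "variation_upto f t s = (if s < 0 then 0 else enn2real (path_variation f (min s t)))"

definition path_upto :: "(real \<Rightarrow> real) \<Rightarrow> real \<Rightarrow> real \<Rightarrow> real" where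
  "path_upto f t s = (if s < 0 then 0 else f (min s t))"

definition abs_measure :: "(real \<Rightarrow> real) \<Rightarrow> real \<Rightarrow> real measure" where
  "abs_measure f t = interval_measure (variation_upto f t)"

definition pos_measure :: "(real \<Rightarrow> real) \<Rightarrow> real \<Rightarrow> real measure" where
  "pos_measure f t = interval_measure (\<lambda>s. (variation_upto f t s + path_upto f t s) / 2)"

definition neg_measure :: "(real \<Rightarrow> real) \<Rightarrow> real \<Rightarrow> real measure" where
  "neg_measure f t = interval_measure (\<lambda>s. (variation_upto f t s - path_upto f t s) / 2)"

text \<open>\<open>\<integral>\<^bsub>[0,t]\<^esub> \<bar>h\<^sub>s\<bar> \<bar>df\<^sub>s\<bar>\<close> and \<open>\<integral>\<^bsub>[0,t]\<^esub> h\<^sub>s df\<^sub>s\<close>.\<close>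

definition abs_path_integral :: "(real \<Rightarrow> real) \<Rightarrow> (real \<Rightarrow> real) \<Rightarrow> real \<Rightarrow> ennreal" where
  "abs_path_integral h f t = (\<integral>\<^sup>+s\<in>{0..t}. ennreal \<bar>h s\<bar> \<partial>abs_measure f t)"

definition path_integral :: "(real \<Rightarrow> real) \<Rightarrow> (real \<Rightarrow> real) \<Rightarrow> real \<Rightarrow> real" where
  "path_integral h f t =
     (LINT s:{0..t}|pos_measure f t. h s) - (LINT s:{0..t}|neg_measure f t. h s)"

section \<open>Classes of processes\<close>

definition cadlag :: "(real \<Rightarrow> real) \<Rightarrow> bool" where
  "cadlag f \<longleftrightarrow> (\<forall>t\<ge>0. continuous (at_right t) f) \<and> (\<forall>t>0. \<exists>l. (f \<longlongrightarrow> l) (at_left t))"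

definition fv_path :: "(real \<Rightarrow> real) \<Rightarrow> bool" where
  "fv_path f \<longleftrightarrow> cadlag f \<and> (\<forall>t\<ge>0. path_variation f t < \<infinity>)"

definition measurable_processes :: "'a measure \<Rightarrow> 'a process set" where
  "measurable_processes M = mod_indist M
     {X. case_prod X \<in> borel_measurable (M \<Otimes>\<^sub>M restrict_space borel {0..})}"

definition predictable_processes ::
    "'a measure \<Rightarrow> (ennreal \<Rightarrow> 'a measure) \<Rightarrow> 'a process set" where
  "predictable_processes M F = mod_indist M
     {X. case_prod X \<in> borel_measurable (predictable_sigma M F)}"

definition fv_processes :: "'a measure \<Rightarrow> 'a process set" where
  "fv_processes M = mod_indist M {A. is_process M A \<and> (\<forall>\<omega>\<in>space M. fv_path (A \<omega>))}"

definition adapted_fv_processes ::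
    "'a measure \<Rightarrow> (ennreal \<Rightarrow> 'a measure) \<Rightarrow> 'a process set" where
  "adapted_fv_processes M F = mod_indist M
     {A. (\<forall>t\<ge>0. (\<lambda>\<omega>. A \<omega> t) \<in> borel_measurable (F (ennreal t))) \<and>
         (\<forall>\<omega>\<in>space M. fv_path (A \<omega>))}"

section \<open>Predictable sets of interval type\<close>

definition psit :: "'a measure \<Rightarrow> (ennreal \<Rightarrow> 'a measure) \<Rightarrow> ('a \<times> real) set \<Rightarrow> bool" where
  "psit M F B \<longleftrightarrow> B \<in> sets (predictable_sigma M F) \<and>
     (\<exists>T :: 'a \<Rightarrow> ennreal. T \<in> borel_measurable M \<and>
        (\<forall>\<omega>\<in>space M. {t. (\<omega>, t) \<in> B} \<noteq> {} \<and>
           ({t. (\<omega>, t) \<in> B} = {t. 0 \<le> t \<and> ennreal t < T \<omega>} \<or>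
            {t. (\<omega>, t) \<in> B} = {t. 0 \<le> t \<and> ennreal t \<le> T \<omega>})))"

definition debut_compl :: "('a \<times> real) set \<Rightarrow> 'a \<Rightarrow> ennreal" where
  "debut_compl B \<omega> = (INF t\<in>{t. 0 \<le> t \<and> (\<omega>, t) \<notin> B}. ennreal t)"

text \<open>The stochastic interval \<open>[[0, \<tau>]]\<close>.\<close>

definition stoch_upto :: "'a measure \<Rightarrow> ('a \<Rightarrow> ennreal) \<Rightarrow> ('a \<times> real) set" where
  "stoch_upto M \<tau> = {(\<omega>, t). \<omega> \<in> space M \<and> 0 \<le> t \<and> ennreal t \<le> \<tau> \<omega>}"

definition increasing_stopping_times ::
    "'a measure \<Rightarrow> (ennreal \<Rightarrow> 'a measure) \<Rightarrow> (nat \<Rightarrow> 'a \<Rightarrow> ennreal) \<Rightarrow> bool" where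
  "increasing_stopping_times M F \<tau> \<longleftrightarrow>
     (\<forall>n. stopping_time F (\<tau> n)) \<and> (\<forall>\<omega>\<in>space M. incseq (\<lambda>n. \<tau> n \<omega>))"

definition fundamental_seq :: "'a measure \<Rightarrow> (ennreal \<Rightarrow> 'a measure) \<Rightarrow> ('a \<times> real) set \<Rightarrow>
    (nat \<Rightarrow> 'a \<Rightarrow> ennreal) \<Rightarrow> bool" where
  "fundamental_seq M F B \<tau> \<longleftrightarrow> increasing_stopping_times M F \<tau> \<and> B = (\<Union>n. stoch_upto M (\<tau> n))"

definition coupled_seq :: "'a measure \<Rightarrow> (ennreal \<Rightarrow> 'a measure) \<Rightarrow> ('a \<times> real) set \<Rightarrow> 'a process \<Rightarrow>
    (nat \<Rightarrow> 'a \<Rightarrow> ennreal) \<Rightarrow> (nat \<Rightarrow> 'a process) \<Rightarrow> bool" where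
  "coupled_seq M F B X T Y \<longleftrightarrow>
     process_on M B X \<and>
     increasing_stopping_times M F T \<and>
     (\<forall>\<omega>\<in>space M. (\<lambda>n. T n \<omega>) \<longlonglongrightarrow> debut_compl B \<omega>) \<and>
     B \<subseteq> (\<Union>n. stoch_upto M (T n)) \<and>
     (\<forall>n. is_process M (Y n)) \<and>
     (\<forall>n. indist M (restr X (B \<inter> stoch_upto M (T n))) (restr (Y n) (B \<inter> stoch_upto M (T n))))"

definition fundamental_coupled_seq :: "'a measure \<Rightarrow> (ennreal \<Rightarrow> 'a measure) \<Rightarrow>
    'a process set \<Rightarrow> ('a \<times> real) set \<Rightarrow> 'a process \<Rightarrow>
    (nat \<Rightarrow> 'a \<Rightarrow> ennreal) \<Rightarrow> (nat \<Rightarrow> 'a process) \<Rightarrow> bool" where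
  "fundamental_coupled_seq M F D B X T Y \<longleftrightarrow> coupled_seq M F B X T Y \<and> (\<forall>n. Y n \<in> D)"

text \<open>The class \<open>D\<^sup>B\<close>.\<close>

definition class_on :: "'a measure \<Rightarrow> (ennreal \<Rightarrow> 'a measure) \<Rightarrow>
    'a process set \<Rightarrow> ('a \<times> real) set \<Rightarrow> 'a process set" where
  "class_on M F D B = {X. \<exists>T Y. fundamental_coupled_seq M F D B X T Y}"

section \<open>Integrals of processes\<close>

text \<open>
  Integrability includes that \<open>H\<close> and \<open>A\<close> belong to the classes for which the integral is defined.
\<close>

definition integrable_wrt :: "'a measure \<Rightarrow> 'a process \<Rightarrow> 'a process \<Rightarrow> bool" where
  "integrable_wrt M H A \<longleftrightarrow> H \<in> measurable_processes M \<and> A \<in> fv_processes M \<and>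
     (AE \<omega> in M. \<forall>t\<ge>0. abs_path_integral (H \<omega>) (A \<omega>) t < \<infinity>)"

definition integral_process :: "'a process \<Rightarrow> 'a process \<Rightarrow> 'a process" where
  "integral_process H A = (\<lambda>\<omega> t. path_integral (H \<omega>) (A \<omega>) t)"

definition integrable_on_wrt :: "'a measure \<Rightarrow> (ennreal \<Rightarrow> 'a measure) \<Rightarrow>
    ('a \<times> real) set \<Rightarrow> 'a process \<Rightarrow> 'a process \<Rightarrow> bool" where
  "integrable_on_wrt M F B H A \<longleftrightarrow>
     H \<in> class_on M F (measurable_processes M) B \<and> A \<in> class_on M F (fv_processes M) B \<and>
     (AE \<omega> in M. \<forall>t. (\<omega>, t) \<in> B \<longrightarrow> abs_path_integral (H \<omega>) (A \<omega>) t < \<infinity>)"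

definition integral_on :: "('a \<times> real) set \<Rightarrow> 'a process \<Rightarrow> 'a process \<Rightarrow> 'a process" where
  "integral_on B H A = restr (\<lambda>\<omega> t. path_integral (H \<omega>) (A \<omega>) t) B"

end

theory Submission
  imports Defs
begin

text \<open>
  Everything is reduced to single paths. On \<open>[0, t]\<close>, finitely many paths of finite variation have
  densities \<open>k\<close> with respect to one finite measure \<open>\<mu>\<close> (Radon-Nikodym), and a path with density \<open>k\<close> has
  variation measure \<open>\<bar>k\<bar> d\<mu>\<close>. Hence \<open>\<integral> h df = \<integral> h k d\<mu>\<close> and \<open>\<integral> \<bar>h\<bar> \<bar>df\<bar> = \<integral> \<bar>h k\<bar> d\<mu>\<close>, so linearity
  is linearity of \<open>\<mu>\<close>-integrals, and \<open>\<integral>\<^bsub>[0,\<cdot>]\<^esub> h df\<close> has density \<open>h k\<close>, which gives associativity together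
  with the equivalence of the two integrability conditions. Adaptedness of the integral process follows
  from measurability of the variation, a supremum over uniform partitions by right-continuity.

  A process on \<open>B\<close> belongs to a class \<open>D\<^sup>B\<close> exactly if it belongs to \<open>D\<close> when stopped at each \<open>\<tau>\<^sub>n\<close>, and
  stopping commutes with integration; so each claim on \<open>B\<close> is the claim for the stopped processes.
\<close>

subsection \<open>The variation function of a path\<close>

text \<open>The Jordan decomposition is not linear: \<open>pos_measure\<close> of
  \<open>a * f + b * g\<close> is not assembled from those of \<open>f\<close> and \<open>g\<close>.
  Densities with respect to a common measure are linear, which is why they replace the Jordan parts.
  The price is to identify \<bar>k\<bar> d\<mu> with the variation, a supremum over partitions;
  \<open>integral_le_var_fun\<close> is the harder inequality. On \<open>B\<close> the obstacle is
  that membership in \<open>class_on\<close> only supplies some coupled sequence, whose times are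
  unrelated to \<open>\<tau>\<close> and whose processes match only up to null sets. The process
  stopped at \<open>\<tau> n\<close> is recovered as a pathwise limit. Measurability passes to the
  limit; finite variation does not in general, and is taken instead from the fact that on each
  [0, t] the sequence is eventually constant. Path properties hold almost surely only, so versions
  are changed repeatedly, relying on completeness and on null sets belonging to the filtration.
  Values at negative times are arbitrary, whereas Stieltjes measures live on the whole line; this is
  the origin of the recurring \<open>max 0 s\<close>.\<close>

definition partition_upto :: "(nat \<Rightarrow> real) \<Rightarrow> nat \<Rightarrow> real \<Rightarrow> bool" where
  "partition_upto p n t \<longleftrightarrow> p 0 = 0 \<and> p n = t \<and> (\<forall>i<n. p i \<le> p (Suc i))"

definition var_sum :: "(real \<Rightarrow> real) \<Rightarrow> (nat \<Rightarrow> real) \<Rightarrow> nat \<Rightarrow> real" where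
  "var_sum f p n = (\<Sum>i<n. \<bar>f (p (Suc i)) - f (p i)\<bar>)"

lemma partition_upto_mono:
  assumes "partition_upto p n t" "i \<le> j" "j \<le> n"
  shows "p i \<le> p j"
  using assms(2,3)
proof (induction j rule: dec_induct)
  case (step j)
  then have "p j \<le> p (Suc j)" using assms(1) by (auto simp: partition_upto_def)
  with step show ?case by auto
qed auto

lemma partition_upto_range:
  assumes "partition_upto p n t" "i \<le> n"
  shows "0 \<le> p i" "p i \<le> t"
  using partition_upto_mono[OF assms(1), of 0 i] partition_upto_mono[OF assms(1), of i n] assms
  by (auto simp: partition_upto_def)

lemma var_sum_nonneg: "0 \<le> var_sum f p n"
  by (simp add: var_sum_def sum_nonneg)

lemma partition_upto_exists: "0 \<le> t \<Longrightarrow> \<exists>p n. partition_upto p n t"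
  by (rule exI[of _ "\<lambda>i. if i = 0 then 0 else t"], rule exI[of _ 1]) (auto simp: partition_upto_def)

text \<open>The constant moves inside the supremum because there is at least one partition;
  afterwards each bound concerns a single real number per partition.\<close>

lemma path_variation_eq_SUP:
  assumes "0 \<le> t"
  shows "path_variation f t =
    (SUP (p, n) \<in> {(p, n). partition_upto p n t}. ennreal (\<bar>f 0\<bar> + var_sum f p n))"
proof -
  have "{(p, n). partition_upto p n t} \<noteq> {}" using partition_upto_exists[OF assms] by auto
  then have "ennreal \<bar>f 0\<bar> + (SUP (p, n) \<in> {(p, n). partition_upto p n t}. ennreal (var_sum f p n))
    = (SUP (p, n) \<in> {(p, n). partition_upto p n t}. ennreal (\<bar>f 0\<bar> + var_sum f p n))"
    using ennreal_SUP_add_right[of "{(p, n). partition_upto p n t}" "ennreal \<bar>f 0\<bar>"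
        "\<lambda>(p, n). ennreal (var_sum f p n)"]
    by (auto simp: var_sum_nonneg intro!: SUP_cong)
  then show ?thesis
    unfolding path_variation_def var_sum_def partition_upto_def
    by (simp add: sum_nonneg flip: sum_ennreal)
qed

lemma path_variation_ge:
  assumes "partition_upto p n t"
  shows "ennreal (\<bar>f 0\<bar> + var_sum f p n) \<le> path_variation f t"
proof -
  have "0 \<le> t" using partition_upto_range[OF assms, of 0] by simp
  then show ?thesis
    unfolding path_variation_eq_SUP[OF \<open>0 \<le> t\<close>]
    by (intro SUP_upper2[of "(p, n)"]) (auto simp: assms)
qed

lemma path_variation_le:
  assumes "0 \<le> t" "\<And>p n. partition_upto p n t \<Longrightarrow> ennreal (\<bar>f 0\<bar> + var_sum f p n) \<le> C"
  shows "path_variation f t \<le> C"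
  unfolding path_variation_eq_SUP[OF assms(1)] using assms(2) by (intro SUP_least) auto

lemma path_variation_cong:
  assumes "0 \<le> t" "\<And>s. 0 \<le> s \<Longrightarrow> s \<le> t \<Longrightarrow> f s = g s"
  shows "path_variation f t = path_variation g t"
proof -
  have "var_sum f p n = var_sum g p n" if "partition_upto p n t" for p n
    unfolding var_sum_def
    by (intro sum.cong refl) (simp add: assms(2) partition_upto_range[OF that])
  then show ?thesis
    unfolding path_variation_eq_SUP[OF assms(1)] using assms by (intro SUP_cong) auto
qed

lemma path_variation_0: "path_variation f 0 = ennreal \<bar>f 0\<bar>"
proof (rule antisym)
  show "path_variation f 0 \<le> ennreal \<bar>f 0\<bar>"
  proof (rule path_variation_le)
    fix p n assume p: "partition_upto p n 0"
    have "p i = 0" if "i \<le> n" for i using partition_upto_range[OF p that] by simp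
    then have "var_sum f p n = 0" by (auto simp: var_sum_def)
    then show "ennreal (\<bar>f 0\<bar> + var_sum f p n) \<le> ennreal \<bar>f 0\<bar>" by simp
  qed simp
  have "partition_upto (\<lambda>_. 0) 0 0" by (simp add: partition_upto_def)
  from path_variation_ge[OF this, of f]
  show "ennreal \<bar>f 0\<bar> \<le> path_variation f 0" by (simp add: var_sum_def)
qed

text \<open>Splitting every partition point \<open>p\<close> into \<open>min p r\<close> and \<open>max p r\<close> replaces the usual insertion
  of \<open>r\<close> into the partition.\<close>

lemma path_variation_le_add:
  assumes "0 \<le> r" "r \<le> s"
    and W: "\<And>x y. r \<le> x \<Longrightarrow> x \<le> y \<Longrightarrow> y \<le> s \<Longrightarrow> \<bar>f y - f x\<bar> \<le> W y - W x"
  shows "path_variation f s \<le> path_variation f r + ennreal (W s - W r)"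
proof (rule path_variation_le)
  fix p n assume p: "partition_upto p n s"
  define q where "q i = min (p i) r" for i
  define m where "m i = max (p i) r" for i
  have q: "partition_upto q n r"
    using p assms(1,2) by (auto simp: partition_upto_def q_def min_absorb2 intro!: min.mono)
  have step: "\<bar>f (p (Suc i)) - f (p i)\<bar> \<le> \<bar>f (q (Suc i)) - f (q i)\<bar> + (W (m (Suc i)) - W (m i))"
    if i: "i < n" for i
  proof -
    \<comment> \<open>One of \<open>q j\<close> and \<open>m j\<close> is \<open>p j\<close>, the
      other is \<open>r\<close>.\<close>
    have "f (p j) = f (q j) + f (m j) - f r" for j by (simp add: q_def m_def min_def max_def)
    then have "f (p (Suc i)) - f (p i) = (f (q (Suc i)) - f (q i)) + (f (m (Suc i)) - f (m i))"
      by simp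
    moreover have "\<bar>f (m (Suc i)) - f (m i)\<bar> \<le> W (m (Suc i)) - W (m i)"
      using partition_upto_mono[OF p, of i "Suc i"] partition_upto_range[OF p, of "Suc i"] i assms(2)
      by (intro W) (auto simp: m_def)
    ultimately show ?thesis by linarith
  qed
  have "var_sum f p n \<le> (\<Sum>i<n. \<bar>f (q (Suc i)) - f (q i)\<bar> + (W (m (Suc i)) - W (m i)))"
    unfolding var_sum_def using step by (intro sum_mono) auto
  also have "\<dots> = var_sum f q n + (W (m n) - W (m 0))"
    by (simp add: sum.distrib var_sum_def sum_lessThan_telescope[of "\<lambda>i. W (m i)"])
  also have "W (m n) - W (m 0) = W s - W r"
    using p assms(1,2) by (simp add: m_def partition_upto_def max_def)
  finally have "ennreal (\<bar>f 0\<bar> + var_sum f p n) \<le> ennreal ((\<bar>f 0\<bar> + var_sum f q n) + (W s - W r))"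
    by (intro ennreal_leI) simp
  also have "\<dots> = ennreal (\<bar>f 0\<bar> + var_sum f q n) + ennreal (W s - W r)"
    using W[of r s] assms(2) var_sum_nonneg[of f q n] by (intro ennreal_plus) (auto intro: add_nonneg_nonneg)
  also have "\<dots> \<le> path_variation f r + ennreal (W s - W r)"
    by (intro add_right_mono path_variation_ge q)
  finally show "ennreal (\<bar>f 0\<bar> + var_sum f p n) \<le> path_variation f r + ennreal (W s - W r)" .
qed (use assms in auto)

text \<open>Appending \<open>s\<close> to a partition of [0, r] gives a partition of [0, s] whose
  sum grows by the last increment.\<close>

lemma path_variation_add_le:
  assumes "0 \<le> r" "r \<le> s"
  shows "path_variation f r + ennreal \<bar>f s - f r\<bar> \<le> path_variation f s"
proof -
  have ne: "{(p, n). partition_upto p n r} \<noteq> {}" using partition_upto_exists[OF assms(1)] by auto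
  have "ennreal (\<bar>f 0\<bar> + var_sum f p n) + ennreal \<bar>f s - f r\<bar> \<le> path_variation f s"
    if p: "partition_upto p n r" for p n
  proof -
    define q where "q = p(Suc n := s)"
    have "partition_upto q (Suc n) s"
      using p assms(2) by (auto simp: partition_upto_def q_def less_Suc_eq)
    moreover have "var_sum f q (Suc n) = var_sum f p n + \<bar>f s - f r\<bar>"
      using p by (auto simp: var_sum_def q_def partition_upto_def intro!: sum.cong)
    ultimately show ?thesis
      using path_variation_ge[of q "Suc n" s f] var_sum_nonneg[of f p n]
      by (simp flip: ennreal_plus add: add.assoc)
  qed
  then show ?thesis
    unfolding path_variation_eq_SUP[OF assms(1)]
    by (subst ennreal_SUP_add_left[symmetric, OF ne]) (auto intro!: SUP_least)
qed

text \<open>Free of the horizon \<open>t\<close>: truncation is recovered by inserting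
  \<open>min s t\<close>, so monotonicity and right-continuity are proved once for all
  horizons.\<close>

definition var_fun :: "(real \<Rightarrow> real) \<Rightarrow> real \<Rightarrow> real" where
  "var_fun f s = (if s < 0 then 0 else enn2real (path_variation f s))"

lemma variation_upto_eq: "0 \<le> t \<Longrightarrow> variation_upto f t s = var_fun f (min s t)"
  by (auto simp: variation_upto_def var_fun_def)

lemma var_fun_nonneg: "0 \<le> var_fun f s"
  by (simp add: var_fun_def)

lemma var_fun_0: "var_fun f 0 = \<bar>f 0\<bar>"
  by (simp add: var_fun_def path_variation_0)

lemma ennreal_var_fun: "fv_path f \<Longrightarrow> 0 \<le> s \<Longrightarrow> ennreal (var_fun f s) = path_variation f s"
  by (auto simp: var_fun_def fv_path_def)

lemma var_fun_incr:
  assumes "fv_path f" "0 \<le> r" "r \<le> s"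
  shows "\<bar>f s - f r\<bar> \<le> var_fun f s - var_fun f r"
proof -
  have "ennreal (var_fun f r) + ennreal \<bar>f s - f r\<bar> \<le> ennreal (var_fun f s)"
    using path_variation_add_le[OF assms(2,3), of f] assms by (simp add: ennreal_var_fun)
  then have "ennreal (var_fun f r + \<bar>f s - f r\<bar>) \<le> ennreal (var_fun f s)"
    by (simp add: var_fun_nonneg)
  then have "var_fun f r + \<bar>f s - f r\<bar> \<le> var_fun f s"
    by (subst (asm) ennreal_le_iff) (simp_all add: var_fun_nonneg)
  then show ?thesis by simp
qed

lemma var_fun_mono: "fv_path f \<Longrightarrow> mono (var_fun f)"
proof (rule monoI)
  fix x y :: real assume "fv_path f" "x \<le> y"
  then show "var_fun f x \<le> var_fun f y"
    using var_fun_incr[of f x y] var_fun_nonneg[of f y] by (cases "x < 0") (auto simp: var_fun_def)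
qed

text \<open>The comparison function \<open>W\<close> stays free: it is later the right limit of the
  variation itself, and the integral of \<bar>k\<bar> for a density \<open>k\<close>.\<close>

lemma var_fun_le_add:
  assumes "fv_path f" "0 \<le> r" "r \<le> s"
    and W: "\<And>x y. r \<le> x \<Longrightarrow> x \<le> y \<Longrightarrow> y \<le> s \<Longrightarrow> \<bar>f y - f x\<bar> \<le> W y - W x"
  shows "var_fun f s - var_fun f r \<le> W s - W r"
proof -
  have "0 \<le> W s - W r" using W[of r s] assms(3) by linarith
  moreover have "ennreal (var_fun f s) \<le> ennreal (var_fun f r) + ennreal (W s - W r)"
    using path_variation_le_add[of r s f W] assms by (simp add: ennreal_var_fun)
  ultimately have "ennreal (var_fun f s) \<le> ennreal (var_fun f r + (W s - W r))"
    by (simp add: var_fun_nonneg)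
  then have "var_fun f s \<le> var_fun f r + (W s - W r)"
    using \<open>0 \<le> W s - W r\<close> var_fun_nonneg[of f r] by (subst (asm) ennreal_le_iff) simp_all
  then show ?thesis by simp
qed

text \<open>The filter \<open>at_right x\<close> excludes \<open>x\<close>, but the approximating
  sequences used below may hit their limit; such terms contribute distance 0.\<close>

lemma right_continuous_sequentially:
  fixes f :: "real \<Rightarrow> real"
  assumes "continuous (at_right x) f" "\<And>n. x \<le> r n" "r \<longlonglongrightarrow> x"
  shows "(\<lambda>n. f (r n)) \<longlonglongrightarrow> f x"
proof (rule tendstoI)
  fix e :: real assume "0 < e"
  have "(f \<longlongrightarrow> f x) (at_right x)" using assms(1) by (simp add: continuous_within)
  from tendstoD[OF this \<open>0 < e\<close>] obtain b where b: "x < b" "\<And>y. x < y \<Longrightarrow> y < b \<Longrightarrow> dist (f y) (f x) < e"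
    by (auto simp: eventually_at_right_field)
  have "\<forall>\<^sub>F n in sequentially. r n < b" using order_tendstoD(2)[OF assms(3) b(1)] .
  then show "\<forall>\<^sub>F n in sequentially. dist (f (r n)) (f x) < e"
  proof eventually_elim
    case (elim n)
    then show ?case using b(2)[of "r n"] assms(2)[of n] \<open>0 < e\<close> by (cases "r n = x") auto
  qed
qed

lemma fv_path_right_cont: "fv_path f \<Longrightarrow> 0 \<le> t \<Longrightarrow> continuous (at_right t) f"
  by (simp add: fv_path_def cadlag_def)

text \<open>The jump \<open>L - var_fun f\<close> of the right limit \<open>L\<close> is nondecreasing, because \<open>L\<close> also
  dominates the increments of \<open>f\<close>; it vanishes outside a countable set, hence everywhere.\<close>

lemma var_fun_right_cont:
  assumes f: "fv_path f"
  shows "continuous (at_right a) (var_fun f)"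
proof (cases "a < 0")
  case True
  have "\<forall>\<^sub>F s in at_right a. var_fun f s = 0"
    unfolding eventually_at_right_field using True by (intro exI[of _ 0]) (auto simp: var_fun_def)
  then have "(var_fun f \<longlongrightarrow> 0) (at_right a)" by (rule tendsto_eventually)
  then show ?thesis using True by (simp add: continuous_within var_fun_def)
next
  case False
  let ?V = "var_fun f"
  let ?d = "\<lambda>n. 1 / real (Suc n)"
  have mono: "mono ?V" by (rule var_fun_mono[OF f])
  have "\<exists>L. (\<lambda>n. ?V (x + ?d n)) \<longlonglongrightarrow> L" for x
  proof -
    have "decseq (\<lambda>n. ?V (x + ?d n))"
      unfolding decseq_def by (auto intro!: monoD[OF mono] divide_left_mono)
    then show ?thesis by (rule decseq_convergent[where B=0]) (auto simp: var_fun_nonneg)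
  qed
  then obtain L where L: "\<And>x. (\<lambda>n. ?V (x + ?d n)) \<longlonglongrightarrow> L x" by metis
  have d0: "(\<lambda>n. x + ?d n) \<longlonglongrightarrow> x" for x
    using tendsto_add[OF tendsto_const[of x] lim_1_over_n[where 'a=real, THEN LIMSEQ_Suc]] by simp
  have incr: "\<bar>f y - f x\<bar> \<le> L y - L x" if "0 \<le> x" "x \<le> y" for x y
  proof (rule LIMSEQ_le)
    show "(\<lambda>n. \<bar>f (y + ?d n) - f (x + ?d n)\<bar>) \<longlonglongrightarrow> \<bar>f y - f x\<bar>"
      using that d0 by (intro tendsto_diff tendsto_rabs right_continuous_sequentially[where f=f] fv_path_right_cont[OF f]) auto
    show "(\<lambda>n. ?V (y + ?d n) - ?V (x + ?d n)) \<longlonglongrightarrow> L y - L x"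
      by (intro tendsto_diff L)
    show "\<exists>N. \<forall>n\<ge>N. \<bar>f (y + ?d n) - f (x + ?d n)\<bar> \<le> ?V (y + ?d n) - ?V (x + ?d n)"
      using that by (intro exI[of _ 0] allI impI var_fun_incr[OF f]) auto
  qed
  have "countable {c. \<not> isCont ?V c}" using mono by (rule mono_ctble_discont)
  moreover have "uncountable {a<..<a + 1}" by (simp add: uncountable_open_interval)
  ultimately have "\<not> {a<..<a + 1} \<subseteq> {c. \<not> isCont ?V c}" using countable_subset by blast
  then obtain c where c: "a < c" "isCont ?V c" by auto
  have "(\<lambda>n. ?V (c + ?d n)) \<longlonglongrightarrow> ?V c" using c(2) d0 by (rule isCont_tendsto_compose)
  then have "L c = ?V c" using L LIMSEQ_unique by blast
  moreover have "?V c - ?V a \<le> L c - L a"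
    using False c incr by (intro var_fun_le_add[OF f]) auto
  ultimately have La: "L a \<le> ?V a" by simp
  show ?thesis
    unfolding continuous_within
  proof (rule order_tendstoI)
    fix e assume e: "e < ?V a"
    show "\<forall>\<^sub>F s in at_right a. e < ?V s"
      unfolding eventually_at_right_field using e monoD[OF mono, of a]
      by (intro exI[of _ "a + 1"]) (auto intro: less_le_trans)
  next
    fix e assume "?V a < e"
    then have "L a < e" using La by simp
    from order_tendstoD(2)[OF L this] obtain n where n: "?V (a + ?d n) < e"
      by (auto simp: eventually_sequentially)
    show "\<forall>\<^sub>F s in at_right a. ?V s < e"
      unfolding eventually_at_right_field
    proof (intro exI[of _ "a + ?d n"] conjI allI impI)
      fix s assume "a < s" "s < a + ?d n"
      then show "?V s < e" using n monoD[OF mono, of s "a + ?d n"] by linarith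
    qed simp
  qed
qed

text \<open>Moving each point of a partition up to the next grid point changes the sum by little, by
  right-continuity, and sums over grid points are dominated by the full grid sum. The gain is a
  countable supremum over deterministic times, which makes the variation measurable in
  \<omega>.\<close>

lemma path_variation_eq_SUP_uniform:
  assumes rc: "\<And>s. 0 \<le> s \<Longrightarrow> continuous (at_right s) f" and t: "0 \<le> t"
  shows "path_variation f t =
    (SUP m. ennreal (\<bar>f 0\<bar> + var_sum f (\<lambda>i. t * real i / real (Suc m)) (Suc m)))"
    (is "_ = (SUP m. ?S m)")
proof (rule antisym)
  show "(SUP m. ?S m) \<le> path_variation f t"
    by (intro SUP_least path_variation_ge)
       (use t in \<open>auto simp: partition_upto_def intro!: divide_right_mono mult_left_mono\<close>)
  show "path_variation f t \<le> (SUP m. ?S m)"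
  proof (cases "t = 0")
    case True
    have "path_variation f t = ?S 0" using True by (simp add: path_variation_0 var_sum_def)
    also have "\<dots> \<le> (SUP m. ?S m)" by (rule SUP_upper) simp
    finally show ?thesis .
  next
    case False
    with t have t: "0 < t" by simp
    show ?thesis
    proof (rule path_variation_le)
      fix p n assume p: "partition_upto p n t"
      \<comment> \<open>Index of the first grid point at or after \<open>p j\<close>. Rounding goes
        up because \<open>f\<close> is continuous from the right only.\<close>
      define k where "k m j = nat \<lceil>p j * real (Suc m) / t\<rceil>" for m j
      define r where "r m j = t * real (k m j) / real (Suc m)" for m j
      have k: "real (k m j) = of_int \<lceil>p j * real (Suc m) / t\<rceil>" if "j \<le> n" for m j
        using partition_upto_range[OF p that] t by (simp add: k_def of_nat_nat)
      have r_bd: "p j \<le> r m j" "r m j \<le> p j + t / real (Suc m)" if "j \<le> n" for m j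
      proof -
        define c where "c = real (Suc m)"
        have c: "0 < c" by (simp add: c_def)
        have "p j * c / t \<le> real (k m j)" "real (k m j) \<le> p j * c / t + 1"
          unfolding k[OF that] c_def by linarith+
        then have "p j * c \<le> t * real (k m j)" "t * real (k m j) \<le> p j * c + t"
          using t by (simp_all add: field_simps)
        then show "p j \<le> r m j" "r m j \<le> p j + t / real (Suc m)"
          using c unfolding r_def c_def[symmetric] by (simp_all add: field_simps)
      qed
      have r_lim: "(\<lambda>m. r m j) \<longlonglongrightarrow> p j" if "j \<le> n" for j
      proof (rule tendsto_sandwich[where f="\<lambda>_. p j" and h="\<lambda>m. p j + t / real (Suc m)"])
        show "(\<lambda>m. p j + t / real (Suc m)) \<longlonglongrightarrow> p j"
          using tendsto_add[OF tendsto_const[of "p j"] lim_const_over_n[where 'a=real, THEN LIMSEQ_Suc]] by simp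
        show "\<forall>\<^sub>F m in sequentially. p j \<le> r m j"
          "\<forall>\<^sub>F m in sequentially. r m j \<le> p j + t / real (Suc m)"
          by (rule always_eventually, rule allI, rule r_bd, rule that)+
      qed simp
      have "(\<lambda>m. \<Sum>i<n. \<bar>f (r m (Suc i)) - f (r m i)\<bar>) \<longlonglongrightarrow> var_sum f p n"
        unfolding var_sum_def
        using partition_upto_range(1)[OF p]
        by (intro tendsto_sum tendsto_diff tendsto_rabs right_continuous_sequentially[where f=f] rc r_lim r_bd) auto
      then have lim: "(\<lambda>m. ennreal (\<bar>f 0\<bar> + (\<Sum>i<n. \<bar>f (r m (Suc i)) - f (r m i)\<bar>)))
        \<longlonglongrightarrow> ennreal (\<bar>f 0\<bar> + var_sum f p n)"
        by (intro tendsto_add tendsto_const tendsto_ennrealI)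
      have kmono: "k m i \<le> k m (Suc i)" if "i < n" for m i
        unfolding k_def using partition_upto_mono[OF p, of i "Suc i"] that t
        by (intro nat_mono ceiling_mono divide_right_mono mult_right_mono) auto
      have sums: "(\<Sum>i<j. \<bar>f (r m (Suc i)) - f (r m i)\<bar>) \<le>
        var_sum f (\<lambda>i. t * real i / real (Suc m)) (k m j)" if "j \<le> n" for m j
        using that
      proof (induction j)
        case (Suc j)
        let ?u = "\<lambda>i. t * real i / real (Suc m)"
        \<comment> \<open>Triangle inequality along the grid points between two consecutive rounded
          points.\<close>
        have "\<bar>f (?u l') - f (?u l)\<bar> \<le> (\<Sum>i\<in>{l..<l'}. \<bar>f (?u (Suc i)) - f (?u i)\<bar>)" if "l \<le> l'" for l l'
        proof -
          have "f (?u l') - f (?u l) = (\<Sum>i\<in>{l..<l'}. f (?u (Suc i)) - f (?u i))"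
            using sum_Suc_diff'[OF that, of "\<lambda>i. f (?u i)"] by simp
          then show ?thesis by (simp only: sum_abs)
        qed
        from this[OF kmono[of j m]] Suc.prems
        have "\<bar>f (r m (Suc j)) - f (r m j)\<bar> \<le>
          (\<Sum>i\<in>{k m j..<k m (Suc j)}. \<bar>f (?u (Suc i)) - f (?u i)\<bar>)"
          by (simp add: r_def)
        moreover have "var_sum f ?u (k m (Suc j)) = var_sum f ?u (k m j) +
          (\<Sum>i\<in>{k m j..<k m (Suc j)}. \<bar>f (?u (Suc i)) - f (?u i)\<bar>)"
          using sum.atLeastLessThan_concat[of 0 "k m j" "k m (Suc j)" "\<lambda>i. \<bar>f (?u (Suc i)) - f (?u i)\<bar>"]
            kmono[of j m] Suc.prems unfolding var_sum_def lessThan_atLeast0 by linarith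
        ultimately show ?case using Suc by simp
      qed (simp add: var_sum_nonneg)
      \<comment> \<open>The endpoint \<open>t\<close> is itself on the grid, so rounding up never
        leaves [0, t].\<close>
      have "k m n = Suc m" for m using p t by (simp add: k_def partition_upto_def del: of_nat_Suc)
      then have "ennreal (\<bar>f 0\<bar> + (\<Sum>i<n. \<bar>f (r m (Suc i)) - f (r m i)\<bar>)) \<le> ?S m" for m
        using sums[of n m] by (intro ennreal_leI) simp
      also have "?S m \<le> (SUP m. ?S m)" for m by (rule SUP_upper) simp
      finally show "ennreal (\<bar>f 0\<bar> + var_sum f p n) \<le> (SUP m. ?S m)"
        by (intro LIMSEQ_le_const2[OF lim]) auto
    qed (use t in simp)
  qed
qed

subsection \<open>Stieltjes measures\<close>

definition stieltjes :: "(real \<Rightarrow> real) \<Rightarrow> real \<Rightarrow> bool" where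
  "stieltjes F t \<longleftrightarrow> mono F \<and> (\<forall>a. continuous (at_right a) F) \<and>
     (\<forall>s<0. F s = 0) \<and> (\<forall>s\<ge>t. F s = F t)"

text \<open>The limits of \<open>F\<close> at both ends of the line are attained, being 0 and
  \<open>F t\<close>; hence the total mass is finite and \<open>F\<close> is the distribution
  function.\<close>

lemma
  assumes "stieltjes F t"
  shows finite_borel_measure_stieltjes: "finite_borel_measure (interval_measure F)"
    and cdf_stieltjes: "cdf (interval_measure F) = F"
proof -
  have mono: "F x \<le> F y" if "x \<le> y" for x y
    using assms that by (auto simp: stieltjes_def dest: monoD)
  have rc: "continuous (at_right a) F" for a using assms by (auto simp: stieltjes_def)
  have "\<forall>\<^sub>F s in at_bot. F s = 0"
    using assms unfolding eventually_at_bot_linorder stieltjes_def by (intro exI[of _ "-1"]) auto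
  then have bot: "(F \<longlongrightarrow> 0) at_bot" by (rule tendsto_eventually)
  have "\<forall>\<^sub>F s in at_top. F s = F t"
    using assms unfolding eventually_at_top_linorder stieltjes_def by blast
  then have top: "(F \<longlongrightarrow> F t) at_top" by (rule tendsto_eventually)
  have "0 \<le> F t"
  proof -
    \<comment> \<open>The sign of \<open>t\<close> is not known, so the comparison point is taken
      below both \<open>t\<close> and 0.\<close>
    have "F (min t (-1)) = 0" using assms by (auto simp: stieltjes_def)
    then show ?thesis using mono[of "min t (-1)" t] by simp
  qed
  then show "finite_borel_measure (interval_measure F)"
    using finite_borel_measure_interval_measure[OF mono rc bot top] by simp
  have nonneg: "0 \<le> F x" for x
  proof -
    have "F (min x (-1)) = 0" using assms by (auto simp: stieltjes_def)
    then show ?thesis using mono[of "min x (-1)" x] by simp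
  qed
  show "cdf (interval_measure F) = F"
  proof
    fix x
    have "emeasure (interval_measure F) {..x} = ennreal (F x)"
      using emeasure_interval_measure_Iic[OF mono rc bot] by simp
    then show "cdf (interval_measure F) x = F x" by (simp add: cdf_def measure_def nonneg)
  qed
qed

lemma right_cont_min:
  fixes g :: "real \<Rightarrow> real"
  assumes "\<And>a. continuous (at_right a) g"
  shows "continuous (at_right a) (\<lambda>s. g (min s t))"
proof (cases "a < t")
  case True
  have "\<forall>\<^sub>F s in at_right a. g s = g (min s t)"
    unfolding eventually_at_right_field using True by (intro exI[of _ t]) auto
  moreover have "(g \<longlongrightarrow> g a) (at_right a)" using assms by (simp add: continuous_within)
  ultimately have "((\<lambda>s. g (min s t)) \<longlongrightarrow> g a) (at_right a)"
    by (rule Lim_transform_eventually[rotated])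
  then show ?thesis using True by (simp add: continuous_within)
next
  case False
  have "\<forall>\<^sub>F s in at_right a. g (min s t) = g t"
    unfolding eventually_at_right_field using False by (intro exI[of _ "a + 1"]) (auto simp: min_def)
  then have "((\<lambda>s. g (min s t)) \<longlongrightarrow> g t) (at_right a)" by (rule tendsto_eventually)
  then show ?thesis using False by (simp add: continuous_within min_absorb2)
qed

text \<open>The horizon-free form of \<open>path_upto\<close>, matching \<open>var_fun\<close>; its
  jump at 0 carries the mass \<open>f 0\<close>.\<close>

definition zero_ext :: "(real \<Rightarrow> real) \<Rightarrow> real \<Rightarrow> real" where
  "zero_ext f s = (if s < 0 then 0 else f s)"

lemma path_upto_eq: "0 \<le> t \<Longrightarrow> path_upto f t s = zero_ext f (min s t)"
  by (auto simp: path_upto_def zero_ext_def)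

text \<open>Across 0 the increment is the full value \<open>f y\<close>. It is still dominated
  because the variation starts at \<bar>f 0\<bar> rather than at 0.\<close>

lemma zero_ext_incr:
  assumes "fv_path f" "x \<le> y"
  shows "\<bar>zero_ext f y - zero_ext f x\<bar> \<le> var_fun f y - var_fun f x"
proof (cases "x < 0")
  case True
  show ?thesis
  proof (cases "y < 0")
    case False
    then have "\<bar>f y - f 0\<bar> \<le> var_fun f y - var_fun f 0" by (intro var_fun_incr assms) auto
    then show ?thesis using True False by (simp add: zero_ext_def var_fun_0) (simp add: var_fun_def)
  qed (use True in \<open>simp add: zero_ext_def var_fun_def\<close>)
qed (use assms var_fun_incr[of f x y] in \<open>simp add: zero_ext_def\<close>)

lemma zero_ext_right_cont:
  assumes "fv_path f"
  shows "continuous (at_right a) (zero_ext f)"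
proof (cases "a < 0")
  case True
  have "\<forall>\<^sub>F s in at_right a. zero_ext f s = 0"
    unfolding eventually_at_right_field using True by (intro exI[of _ 0]) (auto simp: zero_ext_def)
  then have "(zero_ext f \<longlongrightarrow> 0) (at_right a)" by (rule tendsto_eventually)
  then show ?thesis using True by (simp add: continuous_within zero_ext_def)
next
  case False
  have "\<forall>\<^sub>F s in at_right a. f s = zero_ext f s"
    unfolding eventually_at_right_field using False by (intro exI[of _ "a + 1"]) (auto simp: zero_ext_def)
  moreover have "(f \<longlongrightarrow> f a) (at_right a)"
    using fv_path_right_cont[OF assms, of a] False by (simp add: continuous_within)
  ultimately have "(zero_ext f \<longlongrightarrow> f a) (at_right a)"
    by (rule Lim_transform_eventually[rotated])
  then show ?thesis using False by (simp add: continuous_within zero_ext_def)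
qed

text \<open>Covers all three distribution functions at once: \<open>a = 1\<close>,
  \<open>c = 0\<close> for the variation, and \<open>a = 1/2\<close>, \<open>c = 1\<close> or
  \<open>c = -1\<close> for the Jordan parts. Monotonicity rests on \<bar>c\<bar> \<le> 1, as
  increments of the path are bounded by those of the variation.\<close>

lemma stieltjes_combination:
  assumes f: "fv_path f" and "0 \<le> t" "0 \<le> a" "\<bar>c\<bar> \<le> 1"
  shows "stieltjes (\<lambda>s. a * (var_fun f (min s t) + c * zero_ext f (min s t))) t"
  unfolding stieltjes_def
proof (intro conjI allI impI)
  show "mono (\<lambda>s. a * (var_fun f (min s t) + c * zero_ext f (min s t)))"
  proof (rule monoI)
    fix x y :: real assume "x \<le> y"
    define d where "d = zero_ext f (min y t) - zero_ext f (min x t)"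
    have "\<bar>d\<bar> \<le> var_fun f (min y t) - var_fun f (min x t)"
      unfolding d_def using \<open>x \<le> y\<close> by (intro zero_ext_incr f) auto
    moreover have "\<bar>c * d\<bar> \<le> 1 * \<bar>d\<bar>"
      unfolding abs_mult by (intro mult_right_mono assms) auto
    ultimately have "var_fun f (min x t) - var_fun f (min y t) \<le> c * d"
      by linarith
    then have "var_fun f (min x t) + c * zero_ext f (min x t) \<le> var_fun f (min y t) + c * zero_ext f (min y t)"
      by (simp add: d_def algebra_simps)
    then show "a * (var_fun f (min x t) + c * zero_ext f (min x t)) \<le>
      a * (var_fun f (min y t) + c * zero_ext f (min y t))"
      using assms by (intro mult_left_mono)
  qed
  show "continuous (at_right x) (\<lambda>s. a * (var_fun f (min s t) + c * zero_ext f (min s t)))" for x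
    using right_cont_min[OF var_fun_right_cont[OF f], of x t]
      right_cont_min[OF zero_ext_right_cont[OF f], of x t]
    by (intro continuous_intros)
qed (use assms in \<open>auto simp: var_fun_def zero_ext_def min_def\<close>)

lemma
  assumes f: "fv_path f" and t: "0 \<le> t"
  shows finite_borel_abs_measure: "finite_borel_measure (abs_measure f t)"
    and finite_borel_pos_measure: "finite_borel_measure (pos_measure f t)"
    and finite_borel_neg_measure: "finite_borel_measure (neg_measure f t)"
    and cdf_abs_measure: "cdf (abs_measure f t) s = var_fun f (min s t)"
    and cdf_pos_measure: "cdf (pos_measure f t) s = (var_fun f (min s t) + zero_ext f (min s t)) / 2"
    and cdf_neg_measure: "cdf (neg_measure f t) s = (var_fun f (min s t) - zero_ext f (min s t)) / 2"
proof -
  have eqs: "abs_measure f t = interval_measure (\<lambda>s. 1 * (var_fun f (min s t) + 0 * zero_ext f (min s t)))"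
    "pos_measure f t = interval_measure (\<lambda>s. 1 / 2 * (var_fun f (min s t) + 1 * zero_ext f (min s t)))"
    "neg_measure f t = interval_measure (\<lambda>s. 1 / 2 * (var_fun f (min s t) + (-1) * zero_ext f (min s t)))"
    unfolding abs_measure_def pos_measure_def neg_measure_def
    using t by (auto simp: variation_upto_eq path_upto_eq intro!: arg_cong[where f=interval_measure])
  note S = stieltjes_combination[OF f t]
  show "finite_borel_measure (abs_measure f t)" "finite_borel_measure (pos_measure f t)"
    "finite_borel_measure (neg_measure f t)"
    unfolding eqs by (rule finite_borel_measure_stieltjes, rule S, simp, simp)+
  show "cdf (abs_measure f t) s = var_fun f (min s t)"
    "cdf (pos_measure f t) s = (var_fun f (min s t) + zero_ext f (min s t)) / 2"
    "cdf (neg_measure f t) s = (var_fun f (min s t) - zero_ext f (min s t)) / 2"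
    unfolding eqs by (subst cdf_stieltjes, rule S, simp, simp, simp)+
qed

text \<open>A distribution function vanishing below 0 leaves no mass on the negative half-line, as
  its left limit at 0 shows.\<close>

lemma (in finite_borel_measure) measure_Icc_0:
  assumes "\<And>s. s < 0 \<Longrightarrow> cdf M s = 0" "0 \<le> s"
  shows "measure M {0..s} = cdf M s"
proof -
  have "\<forall>\<^sub>F x in at_left 0. cdf M x = 0"
    unfolding eventually_at_left_field using assms(1) by (intro exI[of _ "-1"]) auto
  then have "(cdf M \<longlongrightarrow> 0) (at_left 0)" by (rule tendsto_eventually)
  then have "measure M {..<0} = 0"
    using cdf_at_left[of 0] by (intro tendsto_unique[OF trivial_limit_at_left_real]) auto
  moreover have "measure M {..s} = measure M {..<0} + measure M {0..s}"
    using assms(2) by (subst finite_measure_Union[symmetric]) (auto intro!: arg_cong[where f="measure M"])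
  ultimately show ?thesis by (simp add: cdf_def)
qed

subsection \<open>Densities of finite measures on the line\<close>

definition plus_measure :: "real measure \<Rightarrow> real measure \<Rightarrow> real measure" where
  "plus_measure M N = measure_of UNIV (sets borel) (\<lambda>A. emeasure M A + emeasure N A)"

lemma sets_plus_measure [simp]: "sets (plus_measure M N) = sets borel"
  unfolding plus_measure_def using sets.sigma_sets_eq[of "borel :: real measure"]
  by (simp add: sets_measure_of)

lemma emeasure_plus_measure:
  assumes "finite_borel_measure M" "finite_borel_measure N" "A \<in> sets borel"
  shows "emeasure (plus_measure M N) A = emeasure M A + emeasure N A"
proof -
  note [simp] = assms(1,2)[THEN finite_borel_measure.M_is_borel]
  have "countably_additive (sets (plus_measure M N)) (\<lambda>A. emeasure M A + emeasure N A)"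
  proof (rule countably_additiveI)
    fix D :: "nat \<Rightarrow> real set"
    assume D: "range D \<subseteq> sets (plus_measure M N)" "disjoint_family D" 
    then have "(\<Sum>i. emeasure M (D i) + emeasure N (D i)) = (\<Sum>i. emeasure M (D i)) + (\<Sum>i. emeasure N (D i))"
      by (intro suminf_add[symmetric]) auto
    also have "\<dots> = emeasure M (\<Union>i. D i) + emeasure N (\<Union>i. D i)"
      using D by (simp add: suminf_emeasure)
    finally show "(\<Sum>i. emeasure M (D i) + emeasure N (D i)) = emeasure M (\<Union>i. D i) + emeasure N (\<Union>i. D i)" .
  qed
  then show ?thesis
    using assms(3) by (intro emeasure_measure_of[OF plus_measure_def]) (auto simp: positive_def)
qed

lemma finite_borel_plus_measure:
  assumes "finite_borel_measure M" "finite_borel_measure N"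
  shows "finite_borel_measure (plus_measure M N)"
proof -
  interpret M: finite_borel_measure M by fact
  interpret N: finite_borel_measure N by fact
  have "space (plus_measure M N) = UNIV"
    using sets_eq_imp_space_eq[OF sets_plus_measure[of M N]] by simp
  then have "emeasure (plus_measure M N) (space (plus_measure M N)) \<noteq> \<infinity>"
    by (simp add: emeasure_plus_measure[OF assms] M.emeasure_eq_measure N.emeasure_eq_measure)
  then show ?thesis
    by (intro finite_borel_measure.intro finite_measureI finite_borel_measure_axioms.intro) auto
qed

text \<open>Domination yields absolute continuity. The Radon-Nikodym derivative can be taken
  real-valued and integrable because \<open>P\<close> is finite.\<close>

lemma dominated_density:
  assumes "finite_borel_measure \<nu>" "finite_borel_measure P"
    and le: "\<And>A. A \<in> sets borel \<Longrightarrow> emeasure P A \<le> emeasure \<nu> A"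
  obtains p where "p \<in> borel_measurable borel" "\<And>x. 0 \<le> p x" "integrable \<nu> p"
    "P = density \<nu> (\<lambda>x. ennreal (p x))"
proof -
  interpret nu: finite_borel_measure \<nu> by fact
  interpret P: finite_borel_measure P by fact
  have sets: "sets P = sets \<nu>" by (simp add: nu.M_is_borel P.M_is_borel)
  have ac: "absolutely_continuous \<nu> P"
  proof (unfold absolutely_continuous_def, rule subsetI)
    fix N assume "N \<in> null_sets \<nu>"
    then have "emeasure \<nu> N = 0" "N \<in> sets borel" by (auto simp: null_sets_def nu.M_is_borel)
    then show "N \<in> null_sets P" using le[of N] by (auto simp: null_sets_def P.M_is_borel)
  qed
  obtain D where D: "D \<in> borel_measurable \<nu>" "AE x in \<nu>. RN_deriv \<nu> P x = ennreal (D x)" "\<And>x. 0 \<le> D x"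
    using nu.real_RN_deriv[OF P.finite_measure_axioms ac sets] by metis
  have Pd: "P = density \<nu> (\<lambda>x. ennreal (D x))"
  proof -
    have "density \<nu> (RN_deriv \<nu> P) = density \<nu> (\<lambda>x. ennreal (D x))"
      using D(1,2) by (intro density_cong) auto
    then show ?thesis using nu.density_RN_deriv[OF ac sets] by simp
  qed
  have "(\<integral>\<^sup>+x. ennreal (D x) \<partial>\<nu>) = emeasure P (space \<nu>)"
    unfolding Pd using D by (subst emeasure_density) (auto intro!: nn_integral_cong)
  then have "integrable \<nu> D"
    using D P.emeasure_eq_measure by (intro integrableI_nonneg) auto
  moreover have "D \<in> borel_measurable borel"
    using D(1) unfolding measurable_cong_sets[OF nu.M_is_borel refl] .
  ultimately show ?thesis using D(3) Pd by (intro that)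
qed

lemma (in finite_borel_measure)
  assumes g: "integrable M g" "\<And>x. 0 \<le> g x"
  shows finite_borel_density: "finite_borel_measure (density M (\<lambda>x. ennreal (g x)))"
    and measure_density_eq_integral:
      "A \<in> sets borel \<Longrightarrow> measure (density M (\<lambda>x. ennreal (g x))) A = (\<integral>x. g x * indicator A x \<partial>M)"
proof -
  have em: "emeasure (density M (\<lambda>x. ennreal (g x))) A = ennreal (\<integral>x. g x * indicator A x \<partial>M)"
    if "A \<in> sets borel" for A
  proof -
    have A: "A \<in> sets M" using that by auto
    have "emeasure (density M (\<lambda>x. ennreal (g x))) A = (\<integral>\<^sup>+x. ennreal (g x * indicator A x) \<partial>M)"
      using g A by (subst emeasure_density) (auto intro!: nn_integral_cong split: split_indicator)
    also have "\<dots> = ennreal (\<integral>x. g x * indicator A x \<partial>M)"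
      using g A by (intro nn_integral_eq_integral integrable_real_mult_indicator) auto
    finally show ?thesis .
  qed
  show "measure (density M (\<lambda>x. ennreal (g x))) A = (\<integral>x. g x * indicator A x \<partial>M)" if "A \<in> sets borel"
    using em[OF that] g by (simp add: measure_def)
  show "finite_borel_measure (density M (\<lambda>x. ennreal (g x)))"
    using em[of UNIV] M_is_borel borel_UNIV
    by (intro finite_borel_measure.intro finite_measureI finite_borel_measure_axioms.intro) auto
qed

lemma (in finite_borel_measure) integrable_indicator_mult:
  fixes u :: "real \<Rightarrow> real"
  shows "integrable M u \<Longrightarrow> A \<in> sets borel \<Longrightarrow> integrable M (\<lambda>x. u x * indicator A x)"
  by (intro integrable_real_mult_indicator) auto

text \<open>The positive and negative parts of \<open>u\<close> are densities of two finite measures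
  with the same distribution function. The measures coincide, hence so do the densities almost
  everywhere.\<close>

lemma (in finite_borel_measure) AE_zero_of_cdf_zero:
  fixes u :: "real \<Rightarrow> real"
  assumes u: "integrable M u" and 0: "\<And>s. (\<integral>x. u x * indicator {..s} x \<partial>M) = 0"
  shows "AE x in M. u x = 0"
proof -
  let ?P = "\<lambda>x. max 0 (u x)" and ?N = "\<lambda>x. max 0 (- u x)"
  have int: "integrable M ?P" "integrable M ?N" using u by auto
  have "density M (\<lambda>x. ennreal (?P x)) = density M (\<lambda>x. ennreal (?N x))"
  proof (rule cdf_unique')
    show "cdf (density M (\<lambda>x. ennreal (?P x))) = cdf (density M (\<lambda>x. ennreal (?N x)))"
    proof
      fix s
      have "(\<integral>x. ?P x * indicator {..s} x \<partial>M) - (\<integral>x. ?N x * indicator {..s} x \<partial>M) =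
        (\<integral>x. u x * indicator {..s} x \<partial>M)"
        using int
        by (subst Bochner_Integration.integral_diff[symmetric])
           (auto intro!: Bochner_Integration.integral_cong integrable_indicator_mult split: split_indicator)
      then show "cdf (density M (\<lambda>x. ennreal (?P x))) s = cdf (density M (\<lambda>x. ennreal (?N x))) s"
        using measure_density_eq_integral[OF int(1), of "{..s}"]
          measure_density_eq_integral[OF int(2), of "{..s}"] 0[of s]
        by (simp add: cdf_def)
    qed
  qed (use finite_borel_density[OF int(1)] finite_borel_density[OF int(2)] in auto)
  then have "AE x in M. ennreal (?P x) = ennreal (?N x)"
    using int by (subst (asm) density_unique_iff) (auto simp del: ennreal_max_0)
  then show ?thesis
  proof eventually_elim
    case (elim x)
    then have "?P x = ?N x" by (subst (asm) ennreal_inj) auto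
    then show ?case by auto
  qed
qed

subsection \<open>Paths of finite variation as signed measures\<close>

text \<open>The signed Stieltjes measure of \<open>f\<close> on \<open>[0, t]\<close> is \<open>k d\<mu>\<close>.\<close>

definition path_density :: "real measure \<Rightarrow> (real \<Rightarrow> real) \<Rightarrow> (real \<Rightarrow> real) \<Rightarrow> real \<Rightarrow> bool" where
  "path_density \<mu> k f t \<longleftrightarrow> finite_borel_measure \<mu> \<and> integrable \<mu> k \<and>
     (\<forall>s. 0 \<le> s \<and> s \<le> t \<longrightarrow> f s = (\<integral>x. k x * indicator {0..s} x \<partial>\<mu>))"

lemma path_density_subinterval: "path_density \<mu> k f t \<Longrightarrow> s \<le> t \<Longrightarrow> path_density \<mu> k f s"
  by (auto simp: path_density_def)

lemma path_density_cdf: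
  assumes "path_density \<mu> k f t" "0 \<le> t"
  shows "zero_ext f (min s t) = (\<integral>x. (k x * indicator {0..t} x) * indicator {..s} x \<partial>\<mu>)"
proof (cases "s < 0")
  case True
  then have "(\<lambda>x. (k x * indicator {0..t} x) * indicator {..s} x) = (\<lambda>x. 0)"
    by (auto split: split_indicator)
  then show ?thesis using True by (simp add: zero_ext_def)
next
  case False
  then have "zero_ext f (min s t) = (\<integral>x. k x * indicator {0..min s t} x \<partial>\<mu>)"
    using assms by (auto simp: zero_ext_def path_density_def)
  also have "\<dots> = (\<integral>x. (k x * indicator {0..t} x) * indicator {..s} x \<partial>\<mu>)"
    by (intro Bochner_Integration.integral_cong) (auto split: split_indicator)
  finally show ?thesis .
qed

text \<open>Increments of \<open>f\<close> are integrals of \<open>k\<close> over half-open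
  intervals, so the integral of \<bar>k\<bar> dominates them; the mass at 0 is compared
  separately.\<close>

lemma var_fun_le_integral:
  assumes d: "path_density \<mu> k f t" and f: "fv_path f" and t: "0 \<le> t" "0 \<le> s" "s \<le> t"
  shows "var_fun f s \<le> (\<integral>x. \<bar>k x\<bar> * indicator {0..s} x \<partial>\<mu>)"
proof -
  interpret finite_borel_measure \<mu> using d by (simp add: path_density_def)
  have k: "integrable \<mu> k" using d by (simp add: path_density_def)
  have fs: "f r = (\<integral>x. k x * indicator {0..r} x \<partial>\<mu>)" if "0 \<le> r" "r \<le> s" for r
    using d that t by (auto simp: path_density_def)
  define C where "C r = (\<integral>x. \<bar>k x\<bar> * indicator {0..r} x \<partial>\<mu>)" for r
  have ka: "integrable \<mu> (\<lambda>x. \<bar>k x\<bar>)" using k by auto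
  have "var_fun f s - var_fun f 0 \<le> C s - C 0"
  proof (rule var_fun_le_add[OF f])
    fix x y assume xy: "0 \<le> x" "x \<le> y" "y \<le> s"
    have "f y - f x = (\<integral>z. k z * indicator {x<..y} z \<partial>\<mu>)"
      using xy by (subst (1 2) fs)
        (auto simp: k integrable_indicator_mult intro!: Bochner_Integration.integral_cong
          simp flip: Bochner_Integration.integral_diff split: split_indicator)
    also have "\<bar>\<dots>\<bar> \<le> (\<integral>z. \<bar>k z * indicator {x<..y} z\<bar> \<partial>\<mu>)" by (rule integral_abs_bound)
    also have "\<dots> = C y - C x"
      unfolding C_def using xy
      by (auto simp: ka integrable_indicator_mult intro!: Bochner_Integration.integral_cong
          simp flip: Bochner_Integration.integral_diff split: split_indicator)
    finally show "\<bar>f y - f x\<bar> \<le> C y - C x" .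
  qed (use t in auto)
  moreover have "var_fun f 0 \<le> C 0"
  proof -
    have "var_fun f 0 = \<bar>\<integral>x. k x * indicator {0..0} x \<partial>\<mu>\<bar>" using t by (simp add: var_fun_0 fs)
    also have "\<dots> \<le> (\<integral>x. \<bar>k x * indicator {0..0} x\<bar> \<partial>\<mu>)" by (rule integral_abs_bound)
    also have "\<dots> = C 0" by (simp add: C_def abs_mult)
    finally show ?thesis .
  qed
  ultimately show ?thesis by (simp add: C_def)
qed

text \<open>Let \<open>m\<close>, \<open>p\<close>, \<open>n\<close> be the densities of
  \<open>\<mu>\<close> and of the two Jordan measures with respect to one reference measure. Both
  \<open>m * k\<close> (cut to [0, t]) and \<open>p - n\<close> represent the path, hence agree
  almost everywhere. So \<open>m * \<bar>k\<bar> \<le> p + n\<close>, and \<open>p + n\<close> has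
  the variation as its distribution function.\<close>

lemma integral_le_var_fun:
  assumes d: "path_density \<mu> k f t" and f: "fv_path f" and t: "0 \<le> t"
  shows "(\<integral>x. \<bar>k x * indicator {0..t} x\<bar> * indicator {..s} x \<partial>\<mu>) \<le> var_fun f (min s t)"
proof -
  have \<mu>: "finite_borel_measure \<mu>" and k: "integrable \<mu> k" using d by (auto simp: path_density_def)
  let ?P = "pos_measure f t" and ?N = "neg_measure f t"
  have P: "finite_borel_measure ?P" and N: "finite_borel_measure ?N"
    by (intro finite_borel_pos_measure finite_borel_neg_measure f t)+
  \<comment> \<open>Neither \<open>\<mu>\<close> nor the Jordan measures are known to dominate the
    other, so the sum of all three is the reference measure.\<close>
  define \<nu> where "\<nu> = plus_measure (plus_measure ?P ?N) \<mu>"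
  note PN = finite_borel_plus_measure[OF P N]
  have \<nu>: "finite_borel_measure \<nu>" unfolding \<nu>_def by (intro finite_borel_plus_measure PN \<mu>)
  interpret \<mu>: finite_borel_measure \<mu> by fact
  interpret \<nu>: finite_borel_measure \<nu> by fact
  have em: "emeasure \<nu> A = emeasure ?P A + emeasure ?N A + emeasure \<mu> A" if "A \<in> sets borel" for A
    unfolding \<nu>_def using that by (simp add: emeasure_plus_measure P N PN \<mu>)
  obtain p where p: "p \<in> borel_measurable borel" "\<And>x. 0 \<le> p x" "integrable \<nu> p" "?P = density \<nu> (\<lambda>x. ennreal (p x))"
    by (rule dominated_density[OF \<nu> P]) (auto simp: em add.assoc)
  obtain n where n: "n \<in> borel_measurable borel" "\<And>x. 0 \<le> n x" "integrable \<nu> n" "?N = density \<nu> (\<lambda>x. ennreal (n x))"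
    by (rule dominated_density[OF \<nu> N]) (auto simp: em add.commute add.left_commute)
  obtain m where m: "m \<in> borel_measurable borel" "\<And>x. 0 \<le> m x" "integrable \<nu> m" "\<mu> = density \<nu> (\<lambda>x. ennreal (m x))"
    by (rule dominated_density[OF \<nu> \<mu>]) (auto simp: em add.commute add.left_commute)
  have [measurable]: "k \<in> borel_measurable borel"
    using borel_measurable_integrable[OF k] unfolding measurable_cong_sets[OF \<mu>.M_is_borel refl] .
  have [measurable_cong]: "sets \<nu> = sets borel" by (rule \<nu>.M_is_borel)
  note [measurable] = p(1) n(1) m(1)
  let ?k = "\<lambda>x. k x * indicator {0..t} x"
  have kt: "integrable \<mu> ?k" by (intro \<mu>.integrable_indicator_mult k) auto
  have int_dens: "integrable \<nu> (\<lambda>x. m x * g x)" "(\<integral>x. g x \<partial>\<mu>) = (\<integral>x. m x * g x \<partial>\<nu>)"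
    if "integrable \<mu> g" for g :: "real \<Rightarrow> real"
  proof -
    have [measurable]: "g \<in> borel_measurable borel"
      using borel_measurable_integrable[OF that] unfolding measurable_cong_sets[OF \<mu>.M_is_borel refl] .
    show "(\<integral>x. g x \<partial>\<mu>) = (\<integral>x. m x * g x \<partial>\<nu>)"
      by (subst m(4), subst integral_density) (auto simp: m(2))
    show "integrable \<nu> (\<lambda>x. m x * g x)"
      using that by (subst (asm) m(4), subst (asm) integrable_density) (auto simp: m(2))
  qed
  have ikm: "integrable \<nu> (\<lambda>x. m x * ?k x)" by (rule int_dens(1)[OF kt])
  have cdfP: "(\<integral>x. p x * indicator {..s} x \<partial>\<nu>) = (var_fun f (min s t) + zero_ext f (min s t)) / 2" for s
    using \<nu>.measure_density_eq_integral[OF p(3,2), of "{..s}"] cdf_pos_measure[OF f t, of s]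
    by (simp add: p(4) cdf_def)
  have cdfN: "(\<integral>x. n x * indicator {..s} x \<partial>\<nu>) = (var_fun f (min s t) - zero_ext f (min s t)) / 2" for s
    using \<nu>.measure_density_eq_integral[OF n(3,2), of "{..s}"] cdf_neg_measure[OF f t, of s]
    by (simp add: n(4) cdf_def)
  note ind = \<nu>.integrable_indicator_mult
  \<comment> \<open>Uniqueness of the signed density: both terms integrate over \<open>{..s}\<close>
    to \<open>zero_ext f (min s t)\<close>.\<close>
  have "AE x in \<nu>. m x * ?k x - (p x - n x) = 0"
  proof (rule \<nu>.AE_zero_of_cdf_zero)
    show "integrable \<nu> (\<lambda>x. m x * ?k x - (p x - n x))"
      using ikm p n by (intro Bochner_Integration.integrable_diff)
    fix s :: real
    have "(\<integral>x. (m x * ?k x - (p x - n x)) * indicator {..s} x \<partial>\<nu>) =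
      (\<integral>x. (m x * ?k x) * indicator {..s} x \<partial>\<nu>) -
      ((\<integral>x. p x * indicator {..s} x \<partial>\<nu>) - (\<integral>x. n x * indicator {..s} x \<partial>\<nu>))"
      using ind[OF ikm, of "{..s}"] ind[OF p(3), of "{..s}"] ind[OF n(3), of "{..s}"]
      by (simp add: left_diff_distrib)
    also have "(\<integral>x. (m x * ?k x) * indicator {..s} x \<partial>\<nu>) = zero_ext f (min s t)"
      unfolding path_density_cdf[OF d t] using int_dens(2)[OF \<mu>.integrable_indicator_mult[OF kt, of "{..s}"]]
      by (simp add: mult.assoc)
    finally show "(\<integral>x. (m x * ?k x - (p x - n x)) * indicator {..s} x \<partial>\<nu>) = 0"
      by (simp add: cdfP cdfN field_simps)
  qed
  then have ae: "AE x in \<nu>. m x * (\<bar>?k x\<bar> * indicator {..s} x) \<le> (p x + n x) * indicator {..s} x"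
  proof eventually_elim
    case (elim x)
    have "m x * \<bar>?k x\<bar> = \<bar>m x * ?k x\<bar>" by (simp add: abs_mult m(2))
    also have "\<dots> \<le> p x + n x" using elim p(2)[of x] n(2)[of x] by linarith
    finally show ?case by (auto split: split_indicator)
  qed
  have ik: "integrable \<mu> (\<lambda>x. \<bar>?k x\<bar> * indicator {..s} x)"
    by (intro \<mu>.integrable_indicator_mult integrable_abs kt) auto
  have "(\<integral>x. \<bar>?k x\<bar> * indicator {..s} x \<partial>\<mu>) = (\<integral>x. m x * (\<bar>?k x\<bar> * indicator {..s} x) \<partial>\<nu>)"
    by (rule int_dens(2)[OF ik])
  also have "\<dots> \<le> (\<integral>x. (p x + n x) * indicator {..s} x \<partial>\<nu>)"
    using ae by (intro integral_mono_AE int_dens(1)[OF ik] ind Bochner_Integration.integrable_add p n) auto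
  also have "\<dots> = (\<integral>x. p x * indicator {..s} x \<partial>\<nu>) + (\<integral>x. n x * indicator {..s} x \<partial>\<nu>)"
    using ind[OF p(3), of "{..s}"] ind[OF n(3), of "{..s}"] by (simp add: distrib_right)
  also have "\<dots> = var_fun f (min s t)"
    unfolding cdfP cdfN by (simp add: field_simps)
  finally show ?thesis .
qed

lemma var_fun_eq_integral:
  assumes d: "path_density \<mu> k f t" and f: "fv_path f" and t: "0 \<le> t"
  shows "var_fun f (min s t) = (\<integral>x. \<bar>k x * indicator {0..t} x\<bar> * indicator {..s} x \<partial>\<mu>)"
proof (rule antisym[OF _ integral_le_var_fun[OF assms]])
  show "var_fun f (min s t) \<le> (\<integral>x. \<bar>k x * indicator {0..t} x\<bar> * indicator {..s} x \<partial>\<mu>)"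
  proof (cases "s < 0")
    case False
    have "var_fun f (min s t) \<le> (\<integral>x. \<bar>k x\<bar> * indicator {0..min s t} x \<partial>\<mu>)"
      using False t by (intro var_fun_le_integral[OF d f]) auto
    also have "\<dots> = (\<integral>x. \<bar>k x * indicator {0..t} x\<bar> * indicator {..s} x \<partial>\<mu>)"
      by (intro Bochner_Integration.integral_cong) (auto split: split_indicator)
    finally show ?thesis .
  next
    case True
    then have "var_fun f (min s t) = 0" by (simp add: var_fun_def)
    then show ?thesis by (simp only:) (rule Bochner_Integration.integral_nonneg, simp)
  qed
qed

text \<open>Finite measures are compared through their distribution functions. Half the sum and half
  the difference of \<bar>k\<bar> and \<open>k\<close> are the positive and negative parts of
  \<open>k\<close>.\<close>

lemma
  assumes d: "path_density \<mu> k f t" and f: "fv_path f" and t: "0 \<le> t"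
  shows abs_measure_eq_density:
      "abs_measure f t = density \<mu> (\<lambda>x. ennreal \<bar>k x * indicator {0..t} x\<bar>)"
    and pos_measure_eq_density:
      "pos_measure f t = density \<mu> (\<lambda>x. ennreal (max 0 (k x * indicator {0..t} x)))"
    and neg_measure_eq_density:
      "neg_measure f t = density \<mu> (\<lambda>x. ennreal (max 0 (- (k x * indicator {0..t} x))))"
proof -
  interpret finite_borel_measure \<mu> using d by (simp add: path_density_def)
  let ?k = "\<lambda>x. k x * indicator {0..t} x"
  have k: "integrable \<mu> ?k" using d by (intro integrable_indicator_mult) (auto simp: path_density_def)
  have ik: "integrable \<mu> (\<lambda>x. ?k x * indicator {..s} x)" "integrable \<mu> (\<lambda>x. \<bar>?k x\<bar> * indicator {..s} x)" for s
    by (intro integrable_indicator_mult integrable_abs k; simp)+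
  have kabs: "integrable \<mu> (\<lambda>x. \<bar>?k x\<bar>)" and kpos: "integrable \<mu> (\<lambda>x. max 0 (?k x))"
    and kneg: "integrable \<mu> (\<lambda>x. max 0 (- ?k x))"
    using k by auto
  note V = var_fun_eq_integral[OF d f t] and Z = path_density_cdf[OF d t]
  show "abs_measure f t = density \<mu> (\<lambda>x. ennreal \<bar>?k x\<bar>)"
  proof (rule cdf_unique')
    show "cdf (abs_measure f t) = cdf (density \<mu> (\<lambda>x. ennreal \<bar>?k x\<bar>))"
    proof
      fix s
      have "cdf (density \<mu> (\<lambda>x. ennreal \<bar>?k x\<bar>)) s = (\<integral>x. \<bar>?k x\<bar> * indicator {..s} x \<partial>\<mu>)"
        unfolding cdf_def by (rule measure_density_eq_integral[OF kabs]) auto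
      then show "cdf (abs_measure f t) s = cdf (density \<mu> (\<lambda>x. ennreal \<bar>?k x\<bar>)) s"
        by (simp only: cdf_abs_measure[OF f t] V)
    qed
    show "finite_borel_measure (density \<mu> (\<lambda>x. ennreal \<bar>?k x\<bar>))"
      by (rule finite_borel_density[OF kabs]) simp
  qed (intro finite_borel_abs_measure f t)
  show "pos_measure f t = density \<mu> (\<lambda>x. ennreal (max 0 (?k x)))"
  proof (rule cdf_unique')
    show "cdf (pos_measure f t) = cdf (density \<mu> (\<lambda>x. ennreal (max 0 (?k x))))"
    proof
      fix s
      have "cdf (pos_measure f t) s =
        ((\<integral>x. \<bar>?k x\<bar> * indicator {..s} x \<partial>\<mu>) + (\<integral>x. ?k x * indicator {..s} x \<partial>\<mu>)) / 2"
        by (simp only: cdf_pos_measure[OF f t] V Z)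
      also have "\<dots> = (\<integral>x. (\<bar>?k x\<bar> * indicator {..s} x + ?k x * indicator {..s} x) / 2 \<partial>\<mu>)"
        using ik[of s] by simp
      also have "\<dots> = (\<integral>x. max 0 (?k x) * indicator {..s} x \<partial>\<mu>)"
        by (intro Bochner_Integration.integral_cong) (auto split: split_indicator)
      also have "\<dots> = cdf (density \<mu> (\<lambda>x. ennreal (max 0 (?k x)))) s"
        unfolding cdf_def by (rule measure_density_eq_integral[OF kpos, symmetric]) auto
      finally show "cdf (pos_measure f t) s = cdf (density \<mu> (\<lambda>x. ennreal (max 0 (?k x)))) s" .
    qed
    show "finite_borel_measure (density \<mu> (\<lambda>x. ennreal (max 0 (?k x))))"
      by (rule finite_borel_density[OF kpos]) simp
  qed (intro finite_borel_pos_measure f t)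
  show "neg_measure f t = density \<mu> (\<lambda>x. ennreal (max 0 (- ?k x)))"
  proof (rule cdf_unique')
    show "cdf (neg_measure f t) = cdf (density \<mu> (\<lambda>x. ennreal (max 0 (- ?k x))))"
    proof
      fix s
      have "cdf (neg_measure f t) s =
        ((\<integral>x. \<bar>?k x\<bar> * indicator {..s} x \<partial>\<mu>) - (\<integral>x. ?k x * indicator {..s} x \<partial>\<mu>)) / 2"
        by (simp only: cdf_neg_measure[OF f t] V Z)
      also have "\<dots> = (\<integral>x. (\<bar>?k x\<bar> * indicator {..s} x - ?k x * indicator {..s} x) / 2 \<partial>\<mu>)"
        using ik[of s] by simp
      also have "\<dots> = (\<integral>x. max 0 (- ?k x) * indicator {..s} x \<partial>\<mu>)"
        by (intro Bochner_Integration.integral_cong) (auto split: split_indicator)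
      also have "\<dots> = cdf (density \<mu> (\<lambda>x. ennreal (max 0 (- ?k x)))) s"
        unfolding cdf_def by (rule measure_density_eq_integral[OF kneg, symmetric]) auto
      finally show "cdf (neg_measure f t) s = cdf (density \<mu> (\<lambda>x. ennreal (max 0 (- ?k x)))) s" .
    qed
    show "finite_borel_measure (density \<mu> (\<lambda>x. ennreal (max 0 (- ?k x))))"
      by (rule finite_borel_density[OF kneg]) simp
  qed (intro finite_borel_neg_measure f t)
qed

text \<open>The variation terms of the two distribution functions cancel, and what remains is the
  path, including its mass at 0.\<close>

lemma measure_Icc_jordan:
  assumes f: "fv_path f" and t: "0 \<le> s" "s \<le> t"
  shows "measure (pos_measure f t) {0..s} - measure (neg_measure f t) {0..s} = f s"
proof -
  have t': "0 \<le> t" using t by simp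
  have "measure (pos_measure f t) {0..s} = cdf (pos_measure f t) s"
    by (intro finite_borel_measure.measure_Icc_0[OF finite_borel_pos_measure[OF f t']])
       (use t in \<open>auto simp: cdf_pos_measure[OF f t'] zero_ext_def var_fun_def\<close>)
  moreover have "measure (neg_measure f t) {0..s} = cdf (neg_measure f t) s"
    by (intro finite_borel_measure.measure_Icc_0[OF finite_borel_neg_measure[OF f t']])
       (use t in \<open>auto simp: cdf_neg_measure[OF f t'] zero_ext_def var_fun_def\<close>)
  ultimately show ?thesis
    using t by (simp add: cdf_pos_measure[OF f t'] cdf_neg_measure[OF f t'] zero_ext_def field_simps)
qed

text \<open>The sum of all four Jordan measures serves both paths; sharing \<open>\<mu>\<close> is
  what makes linearity in the integrator a statement about densities. A single path is handled by
  taking \<open>g = f\<close>.\<close>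

lemma path_density_exists:
  assumes f: "fv_path f" and g: "fv_path g" and t: "0 \<le> t"
  obtains \<mu> k l where "path_density \<mu> k f t" "path_density \<mu> l g t"
proof -
  note fin = finite_borel_pos_measure[OF f t] finite_borel_neg_measure[OF f t]
    finite_borel_pos_measure[OF g t] finite_borel_neg_measure[OF g t]
  define \<mu> where "\<mu> = plus_measure (plus_measure (pos_measure f t) (neg_measure f t))
    (plus_measure (pos_measure g t) (neg_measure g t))"
  note fin2 = finite_borel_plus_measure[OF fin(1,2)] finite_borel_plus_measure[OF fin(3,4)]
  have \<mu>: "finite_borel_measure \<mu>" unfolding \<mu>_def by (intro finite_borel_plus_measure fin2)
  have em: "emeasure \<mu> A = (emeasure (pos_measure f t) A + emeasure (neg_measure f t) A) +
    (emeasure (pos_measure g t) A + emeasure (neg_measure g t) A)" if "A \<in> sets borel" for A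
    unfolding \<mu>_def using that by (simp add: emeasure_plus_measure fin fin2)
  have *: "\<exists>k. path_density \<mu> k h t"
    if h: "fv_path h" and P: "\<And>A. A \<in> sets borel \<Longrightarrow> emeasure (pos_measure h t) A \<le> emeasure \<mu> A"
      and N: "\<And>A. A \<in> sets borel \<Longrightarrow> emeasure (neg_measure h t) A \<le> emeasure \<mu> A" for h
  proof -
    interpret \<mu>: finite_borel_measure \<mu> by fact
    obtain p where p: "\<And>x. 0 \<le> p x" "integrable \<mu> p" "pos_measure h t = density \<mu> (\<lambda>x. ennreal (p x))"
      by (rule dominated_density[OF \<mu> finite_borel_pos_measure[OF h t]]) (auto intro: P)
    obtain n where n: "\<And>x. 0 \<le> n x" "integrable \<mu> n" "neg_measure h t = density \<mu> (\<lambda>x. ennreal (n x))"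
      by (rule dominated_density[OF \<mu> finite_borel_neg_measure[OF h t]]) (auto intro: N)
    have "path_density \<mu> (\<lambda>x. p x - n x) h t"
      unfolding path_density_def
    proof (intro conjI allI impI)
      fix s assume s: "0 \<le> s \<and> s \<le> t"
      have "h s = (\<integral>x. p x * indicator {0..s} x \<partial>\<mu>) - (\<integral>x. n x * indicator {0..s} x \<partial>\<mu>)"
        using measure_Icc_jordan[OF h, of s t] s p n by (simp add: \<mu>.measure_density_eq_integral)
      also have "\<dots> = (\<integral>x. (p x - n x) * indicator {0..s} x \<partial>\<mu>)"
        using \<mu>.integrable_indicator_mult[OF p(2), of "{0..s}"] \<mu>.integrable_indicator_mult[OF n(2), of "{0..s}"]
        by (simp add: left_diff_distrib)
      finally show "h s = (\<integral>x. (p x - n x) * indicator {0..s} x \<partial>\<mu>)" .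
    qed (use \<mu> p n in auto)
    then show ?thesis by blast
  qed
  have "\<exists>k. path_density \<mu> k f t"
    by (rule *[OF f]) (simp_all add: em add.assoc add.left_commute[of _ "emeasure (neg_measure f t) _"])
  moreover have "\<exists>k. path_density \<mu> k g t"
    by (rule *[OF g]) (simp_all add: em add.commute add.left_commute)
  ultimately show ?thesis using that by blast
qed

lemma
  assumes d: "path_density \<mu> k f t" and f: "fv_path f" and t: "0 \<le> t"
    and h: "h \<in> borel_measurable borel"
  shows abs_path_integral_eq:
      "abs_path_integral h f t = (\<integral>\<^sup>+x. ennreal (\<bar>h x * k x\<bar> * indicator {0..t} x) \<partial>\<mu>)"
    and integrable_path_density: "abs_path_integral h f t < \<infinity> \<Longrightarrow>
      integrable \<mu> (\<lambda>x. h x * k x * indicator {0..t} x)"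
    and path_integral_eq: "abs_path_integral h f t < \<infinity> \<Longrightarrow>
      path_integral h f t = (\<integral>x. h x * k x * indicator {0..t} x \<partial>\<mu>)"
proof -
  interpret finite_borel_measure \<mu> using d by (simp add: path_density_def)
  have [measurable]: "k \<in> borel_measurable borel"
    using d borel_measurable_integrable[of \<mu> k] unfolding measurable_cong_sets[OF M_is_borel refl]
    by (simp add: path_density_def)
  have [measurable_cong]: "sets \<mu> = sets borel" by (rule M_is_borel)
  note [measurable] = h
  show *: "abs_path_integral h f t = (\<integral>\<^sup>+x. ennreal (\<bar>h x * k x\<bar> * indicator {0..t} x) \<partial>\<mu>)"
    unfolding abs_path_integral_def abs_measure_eq_density[OF d f t]
    by (subst nn_integral_density)
       (auto intro!: nn_integral_cong simp: abs_mult ennreal_mult'' mult.commute split: split_indicator)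
  assume "abs_path_integral h f t < \<infinity>"
  then show int: "integrable \<mu> (\<lambda>x. h x * k x * indicator {0..t} x)"
    unfolding * by (intro integrableI_bounded) (auto simp: abs_mult)
  let ?u = "\<lambda>x. h x * k x * indicator {0..t} x"
  let ?p = "\<lambda>x. max 0 (k x * indicator {0..t} x) * (indicator {0..t} x * h x)"
  let ?n = "\<lambda>x. max 0 (- (k x * indicator {0..t} x)) * (indicator {0..t} x * h x)"
  \<comment> \<open>Both are dominated by \<bar>?u\<bar>, as each part of \<open>k\<close> is
    bounded by \<bar>k\<bar>.\<close>
  have "integrable \<mu> ?p" "integrable \<mu> ?n"
    by (rule Bochner_Integration.integrable_bound[OF int]; auto simp: abs_mult max_def split: split_indicator)+
  then have "(\<integral>x. ?p x \<partial>\<mu>) - (\<integral>x. ?n x \<partial>\<mu>) = (\<integral>x. ?p x - ?n x \<partial>\<mu>)"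
    by (rule Bochner_Integration.integral_diff[symmetric])
  also have "\<dots> = (\<integral>x. ?u x \<partial>\<mu>)"
    by (intro Bochner_Integration.integral_cong) (auto simp: max_def split: split_indicator)
  finally have "(\<integral>x. ?p x \<partial>\<mu>) - (\<integral>x. ?n x \<partial>\<mu>) = (\<integral>x. ?u x \<partial>\<mu>)" .
  moreover have "path_integral h f t = (\<integral>x. ?p x \<partial>\<mu>) - (\<integral>x. ?n x \<partial>\<mu>)"
    unfolding path_integral_def set_lebesgue_integral_def pos_measure_eq_density[OF d f t]
      neg_measure_eq_density[OF d f t]
    by (subst (1 2) integral_density) auto
  ultimately show "path_integral h f t = (\<integral>x. ?u x \<partial>\<mu>)" by simp
qed

subsection \<open>Calculus of pathwise integrals\<close>

lemma abs_path_integral_finite_iff: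
  assumes "path_density \<mu> k f t" "fv_path f" "0 \<le> t" "h \<in> borel_measurable borel"
  shows "abs_path_integral h f t < \<infinity> \<longleftrightarrow> integrable \<mu> (\<lambda>x. h x * k x * indicator {0..t} x)"
proof
  assume "integrable \<mu> (\<lambda>x. h x * k x * indicator {0..t} x)"
  then show "abs_path_integral h f t < \<infinity>"
    unfolding abs_path_integral_eq[OF assms] integrable_iff_bounded by (simp add: abs_mult)
qed (rule integrable_path_density[OF assms])

text \<open>The horizon is built into the measures, so nothing outside [0, t] is seen. This permits
  replacing \<open>h\<close> by \<open>h (max 0 s)\<close>, which is Borel on the whole line even if
  \<open>h\<close> is arbitrary at negative times.\<close>

lemma path_integral_cong:
  assumes "0 \<le> t" "\<And>s. 0 \<le> s \<Longrightarrow> s \<le> t \<Longrightarrow> h s = h' s" "\<And>s. 0 \<le> s \<Longrightarrow> s \<le> t \<Longrightarrow> f s = g s"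
  shows "abs_path_integral h f t = abs_path_integral h' g t" "path_integral h f t = path_integral h' g t"
proof -
  have "path_variation f (min s t) = path_variation g (min s t)" if "0 \<le> s" for s
    using that assms by (intro path_variation_cong) auto
  then have v: "variation_upto f t = variation_upto g t"
    by (auto simp: variation_upto_def fun_eq_iff)
  have p: "path_upto f t = path_upto g t"
    using assms by (auto simp: path_upto_def fun_eq_iff)
  show "abs_path_integral h f t = abs_path_integral h' g t"
    unfolding abs_path_integral_def abs_measure_def v
    by (intro nn_integral_cong) (auto simp: assms(2) split: split_indicator)
  show "path_integral h f t = path_integral h' g t"
    unfolding path_integral_def pos_measure_def neg_measure_def v p set_lebesgue_integral_def
    by (intro arg_cong2[where f=minus] Bochner_Integration.integral_cong)
       (auto simp: assms(2) split: split_indicator)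
qed

lemma integral_Icc_0_diff:
  assumes "finite_borel_measure \<mu>" "integrable \<mu> (k :: real \<Rightarrow> real)" "0 \<le> x" "x \<le> y"
  shows "(\<integral>z. k z * indicator {0..y} z \<partial>\<mu>) - (\<integral>z. k z * indicator {0..x} z \<partial>\<mu>) =
    (\<integral>z. k z * indicator {x<..y} z \<partial>\<mu>)"
proof -
  interpret finite_borel_measure \<mu> by fact
  show ?thesis
    using assms
    by (auto simp: integrable_indicator_mult intro!: Bochner_Integration.integral_cong
          simp flip: Bochner_Integration.integral_diff split: split_indicator)
qed

text \<open>Converse of \<open>path_density_exists\<close>. The path is locally a difference of two
  distribution functions, which gives the one-sided limits, and the integral of \<bar>k\<bar> bounds
  the variation.\<close>

lemma fv_path_if_path_density:
  assumes "\<And>t. 0 \<le> t \<Longrightarrow> \<exists>\<mu> k. path_density \<mu> k f t"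
  shows "fv_path f"
proof -
  have reg: "continuous (at_right t) f \<and> (0 < t \<longrightarrow> (\<exists>l. (f \<longlongrightarrow> l) (at_left t)))" if t: "0 \<le> t" for t
  proof -
    \<comment> \<open>The horizon exceeds \<open>t\<close> so that a right neighbourhood of
      \<open>t\<close> is covered.\<close>
    obtain \<mu> k where d: "path_density \<mu> k f (t + 1)" using assms[of "t + 1"] t by auto
    interpret finite_borel_measure \<mu> using d by (simp add: path_density_def)
    let ?k = "\<lambda>x. k x * indicator {0..t + 1} x"
    have "integrable \<mu> ?k" using d by (intro integrable_indicator_mult) (auto simp: path_density_def)
    then have int: "integrable \<mu> (\<lambda>x. max 0 (?k x))" "integrable \<mu> (\<lambda>x. max 0 (- ?k x))" by auto
    define P where "P = density \<mu> (\<lambda>x. ennreal (max 0 (?k x)))"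
    define N where "N = density \<mu> (\<lambda>x. ennreal (max 0 (- ?k x)))"
    interpret P: finite_borel_measure P unfolding P_def by (rule finite_borel_density[OF int(1)]) simp
    interpret N: finite_borel_measure N unfolding N_def by (rule finite_borel_density[OF int(2)]) simp
    have f: "f s = cdf P s - cdf N s" if "0 \<le> s" "s \<le> t + 1" for s
    proof -
      have "f s = zero_ext f (min s (t + 1))" using that by (simp add: zero_ext_def)
      also have "\<dots> = (\<integral>x. ?k x * indicator {..s} x \<partial>\<mu>)"
        using t by (intro path_density_cdf[OF d]) simp
      also have "\<dots> = (\<integral>x. max 0 (?k x) * indicator {..s} x - max 0 (- ?k x) * indicator {..s} x \<partial>\<mu>)"
        by (intro Bochner_Integration.integral_cong) (auto split: split_indicator)
      also have "\<dots> = (\<integral>x. max 0 (?k x) * indicator {..s} x \<partial>\<mu>) - (\<integral>x. max 0 (- ?k x) * indicator {..s} x \<partial>\<mu>)"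
        by (intro Bochner_Integration.integral_diff integrable_indicator_mult int) auto
      also have "(\<integral>x. max 0 (?k x) * indicator {..s} x \<partial>\<mu>) = cdf P s"
        unfolding cdf_def P_def by (rule measure_density_eq_integral[OF int(1), symmetric]) auto
      also have "(\<integral>x. max 0 (- ?k x) * indicator {..s} x \<partial>\<mu>) = cdf N s"
        unfolding cdf_def N_def by (rule measure_density_eq_integral[OF int(2), symmetric]) auto
      finally show ?thesis .
    qed
    have ev: "\<forall>\<^sub>F s in at_right t. cdf P s - cdf N s = f s"
      unfolding eventually_at_right_field using t by (intro exI[of _ "t + 1"]) (auto intro!: f[symmetric])
    have "((\<lambda>s. cdf P s - cdf N s) \<longlongrightarrow> f t) (at_right t)"
      using f[of t] t P.cdf_is_right_cont[of t] N.cdf_is_right_cont[of t]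
      unfolding continuous_within by (auto intro!: tendsto_diff)
    then have 1: "continuous (at_right t) f"
      unfolding continuous_within using ev by (rule Lim_transform_eventually)
    have "\<exists>l. (f \<longlongrightarrow> l) (at_left t)" if "0 < t"
    proof -
      have ev: "\<forall>\<^sub>F s in at_left t. cdf P s - cdf N s = f s"
        unfolding eventually_at_left_field using that by (intro exI[of _ 0]) (auto intro!: f[symmetric])
      have "((\<lambda>s. cdf P s - cdf N s) \<longlongrightarrow> measure P {..<t} - measure N {..<t}) (at_left t)"
        by (intro tendsto_diff P.cdf_at_left N.cdf_at_left)
      from Lim_transform_eventually[OF this ev] show ?thesis by blast
    qed
    with 1 show ?thesis by blast
  qed
  moreover have "path_variation f t < \<infinity>" if t: "0 \<le> t" for t
  proof -
    obtain \<mu> k where d: "path_density \<mu> k f t" using assms[OF t] by auto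
    define W where "W s = (\<integral>z. \<bar>k z\<bar> * indicator {0..s} z \<partial>\<mu>)" for s
    have "path_variation f t \<le> path_variation f 0 + ennreal (W t - W 0)"
    proof (rule path_variation_le_add)
      fix x y assume xy: "0 \<le> x" "x \<le> y" "y \<le> t"
      have "f y - f x = (\<integral>z. k z * indicator {x<..y} z \<partial>\<mu>)"
        using d xy by (subst integral_Icc_0_diff[symmetric]) (auto simp: path_density_def)
      also have "\<bar>\<dots>\<bar> \<le> (\<integral>z. \<bar>k z * indicator {x<..y} z\<bar> \<partial>\<mu>)" by (rule integral_abs_bound)
      also have "\<dots> = (\<integral>z. \<bar>k z\<bar> * indicator {x<..y} z \<partial>\<mu>)" by (simp add: abs_mult)
      also have "\<dots> = W y - W x"
        unfolding W_def using d xy by (subst integral_Icc_0_diff) (auto simp: path_density_def)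
      finally show "\<bar>f y - f x\<bar> \<le> W y - W x" .
    qed (use t in auto)
    also have "\<dots> < \<infinity>" by (simp add: path_variation_0)
    finally show ?thesis .
  qed
  ultimately show ?thesis by (auto simp: fv_path_def cadlag_def)
qed

lemma path_density_linear:
  assumes "path_density \<mu> k f t" "path_density \<mu> l g t"
  shows "path_density \<mu> (\<lambda>x. a * k x + b * l x) (\<lambda>s. a * f s + b * g s) t"
proof -
  interpret finite_borel_measure \<mu> using assms(1) by (simp add: path_density_def)
  have "a * f s + b * g s = (\<integral>x. (a * k x + b * l x) * indicator {0..s} x \<partial>\<mu>)" if "0 \<le> s" "s \<le> t" for s
  proof -
    have "integrable \<mu> (\<lambda>x. k x * indicator {0..s} x)" "integrable \<mu> (\<lambda>x. l x * indicator {0..s} x)"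
      using assms by (auto simp: path_density_def intro!: integrable_indicator_mult)
    then have "a * f s + b * g s = (\<integral>x. a * (k x * indicator {0..s} x) + b * (l x * indicator {0..s} x) \<partial>\<mu>)"
      using assms that by (simp add: path_density_def)
    then show ?thesis by (simp add: algebra_simps)
  qed
  then show ?thesis using assms by (auto simp: path_density_def)
qed

lemma fv_path_linear:
  assumes "fv_path f" "fv_path g"
  shows "fv_path (\<lambda>s. a * f s + b * g s)"
proof (rule fv_path_if_path_density)
  fix t :: real assume "0 \<le> t"
  then obtain \<mu> k l where "path_density \<mu> k f t" "path_density \<mu> l g t"
    using path_density_exists[OF assms] by blast
  then show "\<exists>\<mu> k. path_density \<mu> k (\<lambda>s. a * f s + b * g s) t"
    using path_density_linear by blast
qed

lemma
  assumes f: "fv_path f" and t: "0 \<le> t"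
    and h: "h \<in> borel_measurable borel" "abs_path_integral h f t < \<infinity>"
    and k: "k \<in> borel_measurable borel" "abs_path_integral k f t < \<infinity>"
  shows abs_path_integral_linear_left: "abs_path_integral (\<lambda>s. a * h s + b * k s) f t < \<infinity>"
    and path_integral_linear_left:
      "path_integral (\<lambda>s. a * h s + b * k s) f t = a * path_integral h f t + b * path_integral k f t"
proof -
  obtain \<mu> l where d: "path_density \<mu> l f t" by (rule path_density_exists[OF f f t])
  note int = integrable_path_density[OF d f t h] integrable_path_density[OF d f t k]
  have m: "(\<lambda>s. a * h s + b * k s) \<in> borel_measurable borel" using h(1) k(1) by measurable
  have eq: "(\<lambda>x. (a * h x + b * k x) * l x * indicator {0..t} x) =
    (\<lambda>x. a * (h x * l x * indicator {0..t} x) + b * (k x * l x * indicator {0..t} x))"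
    by (simp add: algebra_simps)
  show 1: "abs_path_integral (\<lambda>s. a * h s + b * k s) f t < \<infinity>"
    unfolding abs_path_integral_finite_iff[OF d f t m] eq using int by simp
  show "path_integral (\<lambda>s. a * h s + b * k s) f t = a * path_integral h f t + b * path_integral k f t"
    unfolding path_integral_eq[OF d f t m 1] path_integral_eq[OF d f t h] path_integral_eq[OF d f t k] eq
    using int by simp
qed

lemma
  assumes f: "fv_path f" and g: "fv_path g" and t: "0 \<le> t" and h: "h \<in> borel_measurable borel"
    and hf: "abs_path_integral h f t < \<infinity>" and hg: "abs_path_integral h g t < \<infinity>"
  shows abs_path_integral_linear_right: "abs_path_integral h (\<lambda>s. a * f s + b * g s) t < \<infinity>"
    and path_integral_linear_right:
      "path_integral h (\<lambda>s. a * f s + b * g s) t = a * path_integral h f t + b * path_integral h g t"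
proof -
  obtain \<mu> k l where d: "path_density \<mu> k f t" "path_density \<mu> l g t" by (rule path_density_exists[OF f g t])
  note int = integrable_path_density[OF d(1) f t h hf] integrable_path_density[OF d(2) g t h hg]
  note D = path_density_linear[OF d, of a b] fv_path_linear[OF f g, of a b] t h
  have eq: "(\<lambda>x. h x * (a * k x + b * l x) * indicator {0..t} x) =
    (\<lambda>x. a * (h x * k x * indicator {0..t} x) + b * (h x * l x * indicator {0..t} x))"
    by (simp add: algebra_simps)
  show 1: "abs_path_integral h (\<lambda>s. a * f s + b * g s) t < \<infinity>"
    unfolding abs_path_integral_finite_iff[OF D] eq using int by simp
  show "path_integral h (\<lambda>s. a * f s + b * g s) t = a * path_integral h f t + b * path_integral h g t"
    unfolding path_integral_eq[OF D 1] path_integral_eq[OF d(1) f t h hf] path_integral_eq[OF d(2) g t h hg] eq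
    using int by simp
qed

text \<open>The indicator belongs to the density because \<open>path_density\<close> demands
  integrability over the whole line, and \<open>h * k\<close> is integrable on [0, t] only.\<close>

lemma path_density_integral:
  assumes d: "path_density \<mu> k f t" and f: "fv_path f" and t: "0 \<le> t" and h: "h \<in> borel_measurable borel"
    and fin: "\<And>t. 0 \<le> t \<Longrightarrow> abs_path_integral h f t < \<infinity>"
  shows "path_density \<mu> (\<lambda>x. h x * k x * indicator {0..t} x) (path_integral h f) t"
  unfolding path_density_def
proof (intro conjI allI impI)
  fix s assume s: "0 \<le> s \<and> s \<le> t"
  then have "path_integral h f s = (\<integral>x. h x * k x * indicator {0..s} x \<partial>\<mu>)"
    by (intro path_integral_eq f h fin path_density_subinterval[OF d]) auto
  also have "\<dots> = (\<integral>x. h x * k x * indicator {0..t} x * indicator {0..s} x \<partial>\<mu>)"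
    using s by (intro Bochner_Integration.integral_cong) (auto split: split_indicator)
  finally show "path_integral h f s = (\<integral>x. h x * k x * indicator {0..t} x * indicator {0..s} x \<partial>\<mu>)" .
next
  show "finite_borel_measure \<mu>" using d by (simp add: path_density_def)
  show "integrable \<mu> (\<lambda>x. h x * k x * indicator {0..t} x)" by (rule integrable_path_density[OF d f t h fin[OF t]])
qed

lemma fv_path_path_integral:
  assumes f: "fv_path f" and h: "h \<in> borel_measurable borel"
    and fin: "\<And>t. 0 \<le> t \<Longrightarrow> abs_path_integral h f t < \<infinity>"
  shows "fv_path (path_integral h f)"
proof (rule fv_path_if_path_density)
  fix t :: real assume t: "0 \<le> t"
  obtain \<mu> k where d: "path_density \<mu> k f t" by (rule path_density_exists[OF f f t])
  show "\<exists>\<mu> k. path_density \<mu> k (path_integral h f) t"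
    using path_density_integral[OF d f t h fin] by blast
qed

text \<open>Both absolute integrals are the integral of \<bar>h' h k\<bar> d\<mu>, so they agree
  even when infinite. This is the source of the equivalence of the two integrability
  conditions.\<close>

lemma
  assumes f: "fv_path f" and t: "0 \<le> t" and h: "h \<in> borel_measurable borel"
    and fin: "\<And>t. 0 \<le> t \<Longrightarrow> abs_path_integral h f t < \<infinity>"
    and h': "h' \<in> borel_measurable borel"
  shows abs_path_integral_assoc:
      "abs_path_integral h' (path_integral h f) t = abs_path_integral (\<lambda>s. h' s * h s) f t"
    and path_integral_assoc: "abs_path_integral (\<lambda>s. h' s * h s) f t < \<infinity> \<Longrightarrow>
      path_integral h' (path_integral h f) t = path_integral (\<lambda>s. h' s * h s) f t"
proof -
  obtain \<mu> k where d: "path_density \<mu> k f t" by (rule path_density_exists[OF f f t])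
  have d': "path_density \<mu> (\<lambda>x. h x * k x * indicator {0..t} x) (path_integral h f) t"
    by (rule path_density_integral[OF d f t h]) (rule fin)
  have "fv_path (path_integral h f)" by (rule fv_path_path_integral[OF f h]) (rule fin)
  note D = d' this t h'
  have m: "(\<lambda>s. h' s * h s) \<in> borel_measurable borel" using h h' by measurable
  show eq: "abs_path_integral h' (path_integral h f) t = abs_path_integral (\<lambda>s. h' s * h s) f t"
    unfolding abs_path_integral_eq[OF D] abs_path_integral_eq[OF d f t m]
    by (intro nn_integral_cong) (auto simp: mult.assoc split: split_indicator)
  assume fin': "abs_path_integral (\<lambda>s. h' s * h s) f t < \<infinity>"
  show "path_integral h' (path_integral h f) t = path_integral (\<lambda>s. h' s * h s) f t"
    unfolding path_integral_eq[OF D fin'[folded eq]] path_integral_eq[OF d f t m fin']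
    by (intro Bochner_Integration.integral_cong) (auto split: split_indicator)
qed

lemma path_variation_const_after:
  assumes "0 \<le> u" "u \<le> t" "\<And>s. u \<le> s \<Longrightarrow> s \<le> t \<Longrightarrow> f s = f u"
  shows "path_variation f t = path_variation f u"
proof (rule antisym)
  show "path_variation f t \<le> path_variation f u"
  proof -
    have "\<bar>f y - f x\<bar> \<le> 0 - 0" if "u \<le> x" "x \<le> y" "y \<le> t" for x y
      using assms(3)[of x] assms(3)[of y] that by simp
    from path_variation_le_add[OF assms(1,2) this] show ?thesis by simp
  qed
  show "path_variation f u \<le> path_variation f t"
    using path_variation_add_le[OF assms(1,2), of f] by (rule order_trans[rotated]) simp
qed

text \<open>If \<open>f\<close> is constant after \<open>u\<close>, the truncated distribution
  functions for the horizons \<open>t\<close> and \<open>u\<close> are the same functions, so the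
  measures are equal. It remains that this measure gives no mass to ]u, t], which its density
  shows.\<close>

lemma
  assumes f: "fv_path f" and h: "h \<in> borel_measurable borel"
    and u: "0 \<le> u" "u \<le> t" and const: "\<And>s. u \<le> s \<Longrightarrow> s \<le> t \<Longrightarrow> f s = f u"
  shows abs_path_integral_const_after: "abs_path_integral h f t = abs_path_integral h f u"
    and path_integral_const_after: "path_integral h f t = path_integral h f u"
proof -
  have "path_variation f (min s t) = path_variation f (min s u)" if "0 \<le> s" for s
  proof (cases "s \<le> u")
    case False
    have "path_variation f (min s t) = path_variation f u"
    proof (rule path_variation_const_after)
      fix r assume "u \<le> r" "r \<le> min s t"
      then show "f r = f u" by (intro const) auto
    qed (use False u in auto)
    then show ?thesis using False by simp
  qed (use u in auto)
  then have v: "variation_upto f t = variation_upto f u"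
    by (auto simp: variation_upto_def fun_eq_iff)
  have p: "path_upto f t = path_upto f u"
  proof
    fix s
    show "path_upto f t s = path_upto f u s"
      using u const[of "min s t"] by (cases "s \<le> u") (auto simp: path_upto_def)
  qed
  have ms: "abs_measure f t = abs_measure f u" "pos_measure f t = pos_measure f u"
    "neg_measure f t = neg_measure f u"
    unfolding abs_measure_def pos_measure_def neg_measure_def v p by simp_all
  obtain \<mu> k where d: "path_density \<mu> k f u" by (rule path_density_exists[OF f f u(1)])
  have [measurable_cong]: "sets \<mu> = sets borel"
    using d by (simp add: path_density_def finite_borel_measure.M_is_borel)
  have [measurable]: "k \<in> borel_measurable borel"
    using d borel_measurable_integrable[of \<mu> k] measurable_cong_sets[of \<mu> borel borel borel]
    by (simp add: path_density_def finite_borel_measure.M_is_borel)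
  have ae: "AE x in abs_measure f u. x \<in> {0..u}" "AE x in pos_measure f u. x \<in> {0..u}"
    "AE x in neg_measure f u. x \<in> {0..u}"
    unfolding abs_measure_eq_density[OF d f u(1)] pos_measure_eq_density[OF d f u(1)]
      neg_measure_eq_density[OF d f u(1)]
    by (subst AE_density; auto split: split_indicator)+
  show "abs_path_integral h f t = abs_path_integral h f u"
    unfolding abs_path_integral_def ms using ae(1) u
    by (intro nn_integral_cong_AE) (auto split: split_indicator)
  have *: "(LINT s:{0..t}|N. h s) = (LINT s:{0..u}|N. h s)"
    if "AE x in N. x \<in> {0..u}" "sets N = sets borel" for N :: "real measure"
  proof -
    have [measurable_cong]: "sets N = sets borel" by fact
    note [measurable] = h
    show ?thesis
      unfolding set_lebesgue_integral_def using that(1) u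
      by (intro integral_cong_AE) (auto split: split_indicator)
  qed
  have "sets (pos_measure f u) = sets borel" "sets (neg_measure f u) = sets borel"
    by (simp_all add: pos_measure_def neg_measure_def)
  then show "path_integral h f t = path_integral h f u"
    unfolding path_integral_def ms by (simp only: *[OF ae(2)] *[OF ae(3)])
qed

subsection \<open>Measurability of pathwise integrals\<close>

text \<open>The grid points of the uniform partitions are deterministic and at most
  \<open>s\<close>, so only values of the path up to time \<open>s\<close> enter. With
  \<open>G\<close> the sigma-algebra at time \<open>s\<close> this is adaptedness of the
  variation.\<close>

lemma borel_measurable_var_fun:
  assumes fv: "\<And>\<omega>. \<omega> \<in> space G \<Longrightarrow> fv_path (f \<omega>)"
    and meas: "\<And>r. 0 \<le> r \<Longrightarrow> r \<le> s \<Longrightarrow> (\<lambda>\<omega>. f \<omega> r) \<in> borel_measurable G"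
  shows "(\<lambda>\<omega>. var_fun (f \<omega>) s) \<in> borel_measurable G"
proof (cases "s < 0")
  case False
  then have s: "0 \<le> s" by simp
  let ?S = "\<lambda>\<omega> m. \<bar>f \<omega> 0\<bar> + var_sum (f \<omega>) (\<lambda>i. s * real i / real (Suc m)) (Suc m)"
  have "var_fun (f \<omega>) s = enn2real (SUP m. ennreal (?S \<omega> m))" if "\<omega> \<in> space G" for \<omega>
    using path_variation_eq_SUP_uniform[OF fv_path_right_cont[OF fv[OF that]] s] False
    by (simp add: var_fun_def del: of_nat_Suc)
  moreover have "(\<lambda>\<omega>. enn2real (SUP m. ennreal (?S \<omega> m))) \<in> borel_measurable G"
  proof -
    have "(\<lambda>\<omega>. ?S \<omega> m) \<in> borel_measurable G" for m
    proof -
      have part: "(\<lambda>\<omega>. f \<omega> (s * real i / real (Suc m))) \<in> borel_measurable G" if "i \<le> Suc m" for i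
        using s that by (intro meas) (auto simp: divide_le_eq intro!: mult_left_mono simp del: of_nat_Suc)
      have "(\<lambda>\<omega>. f \<omega> 0) \<in> borel_measurable G" using s by (intro meas) auto
      then show ?thesis
        unfolding var_sum_def
        by (intro borel_measurable_add borel_measurable_sum borel_measurable_abs borel_measurable_diff part)
           auto
    qed
    then show ?thesis by measurable
  qed
  ultimately show ?thesis by (subst measurable_cong) auto
qed (simp add: var_fun_def)

text \<open>Half-lines form an intersection-stable generator, so measurability of the distribution
  functions makes \<kappa> a measurable kernel. No integrability is required: the integral has the
  default value 0 otherwise.\<close>

lemma borel_measurable_integral_kernel:
  fixes u :: "'a \<Rightarrow> real \<Rightarrow> real"
  assumes fin: "\<And>\<omega>. \<omega> \<in> space G \<Longrightarrow> finite_borel_measure (\<kappa> \<omega>)"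
    and cdf: "\<And>s. (\<lambda>\<omega>. cdf (\<kappa> \<omega>) s) \<in> borel_measurable G"
    and u: "(\<lambda>(\<omega>, x). u \<omega> x) \<in> borel_measurable (G \<Otimes>\<^sub>M borel)"
  shows "(\<lambda>\<omega>. \<integral>x. u \<omega> x \<partial>\<kappa> \<omega>) \<in> borel_measurable G"
proof -
  \<comment> \<open>The summand 1 keeps the normalising constant positive when the measure is
    zero.\<close>
  define c where "c \<omega> = 1 + measure (\<kappa> \<omega>) UNIV" for \<omega>
  have c: "0 < c \<omega>" for \<omega> unfolding c_def by (simp add: add_pos_nonneg)
  have c_meas: "c \<in> borel_measurable G"
  proof -
    have "(\<lambda>\<omega>. measure (\<kappa> \<omega>) UNIV) \<in> borel_measurable G"
    proof (rule borel_measurable_LIMSEQ_real)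
      fix \<omega> assume "\<omega> \<in> space G"
      then interpret finite_borel_measure "\<kappa> \<omega>" by (rule fin)
      show "(\<lambda>i. cdf (\<kappa> \<omega>) (real i)) \<longlonglongrightarrow> measure (\<kappa> \<omega>) UNIV"
        using cdf_lim_infty by (simp add: borel_UNIV)
    qed (rule cdf)
    then show ?thesis unfolding c_def by measurable
  qed
  text \<open>Normalising the total mass makes the library on subprobability kernels applicable.\<close>
  define K where "K \<omega> = density (\<kappa> \<omega>) (\<lambda>_. ennreal (1 / c \<omega>))" for \<omega>
  have em: "emeasure (K \<omega>) A = ennreal (measure (\<kappa> \<omega>) A / c \<omega>)"
    if "\<omega> \<in> space G" "A \<in> sets borel" for \<omega> A
  proof -
    interpret finite_borel_measure "\<kappa> \<omega>" using that by (intro fin)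
    have "emeasure (K \<omega>) A = ennreal (1 / c \<omega>) * emeasure (\<kappa> \<omega>) A"
      unfolding K_def using that by (intro emeasure_density_const) auto
    then show ?thesis using c[of \<omega>] by (simp add: emeasure_eq_measure ennreal_mult'[symmetric])
  qed
  have sets_K: "sets (K \<omega>) = sets borel" "space (K \<omega>) = UNIV" if "\<omega> \<in> space G" for \<omega>
    using finite_borel_measure.M_is_borel[OF fin[OF that]] finite_borel_measure.borel_UNIV[OF fin[OF that]]
    by (simp_all add: K_def)
  have K[measurable]: "K \<in> measurable G (subprob_algebra borel)"
  proof (rule measurable_subprob_algebra_generated[where \<Omega>=UNIV and G="range (\<lambda>a::real. {..a})"])
    show "sets borel = sigma_sets UNIV (range (\<lambda>a::real. {..a}))"
      by (subst borel_eq_atMost) (simp add: sets_measure_of)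
    show "Int_stable (range (\<lambda>a::real. {..a}))"
      by (auto simp: Int_stable_def)
    show "subprob_space (K \<omega>)" if "\<omega> \<in> space G" for \<omega>
    proof
      have "measure (\<kappa> \<omega>) UNIV / c \<omega> \<le> 1" using c[of \<omega>] by (simp add: c_def)
      then show "emeasure (K \<omega>) (space (K \<omega>)) \<le> 1"
        unfolding sets_K(2)[OF that] by (subst em[OF that]) (auto intro: ennreal_leI[of _ 1, simplified])
    qed (simp add: sets_K(2)[OF that])
    have meas: "(\<lambda>\<omega>. emeasure (K \<omega>) A) \<in> borel_measurable G"
      if "A \<in> sets borel" "(\<lambda>\<omega>. measure (\<kappa> \<omega>) A) \<in> borel_measurable G" for A
      using that c_meas by (subst measurable_cong[OF em]) auto
    show "(\<lambda>\<omega>. emeasure (K \<omega>) UNIV) \<in> borel_measurable G"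
    proof (rule meas)
      have "(\<lambda>\<omega>. c \<omega> - 1) \<in> borel_measurable G" using c_meas by measurable
      then show "(\<lambda>\<omega>. measure (\<kappa> \<omega>) UNIV) \<in> borel_measurable G" by (simp add: c_def)
    qed simp
    show "(\<lambda>\<omega>. emeasure (K \<omega>) A) \<in> borel_measurable G" if "A \<in> range (\<lambda>a::real. {..a})" for A
      using that cdf by (auto intro!: meas simp: cdf_def)
  qed (auto simp: sets_K)
  note u' [measurable] = u
  \<comment> \<open>Pushing the kernel forward along x \<mapsto> (\<omega>, x) moves the dependence
    on \<omega> from the integrand into the measure, leaving one fixed integrand on the
    product.\<close>
  note [measurable] = measurable_distr2
  have "(\<lambda>\<omega>. integral\<^sup>L (distr (K \<omega>) (G \<Otimes>\<^sub>M borel) (\<lambda>x. (\<omega>, x))) (\<lambda>(\<omega>, x). u \<omega> x)) \<in> borel_measurable G"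
    by measurable
  then have "(\<lambda>\<omega>. c \<omega> * integral\<^sup>L (distr (K \<omega>) (G \<Otimes>\<^sub>M borel) (\<lambda>x. (\<omega>, x))) (\<lambda>(\<omega>, x). u \<omega> x)) \<in> borel_measurable G"
    using c_meas by measurable
  moreover have "(\<integral>x. u \<omega> x \<partial>\<kappa> \<omega>) =
    c \<omega> * integral\<^sup>L (distr (K \<omega>) (G \<Otimes>\<^sub>M borel) (\<lambda>x. (\<omega>, x))) (\<lambda>(\<omega>, x). u \<omega> x)"
    if \<omega>: "\<omega> \<in> space G" for \<omega>
  proof -
    have um: "u \<omega> \<in> borel_measurable borel"
      using measurable_compose[OF measurable_Pair1'[OF \<omega>] u] by simp
    have "(\<lambda>x. (\<omega>, x)) \<in> measurable (K \<omega>) (G \<Otimes>\<^sub>M borel)"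
      using measurable_Pair1'[OF \<omega>, of borel] unfolding measurable_cong_sets[OF sets_K(1)[OF \<omega>] refl] .
    then have "integral\<^sup>L (distr (K \<omega>) (G \<Otimes>\<^sub>M borel) (\<lambda>x. (\<omega>, x))) (\<lambda>(\<omega>, x). u \<omega> x) = (\<integral>x. u \<omega> x \<partial>K \<omega>)"
      using integral_distr[of "\<lambda>x. (\<omega>, x)" "K \<omega>" "G \<Otimes>\<^sub>M borel" "\<lambda>(\<omega>, x). u \<omega> x"] u
      by (simp only: split_conv)
    also have "\<dots> = (\<integral>x. (1 / c \<omega>) *\<^sub>R u \<omega> x \<partial>\<kappa> \<omega>)"
      unfolding K_def
    proof (rule integral_density)
      show "u \<omega> \<in> borel_measurable (\<kappa> \<omega>)"
        using um unfolding measurable_cong_sets[OF finite_borel_measure.M_is_borel[OF fin[OF \<omega>]] refl] .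
    qed (use c[of \<omega>] in auto)
    finally show ?thesis using c[of \<omega>] by simp
  qed
  ultimately show ?thesis by (subst measurable_cong) auto
qed

lemma borel_measurable_path_integral:
  assumes fv: "\<And>\<omega>. \<omega> \<in> space G \<Longrightarrow> fv_path (f \<omega>)" and t: "0 \<le> t"
    and f: "\<And>r. 0 \<le> r \<Longrightarrow> r \<le> t \<Longrightarrow> (\<lambda>\<omega>. f \<omega> r) \<in> borel_measurable G"
    and h: "(\<lambda>(\<omega>, x). h \<omega> x) \<in> borel_measurable (G \<Otimes>\<^sub>M borel)"
  shows "(\<lambda>\<omega>. path_integral (h \<omega>) (f \<omega>) t) \<in> borel_measurable G"
proof -
  have V: "(\<lambda>\<omega>. var_fun (f \<omega>) (min s t)) \<in> borel_measurable G" for s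
    by (intro borel_measurable_var_fun fv f) auto
  have Z: "(\<lambda>\<omega>. zero_ext (f \<omega>) (min s t)) \<in> borel_measurable G" for s
    unfolding zero_ext_def using f[of "min s t"] by (cases "min s t < 0") auto
  note [measurable] = V Z
  have pos: "(\<lambda>\<omega>. cdf (pos_measure (f \<omega>) t) s) \<in> borel_measurable G" for s
    by (subst measurable_cong, rule cdf_pos_measure[OF fv t]) (assumption, measurable)
  have neg: "(\<lambda>\<omega>. cdf (neg_measure (f \<omega>) t) s) \<in> borel_measurable G" for s
    by (subst measurable_cong, rule cdf_neg_measure[OF fv t]) (assumption, measurable)
  note [measurable] = h
  have "(\<lambda>(\<omega>, x). indicator {0..t} x *\<^sub>R h \<omega> x) \<in> borel_measurable (G \<Otimes>\<^sub>M borel)"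
    by measurable
  then show ?thesis
    unfolding path_integral_def set_lebesgue_integral_def
    by (intro borel_measurable_diff borel_measurable_integral_kernel pos neg
        finite_borel_pos_measure finite_borel_neg_measure fv t)
qed

subsection \<open>Stopped paths\<close>

text \<open>The minimum of \<open>t\<close> and a possibly infinite \<open>r\<close>, as a real;
  \<open>enn2real\<close> is evaluated at finite \<open>r\<close> only. Stopping a process thus
  becomes a substitution in its time argument.\<close>

definition stop_at :: "ennreal \<Rightarrow> real \<Rightarrow> real" where
  "stop_at r t = (if ennreal t \<le> r then t else enn2real r)"

lemma stopped_eq_stop_at: "stopped X \<tau> \<omega> t = X \<omega> (stop_at (\<tau> \<omega>) t)"
  by (simp add: stopped_def stop_at_def)

lemma stop_at_nonneg: "0 \<le> t \<Longrightarrow> 0 \<le> stop_at r t"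
  by (simp add: stop_at_def)

lemma ennreal_stop_at_le: "ennreal (stop_at r t) \<le> r"
  by (auto simp: stop_at_def ennreal_enn2real_if)

lemma stop_at_top [simp]: "stop_at top t = t"
  by (simp add: stop_at_def)

lemma stop_at_ennreal: "0 \<le> u \<Longrightarrow> stop_at (ennreal u) t = min t u"
  by (auto simp: stop_at_def ennreal_le_iff min_def)

lemma stop_at_mono: "s \<le> t \<Longrightarrow> stop_at r s \<le> stop_at r t"
  by (cases r) (auto simp: stop_at_ennreal)

lemma stop_at_le: "stop_at r t \<le> t"
  by (cases r) (auto simp: stop_at_ennreal)

lemma stop_at_eq: "ennreal t \<le> r \<Longrightarrow> s \<le> t \<Longrightarrow> stop_at r s = s"
  by (cases r) (auto simp: stop_at_ennreal ennreal_le_iff)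

text \<open>Densities refer to times in [0, t] only, so passing through them avoids arguing about
  limits of functions that differ at negative times.\<close>

lemma fv_path_cong:
  assumes "fv_path f" "\<And>t. 0 \<le> t \<Longrightarrow> f t = g t"
  shows "fv_path g"
proof (rule fv_path_if_path_density)
  fix t :: real assume "0 \<le> t"
  then obtain \<mu> k where "path_density \<mu> k f t" by (rule path_density_exists[OF assms(1) assms(1)])
  then have "path_density \<mu> k g t" using assms(2) by (simp add: path_density_def)
  then show "\<exists>\<mu> k. path_density \<mu> k g t" by blast
qed

text \<open>The comparison path may change with \<open>t\<close>; this fits limits that are
  eventually constant with an index depending on \<open>t\<close>.\<close>

lemma fv_path_if_locally:
  assumes "\<And>t. 0 \<le> t \<Longrightarrow> \<exists>g. fv_path g \<and> (\<forall>s. 0 \<le> s \<and> s \<le> t \<longrightarrow> f s = g s)"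
  shows "fv_path f"
proof (rule fv_path_if_path_density)
  fix t :: real assume t: "0 \<le> t"
  from assms[OF t] obtain g where g: "fv_path g" "\<And>s. 0 \<le> s \<Longrightarrow> s \<le> t \<Longrightarrow> f s = g s" by blast
  obtain \<mu> k where "path_density \<mu> k g t" by (rule path_density_exists[OF g(1) g(1) t])
  then have "path_density \<mu> k f t" using g(2) by (simp add: path_density_def)
  then show "\<exists>\<mu> k. path_density \<mu> k f t" by blast
qed

lemma fv_path_zero: "fv_path (\<lambda>_. 0)"
proof (rule fv_path_if_path_density)
  have "finite_borel_measure (null_measure borel)"
    by (intro finite_borel_measure.intro finite_measureI finite_borel_measure_axioms.intro) auto
  then have "path_density (null_measure borel) (\<lambda>_. 0) (\<lambda>_. 0) t" for t by (simp add: path_density_def)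
  then show "\<exists>\<mu> k. path_density \<mu> k (\<lambda>_. 0) t" for t by blast
qed

text \<open>Stopping at a finite time \<open>u\<close> cuts the density down to [0, u].\<close>

lemma fv_path_stop:
  assumes f: "fv_path f"
  shows "fv_path (\<lambda>s. f (stop_at r s))"
proof (cases r)
  case (real u)
  show ?thesis
  proof (rule fv_path_if_path_density)
    fix t :: real assume t: "0 \<le> t"
    obtain \<mu> k where d: "path_density \<mu> k f u" by (rule path_density_exists[OF f f real(1)])
    interpret finite_borel_measure \<mu> using d by (simp add: path_density_def)
    have "f (stop_at r s) = (\<integral>x. k x * indicator {0..u} x * indicator {0..s} x \<partial>\<mu>)"
      if "0 \<le> s" for s
    proof -
      have "f (stop_at r s) = (\<integral>x. k x * indicator {0..min s u} x \<partial>\<mu>)"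
        using d that real by (simp add: path_density_def stop_at_ennreal)
      also have "\<dots> = (\<integral>x. k x * indicator {0..u} x * indicator {0..s} x \<partial>\<mu>)"
        by (intro Bochner_Integration.integral_cong) (auto split: split_indicator)
      finally show ?thesis .
    qed
    then have "path_density \<mu> (\<lambda>x. k x * indicator {0..u} x) (\<lambda>s. f (stop_at r s)) t"
      using d by (auto simp: path_density_def intro!: integrable_indicator_mult)
    then show "\<exists>\<mu> k. path_density \<mu> k (\<lambda>s. f (stop_at r s)) t" by blast
  qed
qed (use f in simp)

text \<open>Finite variation is assumed of the stopped path only, since a path of a process on
  \<open>B\<close> is arbitrary outside \<open>B\<close>. The stopped path is constant after
  \<open>stop_at r t\<close>, so the horizon can be lowered to that time, before which stopping
  changes nothing.\<close>

lemma
  assumes f: "fv_path (\<lambda>s. f (stop_at r s))" and h: "(\<lambda>s. h (stop_at r (max 0 s))) \<in> borel_measurable borel"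
    and t: "0 \<le> t"
  shows abs_path_integral_stop_at:
      "abs_path_integral (\<lambda>s. h (stop_at r s)) (\<lambda>s. f (stop_at r s)) t = abs_path_integral h f (stop_at r t)"
    and path_integral_stop_at:
      "path_integral (\<lambda>s. h (stop_at r s)) (\<lambda>s. f (stop_at r s)) t = path_integral h f (stop_at r t)"
proof -
  let ?f = "\<lambda>s. f (stop_at r s)" and ?h = "\<lambda>s. h (stop_at r s)" and ?m = "\<lambda>s. h (stop_at r (max 0 s))"
  define u where "u = stop_at r t"
  have u: "0 \<le> u" "u \<le> t" "ennreal u \<le> r"
    unfolding u_def using stop_at_nonneg[OF t] stop_at_le ennreal_stop_at_le by blast+
  have const: "?f s = ?f u" if "u \<le> s" "s \<le> t" for s
    using that unfolding u_def by (cases r) (auto simp: stop_at_ennreal intro!: arg_cong[where f=f])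
  have "abs_path_integral ?h ?f t = abs_path_integral ?m ?f t"
    by (intro path_integral_cong t) auto
  also have "\<dots> = abs_path_integral ?m ?f u"
    by (rule abs_path_integral_const_after[OF f h u(1,2)]) (rule const)
  also have "\<dots> = abs_path_integral h f u"
    using u by (intro path_integral_cong) (auto simp: stop_at_eq)
  finally show "abs_path_integral ?h ?f t = abs_path_integral h f (stop_at r t)" by (simp add: u_def)
  have "path_integral ?h ?f t = path_integral ?m ?f t"
    by (intro path_integral_cong t) auto
  also have "\<dots> = path_integral ?m ?f u"
    by (rule path_integral_const_after[OF f h u(1,2)]) (rule const)
  also have "\<dots> = path_integral h f u"
    using u by (intro path_integral_cong) (auto simp: stop_at_eq)
  finally show "path_integral ?h ?f t = path_integral h f (stop_at r t)" by (simp add: u_def)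
qed

section \<open>Indistinguishability, stopped processes and the debut\<close>

lemma indist_sym:
  assumes "indist M X Y"
  shows "indist M Y X"
  using assms unfolding indist_def by eventually_elim auto

lemma indist_trans [trans]:
  assumes "indist M X Y" "indist M Y Z"
  shows "indist M X Z"
  using assms unfolding indist_def by eventually_elim auto

lemma indist_refl: "indist M X X"
  by (simp add: indist_def)

lemma mod_indistI: "Y \<in> C \<Longrightarrow> indist M X Y \<Longrightarrow> X \<in> mod_indist M C"
  by (auto simp: mod_indist_def)

lemma mod_indist_closed: "X \<in> mod_indist M C \<Longrightarrow> indist M Y X \<Longrightarrow> Y \<in> mod_indist M C"
  by (auto simp: mod_indist_def intro: indist_trans)

lemma mod_indist_mono: "C \<subseteq> C' \<Longrightarrow> mod_indist M C \<subseteq> mod_indist M C'"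
  unfolding mod_indist_def by blast

lemma class_on_mono: "C \<subseteq> C' \<Longrightarrow> class_on M F C B \<subseteq> class_on M F C' B"
  unfolding class_on_def fundamental_coupled_seq_def by blast

lemma stopped_lin_comb: "stopped (lin_comb a X b Y) \<tau> = lin_comb a (stopped X \<tau>) b (stopped Y \<tau>)"
  by (simp add: fun_eq_iff stopped_eq_stop_at lin_comb_def)

lemma stopped_proc_mult: "stopped (proc_mult X Y) \<tau> = proc_mult (stopped X \<tau>) (stopped Y \<tau>)"
  by (simp add: fun_eq_iff stopped_eq_stop_at proc_mult_def)

text \<open>A nonnegative time lies outside the section of \<open>B\<close> exactly if it is
  strictly beyond every \<open>\<tau> n \<omega>\<close>. A gap between the supremum and the debut
  would contain such a time.\<close>

lemma tendsto_debut_compl: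
  assumes "fundamental_seq M F B \<tau>" "\<omega> \<in> space M"
  shows "(\<lambda>n. \<tau> n \<omega>) \<longlonglongrightarrow> debut_compl B \<omega>"
proof -
  have B: "(\<omega>, t) \<in> B \<longleftrightarrow> 0 \<le> t \<and> (\<exists>n. ennreal t \<le> \<tau> n \<omega>)" for t
    using assms by (auto simp: fundamental_seq_def stoch_upto_def)
  have "debut_compl B \<omega> = (SUP n. \<tau> n \<omega>)"
  proof (rule antisym)
    show "(SUP n. \<tau> n \<omega>) \<le> debut_compl B \<omega>"
      unfolding debut_compl_def by (intro SUP_least INF_greatest) (use B in \<open>auto simp: not_le less_imp_le\<close>)
    show "debut_compl B \<omega> \<le> (SUP n. \<tau> n \<omega>)"
    proof (rule ccontr)
      assume "\<not> ?thesis"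
      then have "(SUP n. \<tau> n \<omega>) < debut_compl B \<omega>" by (simp add: not_le)
      from dense[OF this] obtain c where c: "(SUP n. \<tau> n \<omega>) < c" "c < debut_compl B \<omega>" by blast
      then have "c \<noteq> top" by auto
      then obtain t where t: "c = ennreal t" "0 \<le> t" by (cases c) auto
      have "\<tau> n \<omega> < c" for n
        using le_less_trans[OF SUP_upper[of n UNIV "\<lambda>n. \<tau> n \<omega>"] c(1)] by simp
      then have "(\<omega>, t) \<notin> B" using B t by (auto simp: not_le)
      then have "debut_compl B \<omega> \<le> c" unfolding debut_compl_def t by (intro INF_lower) (use t in auto)
      then show False using c(2) by simp
    qed
  qed
  then show ?thesis
    using assms by (simp add: fundamental_seq_def increasing_stopping_times_def LIMSEQ_SUP)
qed

subsection \<open>Integrands and integrators\<close>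

text \<open>The two pairs of classes of the theorem are the instances \<open>G = (\<lambda>_. M)\<close>, \<open>S = M \<Otimes> borel\<close> and
  \<open>G = F\<close>, \<open>S\<close> the predictable \<open>\<sigma>\<close>-algebra. Only two properties of \<open>S\<close> matter: its processes are
  progressively measurable with respect to \<open>G\<close>, and \<open>S\<close> is stable under stopping.\<close>

locale progressive_setting = complete_measure M
  for M :: "'a measure" +
  fixes F :: "ennreal \<Rightarrow> 'a measure" and G :: "real \<Rightarrow> 'a measure" and S :: "('a \<times> real) measure"
  assumes space_G: "0 \<le> t \<Longrightarrow> space (G t) = space M"
    and sets_G_mono: "0 \<le> s \<Longrightarrow> s \<le> t \<Longrightarrow> sets (G s) \<subseteq> sets (G t)"
    and sets_G_subset: "0 \<le> t \<Longrightarrow> sets (G t) \<subseteq> sets M"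
    and null_sets_G: "0 \<le> t \<Longrightarrow> null_sets M \<subseteq> sets (G t)"
    and stopping_time_G: "stopping_time F T \<Longrightarrow> 0 \<le> t \<Longrightarrow> {\<omega> \<in> space M. T \<omega> \<le> ennreal t} \<in> sets (G t)"
    and clip_measurable: "0 \<le> t \<Longrightarrow> (\<lambda>(\<omega>, s). (\<omega>, max 0 (min s t))) \<in> measurable (G t \<Otimes>\<^sub>M borel) S"
    and stop_measurable: "stopping_time F T \<Longrightarrow> (\<lambda>(\<omega>, t). (\<omega>, stop_at (T \<omega>) t)) \<in> measurable S S"
    and S_coarser: "(\<lambda>x. x) \<in> measurable (M \<Otimes>\<^sub>M restrict_space borel {0..}) S"
    and stopping_time_M: "stopping_time F T \<Longrightarrow> T \<in> borel_measurable M"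
begin

definition integrands :: "'a process set" where
  "integrands = mod_indist M {X. case_prod X \<in> borel_measurable S}"

definition integrators :: "'a process set" where
  "integrators = mod_indist M {A. (\<forall>t\<ge>0. (\<lambda>\<omega>. A \<omega> t) \<in> borel_measurable (G t)) \<and>
     (\<forall>\<omega>\<in>space M. fv_path (A \<omega>))}"

lemma integrands_measurable: "integrands \<subseteq> measurable_processes M"
proof -
  have "case_prod X \<in> borel_measurable (M \<Otimes>\<^sub>M restrict_space borel {0..})"
    if "case_prod X \<in> borel_measurable S" for X :: "'a process"
    using measurable_compose[OF S_coarser that] by simp
  then show ?thesis unfolding integrands_def measurable_processes_def by (intro mod_indist_mono) blast
qed

lemma borel_measurable_G_M: "f \<in> borel_measurable (G t) \<Longrightarrow> 0 \<le> t \<Longrightarrow> f \<in> borel_measurable M"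
  using sets_G_subset[of t] space_G[of t] unfolding measurable_def by auto

lemma borel_measurable_G_mono:
  "f \<in> borel_measurable (G s) \<Longrightarrow> 0 \<le> s \<Longrightarrow> s \<le> t \<Longrightarrow> f \<in> borel_measurable (G t)"
  using sets_G_mono[of s t] space_G[of s] space_G[of t] unfolding measurable_def by auto

lemma integrators_fv: "integrators \<subseteq> fv_processes M"
  unfolding integrators_def fv_processes_def is_process_def
  using borel_measurable_G_M by (intro mod_indist_mono) blast

text \<open>Preimages under the two processes differ by a null set, and the measure is
  complete.\<close>

lemma is_process_indist:
  assumes "is_process M X" "indist M X Y"
  shows "is_process M Y"
  unfolding is_process_def
proof (intro allI impI measurableI)
  fix t :: real and A :: "real set" assume t: "0 \<le> t" and A: "A \<in> sets borel"
  show "(\<lambda>\<omega>. Y \<omega> t) -` A \<inter> space M \<in> sets M"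
  proof (rule in_sets_AE)
    show "(\<lambda>\<omega>. X \<omega> t) -` A \<inter> space M \<in> sets M"
      using assms(1) t A by (auto simp: is_process_def intro: measurable_sets)
    show "AE \<omega> in M. \<omega> \<in> (\<lambda>\<omega>. X \<omega> t) -` A \<inter> space M \<longleftrightarrow> \<omega> \<in> (\<lambda>\<omega>. Y \<omega> t) -` A \<inter> space M"
      using assms(2) unfolding indist_def by eventually_elim (use t in auto)
  qed auto
qed auto

lemma integrands_process: "X \<in> integrands \<Longrightarrow> is_process M X"
proof -
  assume "X \<in> integrands"
  then obtain Y where Y: "case_prod Y \<in> borel_measurable S" "indist M Y X"
    by (auto simp: integrands_def mod_indist_def intro: indist_sym)
  have "(\<lambda>\<omega>. Y \<omega> t) \<in> borel_measurable M" if t: "0 \<le> t" for t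
  proof -
    have "(\<lambda>\<omega>. (\<omega>, t)) \<in> measurable (G t) (G t \<Otimes>\<^sub>M borel)" by measurable
    from measurable_compose[OF measurable_compose[OF this clip_measurable[OF t]] Y(1)]
    have "(\<lambda>\<omega>. Y \<omega> t) \<in> borel_measurable (G t)" using t by simp
    then show ?thesis using t by (rule borel_measurable_G_M)
  qed
  then show ?thesis using is_process_indist[OF _ Y(2)] by (simp add: is_process_def)
qed

lemma integrators_process: "X \<in> integrators \<Longrightarrow> is_process M X"
proof -
  assume "X \<in> integrators"
  then obtain Y where Y: "\<And>t. 0 \<le> t \<Longrightarrow> (\<lambda>\<omega>. Y \<omega> t) \<in> borel_measurable (G t)" "indist M Y X"
    by (auto simp: integrators_def mod_indist_def intro: indist_sym)
  then show ?thesis using is_process_indist[OF _ Y(2)] borel_measurable_G_M by (auto simp: is_process_def)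
qed

lemma integrators_path:
  assumes "A \<in> integrators"
  shows "AE \<omega> in M. fv_path (A \<omega>)"
proof -
  obtain Z where Z: "indist M A Z" "\<And>\<omega>. \<omega> \<in> space M \<Longrightarrow> fv_path (Z \<omega>)"
    using assms by (auto simp: integrators_def mod_indist_def)
  from Z(1) show ?thesis
    unfolding indist_def
  proof (rule AE_mp, intro AE_I2 impI)
    fix \<omega> assume "\<omega> \<in> space M" "\<forall>t\<ge>0. A \<omega> t = Z \<omega> t"
    then show "fv_path (A \<omega>)" using Z(2) by (intro fv_path_cong[of "Z \<omega>" "A \<omega>"]) auto
  qed
qed

text \<open>Progressive measurability only speaks of paths clipped at a finite horizon; the full
  path is the limit over integer horizons.\<close>

lemma strict_path_measurable:
  fixes Y :: "'a process"
  assumes "case_prod Y \<in> borel_measurable S" "\<omega> \<in> space M"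
  shows "(\<lambda>s. Y \<omega> (max 0 s)) \<in> borel_measurable borel"
proof (rule borel_measurable_LIMSEQ_real)
  fix s :: real
  have "\<forall>\<^sub>F n in sequentially. s \<le> real n"
    using eventually_ge_at_top[of "nat \<lceil>s\<rceil>"] by eventually_elim linarith
  then have "\<forall>\<^sub>F n in sequentially. Y \<omega> (max 0 (min s (real n))) = Y \<omega> (max 0 s)"
    by eventually_elim simp
  then show "(\<lambda>n. Y \<omega> (max 0 (min s (real n)))) \<longlonglongrightarrow> Y \<omega> (max 0 s)" by (rule tendsto_eventually)
next
  fix n :: nat
  have "\<omega> \<in> space (G (real n))" using assms(2) by (simp add: space_G)
  from measurable_compose[OF measurable_compose[OF measurable_Pair1'[OF this] clip_measurable] assms(1)]
  show "(\<lambda>s. Y \<omega> (max 0 (min s (real n)))) \<in> borel_measurable borel" by simp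
qed

text \<open>Precomposition with \<open>max 0\<close> is unavoidable: a version controls the path at
  nonnegative times only.\<close>

lemma integrands_path:
  assumes "H \<in> integrands"
  shows "AE \<omega> in M. (\<lambda>s. H \<omega> (max 0 s)) \<in> borel_measurable borel"
proof -
  obtain Y where Y: "indist M H Y" "case_prod Y \<in> borel_measurable S"
    using assms by (auto simp: integrands_def mod_indist_def)
  from Y(1) show ?thesis
    unfolding indist_def
  proof (rule AE_mp, intro AE_I2 impI)
    fix \<omega> assume "\<omega> \<in> space M" "\<forall>t\<ge>0. H \<omega> t = Y \<omega> t"
    then show "(\<lambda>s. H \<omega> (max 0 s)) \<in> borel_measurable borel" using strict_path_measurable[OF Y(2)] by simp
  qed
qed

section \<open>Closure properties of integrands and integrators\<close>

lemma integrands_closed: "X \<in> integrands \<Longrightarrow> indist M Y X \<Longrightarrow> Y \<in> integrands"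
  unfolding integrands_def by (rule mod_indist_closed)

lemma integrators_closed: "X \<in> integrators \<Longrightarrow> indist M Y X \<Longrightarrow> Y \<in> integrators"
  unfolding integrators_def by (rule mod_indist_closed)

lemma integrands_lin_comb:
  assumes "H \<in> integrands" "K \<in> integrands"
  shows "lin_comb a H b K \<in> integrands"
proof -
  obtain Y Z where Y: "indist M H Y" "case_prod Y \<in> borel_measurable S"
    and Z: "indist M K Z" "case_prod Z \<in> borel_measurable S"
    using assms by (auto simp: integrands_def mod_indist_def)
  have "case_prod (lin_comb a Y b Z) = (\<lambda>x. a * case_prod Y x + b * case_prod Z x)"
    by (auto simp: lin_comb_def)
  then have "case_prod (lin_comb a Y b Z) \<in> borel_measurable S" using Y(2) Z(2) by simp
  moreover have "indist M (lin_comb a H b K) (lin_comb a Y b Z)"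
    using Y(1) Z(1) unfolding indist_def by eventually_elim (auto simp: lin_comb_def)
  ultimately show ?thesis unfolding integrands_def by (intro mod_indistI) auto
qed

lemma integrands_proc_mult:
  assumes "H \<in> integrands" "K \<in> integrands"
  shows "proc_mult H K \<in> integrands"
proof -
  obtain Y Z where Y: "indist M H Y" "case_prod Y \<in> borel_measurable S"
    and Z: "indist M K Z" "case_prod Z \<in> borel_measurable S"
    using assms by (auto simp: integrands_def mod_indist_def)
  have "case_prod (proc_mult Y Z) = (\<lambda>x. case_prod Y x * case_prod Z x)"
    by (auto simp: proc_mult_def)
  then have "case_prod (proc_mult Y Z) \<in> borel_measurable S" using Y(2) Z(2) by simp
  moreover have "indist M (proc_mult H K) (proc_mult Y Z)"
    using Y(1) Z(1) unfolding indist_def by eventually_elim (auto simp: proc_mult_def)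
  ultimately show ?thesis unfolding integrands_def by (intro mod_indistI) auto
qed

lemma integrators_lin_comb:
  assumes "A \<in> integrators" "V \<in> integrators"
  shows "lin_comb a A b V \<in> integrators"
proof -
  obtain Y Z where Y: "indist M A Y" "\<And>t. 0 \<le> t \<Longrightarrow> (\<lambda>\<omega>. Y \<omega> t) \<in> borel_measurable (G t)"
      "\<And>\<omega>. \<omega> \<in> space M \<Longrightarrow> fv_path (Y \<omega>)"
    and Z: "indist M V Z" "\<And>t. 0 \<le> t \<Longrightarrow> (\<lambda>\<omega>. Z \<omega> t) \<in> borel_measurable (G t)"
      "\<And>\<omega>. \<omega> \<in> space M \<Longrightarrow> fv_path (Z \<omega>)"
    using assms by (auto simp: integrators_def mod_indist_def)
  have "indist M (lin_comb a A b V) (lin_comb a Y b Z)"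
    using Y(1) Z(1) unfolding indist_def by eventually_elim (auto simp: lin_comb_def)
  then show ?thesis
    unfolding integrators_def using Y(2,3) Z(2,3)
    by (intro mod_indistI[of "lin_comb a Y b Z"]) (auto simp: lin_comb_def fv_path_linear)
qed

text \<open>Exceptional null sets belong to every \<open>G t\<close>, so that paths may be replaced by \<open>0\<close> there.\<close>

lemma integrators_AE_I:
  assumes adapted: "\<And>t. 0 \<le> t \<Longrightarrow> (\<lambda>\<omega>. A \<omega> t) \<in> borel_measurable (G t)"
    and fv: "AE \<omega> in M. fv_path (A \<omega>)"
  shows "A \<in> integrators"
proof -
  define N where "N = {\<omega> \<in> space M. \<not> fv_path (A \<omega>)}"
  have N: "N \<in> null_sets M" using fv unfolding N_def AE_iff_null_sets .
  define Z where "Z \<omega> t = (if \<omega> \<in> N then 0 else A \<omega> t)" for \<omega> t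
  have "indist M A Z"
    using fv unfolding indist_def by eventually_elim (auto simp: Z_def N_def)
  moreover have "(\<lambda>\<omega>. Z \<omega> t) \<in> borel_measurable (G t)" if t: "0 \<le> t" for t
    unfolding Z_def using adapted[OF t] N null_sets_G[OF t] by (intro measurable_If_set) auto
  moreover have "fv_path (Z \<omega>)" if "\<omega> \<in> space M" for \<omega>
    using that fv_path_zero by (cases "\<omega> \<in> N") (auto simp: Z_def[abs_def] N_def)
  ultimately show ?thesis unfolding integrators_def by (intro mod_indistI) auto
qed

text \<open>For the good versions \<open>Y\<close> and \<open>Z\<close> the integral is adapted at
  every \<omega>, finite or not. Finiteness holds almost surely and gives finite variation almost
  surely, which suffices by \<open>integrators_AE_I\<close>.\<close>

lemma integral_process_integrator:
  assumes H: "H \<in> integrands" and A: "A \<in> integrators"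
    and fin: "AE \<omega> in M. \<forall>t\<ge>0. abs_path_integral (H \<omega>) (A \<omega>) t < \<infinity>"
  shows "integral_process H A \<in> integrators"
proof -
  obtain Y where Y: "indist M H Y" "case_prod Y \<in> borel_measurable S"
    using H by (auto simp: integrands_def mod_indist_def)
  obtain Z where Z: "indist M A Z" "\<And>t. 0 \<le> t \<Longrightarrow> (\<lambda>\<omega>. Z \<omega> t) \<in> borel_measurable (G t)"
      "\<And>\<omega>. \<omega> \<in> space M \<Longrightarrow> fv_path (Z \<omega>)"
    using A by (auto simp: integrators_def mod_indist_def)
  define P where "P \<omega> t = path_integral (\<lambda>s. Y \<omega> (max 0 s)) (Z \<omega>) t" for \<omega> t
  have eq: "AE \<omega> in M. \<forall>t\<ge>0. abs_path_integral (\<lambda>s. Y \<omega> (max 0 s)) (Z \<omega>) t < \<infinity> \<and>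
      path_integral (H \<omega>) (A \<omega>) t = P \<omega> t"
    using Y(1) Z(1) fin unfolding indist_def
  proof eventually_elim
    case (elim \<omega>)
    show ?case
    proof (intro allI impI)
      fix t :: real assume t: "0 \<le> t"
      have "abs_path_integral (H \<omega>) (A \<omega>) t = abs_path_integral (\<lambda>s. Y \<omega> (max 0 s)) (Z \<omega>) t"
        "path_integral (H \<omega>) (A \<omega>) t = P \<omega> t"
        unfolding P_def using elim by (auto intro!: path_integral_cong t)
      then show "abs_path_integral (\<lambda>s. Y \<omega> (max 0 s)) (Z \<omega>) t < \<infinity> \<and>
          path_integral (H \<omega>) (A \<omega>) t = P \<omega> t"
        using elim(3) t by auto
    qed
  qed
  have "P \<in> integrators"
  proof (rule integrators_AE_I)
    fix t :: real assume t: "0 \<le> t"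
    \<comment> \<open>Clipping the integrand at \<open>t\<close> leaves the integral unchanged and
      makes the integrand jointly measurable with respect to \<open>G t\<close>.\<close>
    have "P \<omega> t = path_integral (\<lambda>s. Y \<omega> (max 0 (min s t))) (Z \<omega>) t" for \<omega>
      unfolding P_def by (intro path_integral_cong t) auto
    moreover have "(\<lambda>\<omega>. path_integral (\<lambda>s. Y \<omega> (max 0 (min s t))) (Z \<omega>) t) \<in> borel_measurable (G t)"
    proof (rule borel_measurable_path_integral[OF _ t])
      show "fv_path (Z \<omega>)" if "\<omega> \<in> space (G t)" for \<omega> using that Z(3) space_G[OF t] by simp
      show "(\<lambda>\<omega>. Z \<omega> r) \<in> borel_measurable (G t)" if "0 \<le> r" "r \<le> t" for r
        using borel_measurable_G_mono[OF Z(2)[OF that(1)] that] .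
      show "(\<lambda>(\<omega>, s). Y \<omega> (max 0 (min s t))) \<in> borel_measurable (G t \<Otimes>\<^sub>M borel)"
        using measurable_compose[OF clip_measurable[OF t] Y(2)] by (simp add: case_prod_beta')
    qed
    ultimately show "(\<lambda>\<omega>. P \<omega> t) \<in> borel_measurable (G t)" by simp
  next
    show "AE \<omega> in M. fv_path (P \<omega>)"
      using eq AE_space
    proof eventually_elim
      case (elim \<omega>)
      have "fv_path (path_integral (\<lambda>s. Y \<omega> (max 0 s)) (Z \<omega>))"
        using elim Z(3) strict_path_measurable[OF Y(2)] by (intro fv_path_path_integral) auto
      then show ?case by (simp add: P_def[abs_def])
    qed
  qed
  moreover have "indist M (integral_process H A) P"
    using eq unfolding indist_def integral_process_def by eventually_elim auto
  ultimately show ?thesis by (rule integrators_closed)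
qed

text \<open>The stopped time is approximated from the right by times with countably many values, and
  the right-continuous path is evaluated along them.\<close>

lemma stopped_adapted:
  assumes T: "stopping_time F T" and t: "0 \<le> t"
    and adapted: "\<And>t. 0 \<le> t \<Longrightarrow> (\<lambda>\<omega>. A \<omega> t) \<in> borel_measurable (G t)"
    and fv: "\<And>\<omega>. \<omega> \<in> space M \<Longrightarrow> fv_path (A \<omega>)"
  shows "(\<lambda>\<omega>. A \<omega> (stop_at (T \<omega>) t)) \<in> borel_measurable (G t)"
proof -
  define v where "v \<omega> = stop_at (T \<omega>) t" for \<omega>
  have v: "0 \<le> v \<omega>" "v \<omega> \<le> t" for \<omega>
    unfolding v_def using stop_at_nonneg[OF t] stop_at_le by auto
  have v_meas: "v \<in> borel_measurable (G t)"
  proof (rule borel_measurableI_le)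
    fix c :: real
    show "{\<omega> \<in> space (G t). v \<omega> \<le> c} \<in> sets (G t)"
    proof (cases "0 \<le> c \<and> c < t")
      case True
      have "v \<omega> \<le> c \<longleftrightarrow> T \<omega> \<le> ennreal c" for \<omega>
        using True by (cases "T \<omega>") (auto simp: v_def stop_at_ennreal ennreal_le_iff top_unique)
      then have "{\<omega> \<in> space (G t). v \<omega> \<le> c} = {\<omega> \<in> space M. T \<omega> \<le> ennreal c}"
        by (simp add: space_G[OF t])
      then show ?thesis using stopping_time_G[OF T, of c] sets_G_mono[of c t] True by auto
    next
      case False
      then consider "c < 0" | "t \<le> c" by linarith
      then show ?thesis
      proof cases
        case 1
        then have "{\<omega> \<in> space (G t). v \<omega> \<le> c} = {}" using v(1) by (auto simp: not_le intro: less_le_trans)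
        then show ?thesis by (simp only: sets.empty_sets)
      next
        case 2
        then have "{\<omega> \<in> space (G t). v \<omega> \<le> c} = space (G t)" using v(2) by (auto intro: order_trans)
        then show ?thesis by (simp only: sets.top)
      qed
    qed
  qed
  \<comment> \<open>The cap at \<open>t\<close> keeps the approximation from looking beyond time
    \<open>t\<close>.\<close>
  define r where "r m \<omega> = min t (max 0 (of_int \<lceil>v \<omega> * real (Suc m)\<rceil> / real (Suc m)))" for m \<omega>
  have bd: "v \<omega> \<le> r m \<omega>" "r m \<omega> \<le> v \<omega> + 1 / real (Suc m)" for m \<omega>
  proof -
    define c where "c = real (Suc m)"
    have c: "0 < c" by (simp add: c_def)
    have "v \<omega> * c \<le> of_int \<lceil>v \<omega> * c\<rceil>" "of_int \<lceil>v \<omega> * c\<rceil> \<le> v \<omega> * c + 1" by linarith+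
    then have "v \<omega> \<le> of_int \<lceil>v \<omega> * c\<rceil> / c" "of_int \<lceil>v \<omega> * c\<rceil> / c \<le> v \<omega> + 1 / c"
      using c by (simp_all add: field_simps)
    then show "v \<omega> \<le> r m \<omega>" "r m \<omega> \<le> v \<omega> + 1 / real (Suc m)"
      unfolding r_def c_def[symmetric] using v[of \<omega>] c by (auto simp: min_def max_def)
  qed
  have "(\<lambda>\<omega>. A \<omega> (v \<omega>)) \<in> borel_measurable (G t)"
  proof (rule borel_measurable_LIMSEQ_real)
    fix \<omega> assume "\<omega> \<in> space (G t)"
    then have f: "fv_path (A \<omega>)" using fv space_G[OF t] by simp
    show "(\<lambda>m. A \<omega> (r m \<omega>)) \<longlonglongrightarrow> A \<omega> (v \<omega>)"
    proof (rule right_continuous_sequentially[where f="A \<omega>"])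
      show "(\<lambda>m. r m \<omega>) \<longlonglongrightarrow> v \<omega>"
      proof (rule tendsto_sandwich[where f="\<lambda>_. v \<omega>" and h="\<lambda>m. v \<omega> + 1 / real (Suc m)"])
        show "(\<lambda>m. v \<omega> + 1 / real (Suc m)) \<longlonglongrightarrow> v \<omega>"
          using tendsto_add[OF tendsto_const[of "v \<omega>"] lim_1_over_n[where 'a=real, THEN LIMSEQ_Suc]] by simp
        show "\<forall>\<^sub>F m in sequentially. v \<omega> \<le> r m \<omega>"
          "\<forall>\<^sub>F m in sequentially. r m \<omega> \<le> v \<omega> + 1 / real (Suc m)"
          by (rule always_eventually, rule allI, rule bd)+
      qed simp
    qed (intro fv_path_right_cont f v bd)+
  next
    fix m
    \<comment> \<open>Freezing the rounded value at an integer \<open>i\<close>, possibly negative,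
      explains the \<open>max 0\<close>: every frozen time lies in [0, t].\<close>
    have "(\<lambda>\<omega>. A \<omega> (min t (max 0 (of_int i / real (Suc m))))) \<in> borel_measurable (G t)" for i :: int
      using t by (intro borel_measurable_G_mono[OF adapted]) auto
    moreover have "(\<lambda>\<omega>. \<lceil>v \<omega> * real (Suc m)\<rceil>) \<in> measurable (G t) (count_space UNIV)"
      using v_meas by measurable
    ultimately show "(\<lambda>\<omega>. A \<omega> (r m \<omega>)) \<in> borel_measurable (G t)"
      unfolding r_def by (rule measurable_compose_countable)
  qed
  then show ?thesis by (simp add: v_def)
qed

end

section \<open>Linearity and associativity of integrals over the whole half-line\<close>

context progressive_setting
begin

lemma integrable_wrt_iff:
  assumes "H \<in> integrands" "A \<in> integrators"
  shows "integrable_wrt M H A \<longleftrightarrow> (AE \<omega> in M. \<forall>t\<ge>0. abs_path_integral (H \<omega>) (A \<omega>) t < \<infinity>)"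
  using assms integrands_measurable integrators_fv by (auto simp: integrable_wrt_def)

lemma integral_process_integrable:
  assumes "H \<in> integrands" "A \<in> integrators" "integrable_wrt M H A"
  shows "integral_process H A \<in> integrators"
  using assms by (intro integral_process_integrator) (simp_all add: integrable_wrt_iff)

text \<open>Needed for iterated integrals: an integral on \<open>B\<close>, once stopped, is known
  only up to indistinguishability, and then acts as an integrator itself.\<close>

lemma
  assumes H: "H \<in> integrands" and A: "A \<in> integrators" and A': "A' \<in> integrators" and AA': "indist M A A'"
  shows integrable_wrt_indist: "integrable_wrt M H A \<longleftrightarrow> integrable_wrt M H A'"
    and integral_process_indist: "indist M (integral_process H A) (integral_process H A')"
proof -
  have eq: "AE \<omega> in M. \<forall>t\<ge>0. abs_path_integral (H \<omega>) (A \<omega>) t = abs_path_integral (H \<omega>) (A' \<omega>) t \<and>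
    path_integral (H \<omega>) (A \<omega>) t = path_integral (H \<omega>) (A' \<omega>) t"
    using AA' unfolding indist_def
  proof eventually_elim
    case (elim \<omega>)
    then show ?case by (auto intro!: path_integral_cong)
  qed
  then show "indist M (integral_process H A) (integral_process H A')"
    unfolding indist_def integral_process_def by eventually_elim auto
  show "integrable_wrt M H A \<longleftrightarrow> integrable_wrt M H A'"
    unfolding integrable_wrt_iff[OF H A] integrable_wrt_iff[OF H A']
  proof
    assume "AE \<omega> in M. \<forall>t\<ge>0. abs_path_integral (H \<omega>) (A \<omega>) t < \<infinity>"
    with eq show "AE \<omega> in M. \<forall>t\<ge>0. abs_path_integral (H \<omega>) (A' \<omega>) t < \<infinity>"
      by eventually_elim auto
  next
    assume "AE \<omega> in M. \<forall>t\<ge>0. abs_path_integral (H \<omega>) (A' \<omega>) t < \<infinity>"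
    with eq show "AE \<omega> in M. \<forall>t\<ge>0. abs_path_integral (H \<omega>) (A \<omega>) t < \<infinity>"
      by eventually_elim auto
  qed
qed

lemma
  assumes H: "H \<in> integrands" and K: "K \<in> integrands" and A: "A \<in> integrators"
    and HA: "integrable_wrt M H A" and KA: "integrable_wrt M K A"
  shows integrable_wrt_lin_comb_left: "integrable_wrt M (lin_comb a H b K) A"
    and integral_process_lin_comb_left:
      "indist M (integral_process (lin_comb a H b K) A) (lin_comb a (integral_process H A) b (integral_process K A))"
proof -
  have *: "AE \<omega> in M. \<forall>t\<ge>0. abs_path_integral (lin_comb a H b K \<omega>) (A \<omega>) t < \<infinity> \<and>
    path_integral (lin_comb a H b K \<omega>) (A \<omega>) t = a * path_integral (H \<omega>) (A \<omega>) t + b * path_integral (K \<omega>) (A \<omega>) t"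
    using integrators_path[OF A] integrands_path[OF H] integrands_path[OF K]
      HA[unfolded integrable_wrt_iff[OF H A]] KA[unfolded integrable_wrt_iff[OF K A]]
  proof eventually_elim
    case (elim \<omega>)
    show ?case
    proof (intro allI impI)
      fix t :: real assume t: "0 \<le> t"
      let ?h = "\<lambda>s. H \<omega> (max 0 s)" and ?k = "\<lambda>s. K \<omega> (max 0 s)"
      have c: "abs_path_integral (lin_comb a H b K \<omega>) (A \<omega>) t = abs_path_integral (\<lambda>s. a * ?h s + b * ?k s) (A \<omega>) t"
        "path_integral (lin_comb a H b K \<omega>) (A \<omega>) t = path_integral (\<lambda>s. a * ?h s + b * ?k s) (A \<omega>) t"
        "abs_path_integral (H \<omega>) (A \<omega>) t = abs_path_integral ?h (A \<omega>) t"
        "path_integral (H \<omega>) (A \<omega>) t = path_integral ?h (A \<omega>) t"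
        "abs_path_integral (K \<omega>) (A \<omega>) t = abs_path_integral ?k (A \<omega>) t"
        "path_integral (K \<omega>) (A \<omega>) t = path_integral ?k (A \<omega>) t"
        by (auto intro!: path_integral_cong t simp: lin_comb_def)
      have fin: "abs_path_integral ?h (A \<omega>) t < \<infinity>" "abs_path_integral ?k (A \<omega>) t < \<infinity>"
        using elim(4,5) t c by auto
      show "abs_path_integral (lin_comb a H b K \<omega>) (A \<omega>) t < \<infinity> \<and>
        path_integral (lin_comb a H b K \<omega>) (A \<omega>) t = a * path_integral (H \<omega>) (A \<omega>) t + b * path_integral (K \<omega>) (A \<omega>) t"
        unfolding c
        using abs_path_integral_linear_left[OF elim(1) t elim(2) fin(1) elim(3) fin(2)]
          path_integral_linear_left[OF elim(1) t elim(2) fin(1) elim(3) fin(2)] by simp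
    qed
  qed
  then have "AE \<omega> in M. \<forall>t\<ge>0. abs_path_integral (lin_comb a H b K \<omega>) (A \<omega>) t < \<infinity>"
    by eventually_elim auto
  then show "integrable_wrt M (lin_comb a H b K) A"
    by (simp only: integrable_wrt_iff[OF integrands_lin_comb[OF H K] A])
  show "indist M (integral_process (lin_comb a H b K) A) (lin_comb a (integral_process H A) b (integral_process K A))"
    using * unfolding indist_def
    by eventually_elim (auto simp: integral_process_def lin_comb_def)
qed

lemma
  assumes H: "H \<in> integrands" and A: "A \<in> integrators" and V: "V \<in> integrators"
    and HA: "integrable_wrt M H A" and HV: "integrable_wrt M H V"
  shows integrable_wrt_lin_comb_right: "integrable_wrt M H (lin_comb a A b V)"
    and integral_process_lin_comb_right:
      "indist M (integral_process H (lin_comb a A b V)) (lin_comb a (integral_process H A) b (integral_process H V))"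
proof -
  have *: "AE \<omega> in M. \<forall>t\<ge>0. abs_path_integral (H \<omega>) (lin_comb a A b V \<omega>) t < \<infinity> \<and>
    path_integral (H \<omega>) (lin_comb a A b V \<omega>) t = a * path_integral (H \<omega>) (A \<omega>) t + b * path_integral (H \<omega>) (V \<omega>) t"
    using integrators_path[OF A] integrators_path[OF V] integrands_path[OF H]
      HA[unfolded integrable_wrt_iff[OF H A]] HV[unfolded integrable_wrt_iff[OF H V]]
  proof eventually_elim
    case (elim \<omega>)
    show ?case
    proof (intro allI impI)
      fix t :: real assume t: "0 \<le> t"
      let ?h = "\<lambda>s. H \<omega> (max 0 s)"
      have c: "abs_path_integral (H \<omega>) f t = abs_path_integral ?h f t"
        "path_integral (H \<omega>) f t = path_integral ?h f t" for f
        by (auto intro!: path_integral_cong t)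
      have fin: "abs_path_integral ?h (A \<omega>) t < \<infinity>" "abs_path_integral ?h (V \<omega>) t < \<infinity>"
        using elim(4,5) t c by auto
      have L: "lin_comb a A b V \<omega> = (\<lambda>s. a * A \<omega> s + b * V \<omega> s)" by (simp add: lin_comb_def)
      show "abs_path_integral (H \<omega>) (lin_comb a A b V \<omega>) t < \<infinity> \<and>
        path_integral (H \<omega>) (lin_comb a A b V \<omega>) t = a * path_integral (H \<omega>) (A \<omega>) t + b * path_integral (H \<omega>) (V \<omega>) t"
        unfolding c L
        using abs_path_integral_linear_right[OF elim(1,2) t elim(3) fin]
          path_integral_linear_right[OF elim(1,2) t elim(3) fin] by simp
    qed
  qed
  then have "AE \<omega> in M. \<forall>t\<ge>0. abs_path_integral (H \<omega>) (lin_comb a A b V \<omega>) t < \<infinity>"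
    by eventually_elim auto
  then show "integrable_wrt M H (lin_comb a A b V)"
    by (simp only: integrable_wrt_iff[OF H integrators_lin_comb[OF A V]])
  show "indist M (integral_process H (lin_comb a A b V)) (lin_comb a (integral_process H A) b (integral_process H V))"
    using * unfolding indist_def
    by eventually_elim (auto simp: integral_process_def lin_comb_def)
qed

text \<open>The two absolute integrals agree in [0, \<infinity>] for almost all paths, so finiteness
  transfers in both directions.\<close>

lemma
  assumes H: "H \<in> integrands" and H': "H' \<in> integrands" and A: "A \<in> integrators"
    and HA: "integrable_wrt M H A"
  shows integrable_wrt_assoc:
      "integrable_wrt M H' (integral_process H A) \<longleftrightarrow> integrable_wrt M (proc_mult H' H) A"
    and integral_process_assoc: "integrable_wrt M (proc_mult H' H) A \<Longrightarrow>
      indist M (integral_process H' (integral_process H A)) (integral_process (proc_mult H' H) A)"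
proof -
  have *: "AE \<omega> in M. \<forall>t\<ge>0.
    abs_path_integral (H' \<omega>) (integral_process H A \<omega>) t = abs_path_integral (proc_mult H' H \<omega>) (A \<omega>) t \<and>
    (abs_path_integral (proc_mult H' H \<omega>) (A \<omega>) t < \<infinity> \<longrightarrow>
      path_integral (H' \<omega>) (integral_process H A \<omega>) t = path_integral (proc_mult H' H \<omega>) (A \<omega>) t)"
    using integrators_path[OF A] integrands_path[OF H] integrands_path[OF H']
      HA[unfolded integrable_wrt_iff[OF H A]]
  proof eventually_elim
    case (elim \<omega>)
    let ?h = "\<lambda>s. H \<omega> (max 0 s)" and ?k = "\<lambda>s. H' \<omega> (max 0 s)"
    have h: "abs_path_integral (H \<omega>) (A \<omega>) t = abs_path_integral ?h (A \<omega>) t"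
      "path_integral (H \<omega>) (A \<omega>) t = path_integral ?h (A \<omega>) t" if "0 \<le> t" for t
      by (auto intro!: path_integral_cong that)
    have fin: "abs_path_integral ?h (A \<omega>) t < \<infinity>" if "0 \<le> t" for t
      using elim(4) that h by simp
    show ?case
    proof (intro allI impI)
      fix t :: real assume t: "0 \<le> t"
      have c: "abs_path_integral (proc_mult H' H \<omega>) (A \<omega>) t = abs_path_integral (\<lambda>s. ?k s * ?h s) (A \<omega>) t"
        "path_integral (proc_mult H' H \<omega>) (A \<omega>) t = path_integral (\<lambda>s. ?k s * ?h s) (A \<omega>) t"
        by (auto intro!: path_integral_cong t simp: proc_mult_def)
      have d: "abs_path_integral (H' \<omega>) (integral_process H A \<omega>) t = abs_path_integral ?k (path_integral ?h (A \<omega>)) t"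
        "path_integral (H' \<omega>) (integral_process H A \<omega>) t = path_integral ?k (path_integral ?h (A \<omega>)) t"
        by (auto intro!: path_integral_cong t h simp: integral_process_def)
      show "abs_path_integral (H' \<omega>) (integral_process H A \<omega>) t = abs_path_integral (proc_mult H' H \<omega>) (A \<omega>) t \<and>
        (abs_path_integral (proc_mult H' H \<omega>) (A \<omega>) t < \<infinity> \<longrightarrow>
          path_integral (H' \<omega>) (integral_process H A \<omega>) t = path_integral (proc_mult H' H \<omega>) (A \<omega>) t)"
        unfolding c d
        using abs_path_integral_assoc[OF elim(1) t elim(2) fin elim(3)]
          path_integral_assoc[OF elim(1) t elim(2) fin elim(3)] by simp
    qed
  qed
  note I = integrable_wrt_iff[OF H' integral_process_integrable[OF H A HA]]
  note P = integrable_wrt_iff[OF integrands_proc_mult[OF H' H] A]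
  show "integrable_wrt M H' (integral_process H A) \<longleftrightarrow> integrable_wrt M (proc_mult H' H) A"
    unfolding I P
  proof
    assume "AE \<omega> in M. \<forall>t\<ge>0. abs_path_integral (H' \<omega>) (integral_process H A \<omega>) t < \<infinity>"
    with * show "AE \<omega> in M. \<forall>t\<ge>0. abs_path_integral (proc_mult H' H \<omega>) (A \<omega>) t < \<infinity>"
      by eventually_elim auto
  next
    assume "AE \<omega> in M. \<forall>t\<ge>0. abs_path_integral (proc_mult H' H \<omega>) (A \<omega>) t < \<infinity>"
    with * show "AE \<omega> in M. \<forall>t\<ge>0. abs_path_integral (H' \<omega>) (integral_process H A \<omega>) t < \<infinity>"
      by eventually_elim auto
  qed
  assume "integrable_wrt M (proc_mult H' H) A"
  then have "AE \<omega> in M. \<forall>t\<ge>0. abs_path_integral (proc_mult H' H \<omega>) (A \<omega>) t < \<infinity>" by (simp only: P)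
  with * show "indist M (integral_process H' (integral_process H A)) (integral_process (proc_mult H' H) A)"
    unfolding indist_def integral_process_def[of H'] integral_process_def[of "proc_mult H' H"]
    by eventually_elim auto
qed

end

subsection \<open>Processes on a predictable set of interval type\<close>

locale progressive_interval = progressive_setting +
  fixes B :: "('a \<times> real) set" and \<tau> :: "nat \<Rightarrow> 'a \<Rightarrow> ennreal"
  assumes FS: "fundamental_seq M F B \<tau>"
begin

lemma stopping_\<tau>: "stopping_time F (\<tau> n)"
  using FS by (simp add: fundamental_seq_def increasing_stopping_times_def)

lemma mem_B: "\<omega> \<in> space M \<Longrightarrow> (\<omega>, t) \<in> B \<longleftrightarrow> 0 \<le> t \<and> (\<exists>n. ennreal t \<le> \<tau> n \<omega>)"
  using FS by (auto simp: fundamental_seq_def stoch_upto_def)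

lemma stop_at_in_B: "\<omega> \<in> space M \<Longrightarrow> 0 \<le> t \<Longrightarrow> (\<omega>, stop_at (\<tau> n \<omega>) t) \<in> B"
  using ennreal_stop_at_le by (auto simp: mem_B stop_at_nonneg)

text \<open>The time \<open>stop_at (\<tau> n \<omega>) t\<close> lies in \<open>B\<close> and is
  therefore covered by some \<open>T m0\<close>. Monotonicity carries this to all later
  \<open>m\<close> and all earlier \<open>s\<close>. That one index serves all
  \<open>s \<le> t\<close> matters for regularity of paths.\<close>

lemma coupled_seq_eventually_eq:
  assumes X: "coupled_seq M F B X T Y" and Z: "\<And>m. indist M (Y m) (Z m)"
  shows "AE \<omega> in M. \<forall>n. \<forall>t\<ge>0. \<exists>m0. \<forall>m\<ge>m0. \<forall>s. 0 \<le> s \<and> s \<le> t \<longrightarrow>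
    stopped X (\<tau> n) \<omega> s = Z m \<omega> (stop_at (\<tau> n \<omega>) s)"
proof -
  have "AE \<omega> in M. \<forall>m. \<forall>t\<ge>0. restr X (B \<inter> stoch_upto M (T m)) \<omega> t = restr (Y m) (B \<inter> stoch_upto M (T m)) \<omega> t"
    using X unfolding coupled_seq_def indist_def AE_all_countable by blast
  moreover have "AE \<omega> in M. \<forall>m. \<forall>t\<ge>0. Y m \<omega> t = Z m \<omega> t"
    using Z unfolding indist_def AE_all_countable by blast
  ultimately show ?thesis
    using AE_space
  proof eventually_elim
    case (elim \<omega>)
    show ?case
    proof (intro allI impI)
      fix n and t :: real assume t: "0 \<le> t"
      let ?u = "stop_at (\<tau> n \<omega>)"
      have "(\<omega>, ?u t) \<in> (\<Union>m. stoch_upto M (T m))"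
        using X stop_at_in_B[OF elim(3) t] unfolding coupled_seq_def by blast
      then obtain m0 where m0: "ennreal (?u t) \<le> T m0 \<omega>" by (auto simp: stoch_upto_def)
      show "\<exists>m0. \<forall>m\<ge>m0. \<forall>s. 0 \<le> s \<and> s \<le> t \<longrightarrow> stopped X (\<tau> n) \<omega> s = Z m \<omega> (?u s)"
      proof (intro exI allI impI)
        fix m s assume m: "m0 \<le> m" and s: "0 \<le> s \<and> s \<le> t"
        have "T m0 \<omega> \<le> T m \<omega>"
          using X m elim(3) by (auto simp: coupled_seq_def increasing_stopping_times_def incseq_def)
        moreover have "ennreal (?u s) \<le> ennreal (?u t)" using s by (intro ennreal_leI stop_at_mono) auto
        ultimately have "ennreal (?u s) \<le> T m \<omega>" using m0 by (meson order_trans)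
        then have "(\<omega>, ?u s) \<in> B \<inter> stoch_upto M (T m)"
          using stop_at_in_B[OF elim(3)] s elim(3) by (auto simp: stoch_upto_def stop_at_nonneg)
        then have "X \<omega> (?u s) = Y m \<omega> (?u s)"
          using elim(1) s stop_at_nonneg[of s "\<tau> n \<omega>"] by (metis restr_def)
        then show "stopped X (\<tau> n) \<omega> s = Z m \<omega> (?u s)"
          using elim(2) s stop_at_nonneg[of s "\<tau> n \<omega>"] by (simp add: stopped_eq_stop_at)
      qed
    qed
  qed
qed

text \<open>Writing the eventual value as \<open>lim\<close> hides the random index and gives an
  expression whose measurability follows from that of its terms.\<close>

lemma coupled_seq_lim:
  assumes "coupled_seq M F B X T Y" "\<And>m. indist M (Y m) (Z m)"
  shows "indist M (stopped X (\<tau> n)) (\<lambda>\<omega> t. lim (\<lambda>m. Z m \<omega> (stop_at (\<tau> n \<omega>) t)))"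
  using coupled_seq_eventually_eq[OF assms] unfolding indist_def
proof eventually_elim
  case (elim \<omega>)
  show ?case
  proof (intro allI impI)
    fix t :: real assume t: "0 \<le> t"
    from elim t obtain m0 where m0: "\<forall>m\<ge>m0. \<forall>s. 0 \<le> s \<and> s \<le> t \<longrightarrow>
      stopped X (\<tau> n) \<omega> s = Z m \<omega> (stop_at (\<tau> n \<omega>) s)" by blast
    have "\<forall>\<^sub>F m in sequentially. Z m \<omega> (stop_at (\<tau> n \<omega>) t) = stopped X (\<tau> n) \<omega> t"
      using eventually_ge_at_top[of m0] by eventually_elim (use m0 t in auto)
    then show "stopped X (\<tau> n) \<omega> t = lim (\<lambda>m. Z m \<omega> (stop_at (\<tau> n \<omega>) t))"
      by (intro limI[symmetric] tendsto_eventually)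
  qed
qed

lemma stopped_integrand:
  assumes "X \<in> class_on M F integrands B"
  shows "stopped X (\<tau> n) \<in> integrands"
proof -
  obtain T Y where X: "coupled_seq M F B X T Y" and "\<And>m. Y m \<in> integrands"
    using assms by (auto simp: class_on_def fundamental_coupled_seq_def)
  then have "\<exists>Z. indist M (Y m) Z \<and> case_prod Z \<in> borel_measurable S" for m
    by (auto simp: integrands_def mod_indist_def)
  then obtain Z where Z: "\<And>m. indist M (Y m) (Z m)" "\<And>m. case_prod (Z m) \<in> borel_measurable S" by metis
  let ?W = "\<lambda>\<omega> t. lim (\<lambda>m. Z m \<omega> (stop_at (\<tau> n \<omega>) t))"
  have "(\<lambda>(\<omega>, t). Z m \<omega> (stop_at (\<tau> n \<omega>) t)) \<in> borel_measurable S" for m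
    using measurable_compose[OF stop_measurable[OF stopping_\<tau>] Z(2)] by (simp add: case_prod_beta')
  then have "(\<lambda>x. lim (\<lambda>m. (\<lambda>(\<omega>, t). Z m \<omega> (stop_at (\<tau> n \<omega>) t)) x)) \<in> borel_measurable S"
    by (rule borel_measurable_lim_metric)
  then have "case_prod ?W \<in> borel_measurable S" by (simp add: case_prod_beta')
  then show ?thesis
    unfolding integrands_def using coupled_seq_lim[OF X Z(1)] by (intro mod_indistI) auto
qed

lemma stopped_integrator:
  assumes "X \<in> class_on M F integrators B"
  shows "stopped X (\<tau> n) \<in> integrators"
proof -
  obtain T Y where X: "coupled_seq M F B X T Y" and "\<And>m. Y m \<in> integrators"
    using assms by (auto simp: class_on_def fundamental_coupled_seq_def)
  then have "\<exists>Z. indist M (Y m) Z \<and> (\<forall>t\<ge>0. (\<lambda>\<omega>. Z \<omega> t) \<in> borel_measurable (G t)) \<and>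
      (\<forall>\<omega>\<in>space M. fv_path (Z \<omega>))" for m
    unfolding integrators_def mod_indist_def by blast
  then obtain Z where Z: "\<And>m. indist M (Y m) (Z m)"
      "\<And>m t. 0 \<le> t \<Longrightarrow> (\<lambda>\<omega>. Z m \<omega> t) \<in> borel_measurable (G t)"
      "\<And>m \<omega>. \<omega> \<in> space M \<Longrightarrow> fv_path (Z m \<omega>)" by metis
  let ?W = "\<lambda>\<omega> t. lim (\<lambda>m. Z m \<omega> (stop_at (\<tau> n \<omega>) t))"
  have W: "indist M (stopped X (\<tau> n)) ?W" by (rule coupled_seq_lim[OF X Z(1)])
  have "?W \<in> integrators"
  proof (rule integrators_AE_I)
    show "(\<lambda>\<omega>. ?W \<omega> t) \<in> borel_measurable (G t)" if "0 \<le> t" for t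
    proof (rule borel_measurable_lim_metric)
      show "(\<lambda>\<omega>. Z m \<omega> (stop_at (\<tau> n \<omega>) t)) \<in> borel_measurable (G t)" for m
        by (rule stopped_adapted[OF stopping_\<tau>[of n] that, where A="Z m"]) (auto intro: Z(2,3))
    qed
    \<comment> \<open>Finite variation is not inherited by pointwise limits; here the limit equals a
      single stopped term on each [0, t].\<close>
    show "AE \<omega> in M. fv_path (?W \<omega>)"
      using coupled_seq_eventually_eq[OF X Z(1)] W[unfolded indist_def] AE_space
    proof eventually_elim
      case (elim \<omega>)
      show ?case
      proof (rule fv_path_if_locally)
        fix t :: real assume t: "0 \<le> t"
        from elim t obtain m0 where m0: "\<forall>m\<ge>m0. \<forall>s. 0 \<le> s \<and> s \<le> t \<longrightarrow>
          stopped X (\<tau> n) \<omega> s = Z m \<omega> (stop_at (\<tau> n \<omega>) s)" by blast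
        have "fv_path (\<lambda>s. Z m0 \<omega> (stop_at (\<tau> n \<omega>) s))"
          by (rule fv_path_stop[OF Z(3)[OF elim(3)]])
        moreover have "?W \<omega> s = Z m0 \<omega> (stop_at (\<tau> n \<omega>) s)" if "0 \<le> s" "s \<le> t" for s
          using m0 elim(2) that by auto
        ultimately show "\<exists>g. fv_path g \<and> (\<forall>s. 0 \<le> s \<and> s \<le> t \<longrightarrow> ?W \<omega> s = g s)" by blast
      qed
    qed
  qed
  then show ?thesis using W by (rule integrators_closed)
qed

text \<open>On [0, \<tau> n] stopping changes nothing, so the coupling is immediate. What needs an
  argument is that \<open>X\<close> restricted to \<open>B\<close> is a process.\<close>

lemma fundamental_coupled_seqI:
  assumes process: "\<And>X. X \<in> C \<Longrightarrow> is_process M X"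
    and closed: "\<And>X Y. X \<in> C \<Longrightarrow> indist M Y X \<Longrightarrow> Y \<in> C"
    and X: "\<And>n. stopped X (\<tau> n) \<in> C" and Y: "\<And>n. indist M (stopped X (\<tau> n)) (Y n)"
  shows "fundamental_coupled_seq M F C B X \<tau> Y"
proof -
  have YC: "Y n \<in> C" for n using X indist_sym[OF Y] by (rule closed)
  have "process_on M B X"
    unfolding process_on_def is_process_def
  proof (intro allI impI)
    fix t :: real assume t: "0 \<le> t"
    show "(\<lambda>\<omega>. restr X B \<omega> t) \<in> borel_measurable M"
    proof (rule borel_measurable_LIMSEQ_real)
      fix n
      have [measurable]: "(\<lambda>\<omega>. stopped X (\<tau> n) \<omega> t) \<in> borel_measurable M"
        using process[OF X[of n]] t by (simp add: is_process_def)
      have [measurable]: "\<tau> n \<in> borel_measurable M" by (intro stopping_time_M stopping_\<tau>)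
      \<comment> \<open>For fixed \<omega> and \<open>t\<close> these terms are eventually constant:
        equal to the value of \<open>X\<close> if (\<omega>, t) is in \<open>B\<close>, and 0
        otherwise.\<close>
      show "(\<lambda>\<omega>. if ennreal t \<le> \<tau> n \<omega> then stopped X (\<tau> n) \<omega> t else 0) \<in> borel_measurable M"
        by measurable
    next
      fix \<omega> assume \<omega>: "\<omega> \<in> space M"
      have "\<forall>\<^sub>F n in sequentially. (if ennreal t \<le> \<tau> n \<omega> then stopped X (\<tau> n) \<omega> t else 0) = restr X B \<omega> t"
      proof (cases "(\<omega>, t) \<in> B")
        case True
        then obtain m where m: "ennreal t \<le> \<tau> m \<omega>" using \<omega> by (auto simp: mem_B)
        show ?thesis
          using eventually_ge_at_top[of m]
        proof eventually_elim
          case (elim n)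
          have "\<tau> m \<omega> \<le> \<tau> n \<omega>"
            using FS elim \<omega> by (auto simp: fundamental_seq_def increasing_stopping_times_def incseq_def)
          with m have "ennreal t \<le> \<tau> n \<omega>" by (rule order_trans)
          then show ?case using True by (simp add: restr_def stopped_def)
        qed
      next
        case False
        then show ?thesis using \<omega> t by (auto simp: mem_B restr_def)
      qed
      then show "(\<lambda>n. if ennreal t \<le> \<tau> n \<omega> then stopped X (\<tau> n) \<omega> t else 0) \<longlonglongrightarrow> restr X B \<omega> t"
        by (rule tendsto_eventually)
    qed
  qed
  moreover have "indist M (restr X (B \<inter> stoch_upto M (\<tau> n))) (restr (Y n) (B \<inter> stoch_upto M (\<tau> n)))" for n
    using Y[of n] unfolding indist_def
    by eventually_elim (auto simp: restr_def stoch_upto_def stopped_def)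
  ultimately show ?thesis
    using FS tendsto_debut_compl[OF FS] process YC
    by (auto simp: fundamental_coupled_seq_def coupled_seq_def fundamental_seq_def)
qed

section \<open>Reduction of classes and integrals on \<open>B\<close> to stopped processes\<close>

lemma class_on_integrands_iff: "X \<in> class_on M F integrands B \<longleftrightarrow> (\<forall>n. stopped X (\<tau> n) \<in> integrands)"
proof
  assume "\<forall>n. stopped X (\<tau> n) \<in> integrands"
  then have "fundamental_coupled_seq M F integrands B X \<tau> (\<lambda>n. stopped X (\<tau> n))"
    by (intro fundamental_coupled_seqI integrands_process indist_refl) (auto intro: integrands_closed)
  then show "X \<in> class_on M F integrands B" by (auto simp: class_on_def)
qed (use stopped_integrand in auto)

lemma class_on_integrators_iff: "X \<in> class_on M F integrators B \<longleftrightarrow> (\<forall>n. stopped X (\<tau> n) \<in> integrators)"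
proof
  assume "\<forall>n. stopped X (\<tau> n) \<in> integrators"
  then have "fundamental_coupled_seq M F integrators B X \<tau> (\<lambda>n. stopped X (\<tau> n))"
    by (intro fundamental_coupled_seqI integrators_process indist_refl) (auto intro: integrators_closed)
  then show "X \<in> class_on M F integrators B" by (auto simp: class_on_def)
qed (use stopped_integrator in auto)

text \<open>One null set serves all \<open>n\<close>, by countability. Only the stopped paths of
  \<open>A\<close> are required to have finite variation.\<close>

lemma path_integral_stopped:
  assumes H: "H \<in> class_on M F integrands B" and A: "A \<in> class_on M F integrators B"
  shows "AE \<omega> in M. \<forall>n. \<forall>t\<ge>0.
    abs_path_integral (stopped H (\<tau> n) \<omega>) (stopped A (\<tau> n) \<omega>) t =
      abs_path_integral (H \<omega>) (A \<omega>) (stop_at (\<tau> n \<omega>) t) \<and>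
    path_integral (stopped H (\<tau> n) \<omega>) (stopped A (\<tau> n) \<omega>) t =
      path_integral (H \<omega>) (A \<omega>) (stop_at (\<tau> n \<omega>) t)"
  unfolding AE_all_countable
proof
  fix n
  show "AE \<omega> in M. \<forall>t\<ge>0.
    abs_path_integral (stopped H (\<tau> n) \<omega>) (stopped A (\<tau> n) \<omega>) t =
      abs_path_integral (H \<omega>) (A \<omega>) (stop_at (\<tau> n \<omega>) t) \<and>
    path_integral (stopped H (\<tau> n) \<omega>) (stopped A (\<tau> n) \<omega>) t =
      path_integral (H \<omega>) (A \<omega>) (stop_at (\<tau> n \<omega>) t)"
    using integrators_path[OF stopped_integrator[OF A, of n]] integrands_path[OF stopped_integrand[OF H, of n]]
  proof eventually_elim
    case (elim \<omega>)
    have eq: "stopped X (\<tau> n) \<omega> = (\<lambda>s. X \<omega> (stop_at (\<tau> n \<omega>) s))" for X :: "'a process"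
      by (simp add: fun_eq_iff stopped_eq_stop_at)
    show ?case
      using abs_path_integral_stop_at[OF elim[unfolded eq]] path_integral_stop_at[OF elim[unfolded eq]]
      by (simp add: eq)
  qed
qed

text \<open>As \<open>n\<close> and \<open>t \<ge> 0\<close> vary,
  \<open>stop_at (\<tau> n \<omega>) t\<close> runs through exactly the section of \<open>B\<close>
  at \<omega>.\<close>

lemma integrable_on_wrt_iff:
  assumes H: "H \<in> class_on M F integrands B" and A: "A \<in> class_on M F integrators B"
  shows "integrable_on_wrt M F B H A \<longleftrightarrow> (\<forall>n. integrable_wrt M (stopped H (\<tau> n)) (stopped A (\<tau> n)))"
proof -
  \<comment> \<open>Integrability is formulated with the larger pair of classes also in the
    predictable case.\<close>
  have "H \<in> class_on M F (measurable_processes M) B" "A \<in> class_on M F (fv_processes M) B"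
    using H A class_on_mono[OF integrands_measurable] class_on_mono[OF integrators_fv] by blast+
  then have "integrable_on_wrt M F B H A \<longleftrightarrow>
      (AE \<omega> in M. \<forall>t. (\<omega>, t) \<in> B \<longrightarrow> abs_path_integral (H \<omega>) (A \<omega>) t < \<infinity>)"
    by (simp add: integrable_on_wrt_def)
  also have "\<dots> \<longleftrightarrow> (AE \<omega> in M. \<forall>n. \<forall>t\<ge>0.
      abs_path_integral (stopped H (\<tau> n) \<omega>) (stopped A (\<tau> n) \<omega>) t < \<infinity>)"
  proof
    assume "AE \<omega> in M. \<forall>t. (\<omega>, t) \<in> B \<longrightarrow> abs_path_integral (H \<omega>) (A \<omega>) t < \<infinity>"
    with path_integral_stopped[OF H A] AE_space
    show "AE \<omega> in M. \<forall>n. \<forall>t\<ge>0. abs_path_integral (stopped H (\<tau> n) \<omega>) (stopped A (\<tau> n) \<omega>) t < \<infinity>"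
      by eventually_elim (simp add: stop_at_in_B)
  next
    assume "AE \<omega> in M. \<forall>n. \<forall>t\<ge>0. abs_path_integral (stopped H (\<tau> n) \<omega>) (stopped A (\<tau> n) \<omega>) t < \<infinity>"
    with path_integral_stopped[OF H A] AE_space
    show "AE \<omega> in M. \<forall>t. (\<omega>, t) \<in> B \<longrightarrow> abs_path_integral (H \<omega>) (A \<omega>) t < \<infinity>"
    proof eventually_elim
      case (elim \<omega>)
      show ?case
      proof (intro allI impI)
        fix t assume "(\<omega>, t) \<in> B"
        then obtain n where n: "0 \<le> t" "ennreal t \<le> \<tau> n \<omega>" using elim(2) by (auto simp: mem_B)
        have "abs_path_integral (stopped H (\<tau> n) \<omega>) (stopped A (\<tau> n) \<omega>) t = abs_path_integral (H \<omega>) (A \<omega>) t"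
          using elim(1) n stop_at_eq[OF n(2) order_refl] by simp
        then show "abs_path_integral (H \<omega>) (A \<omega>) t < \<infinity>" using elim(3) n(1) by metis
      qed
    qed
  qed
  also have "\<dots> \<longleftrightarrow> (\<forall>n. integrable_wrt M (stopped H (\<tau> n)) (stopped A (\<tau> n)))"
    by (simp add: AE_all_countable integrable_wrt_iff stopped_integrand[OF H] stopped_integrator[OF A])
  finally show ?thesis .
qed

text \<open>A process stopped at \<open>\<tau> n\<close> is evaluated inside \<open>B\<close> only,
  so the value 0 assigned outside \<open>B\<close> never enters.\<close>

lemma stopped_integral_on:
  assumes H: "H \<in> class_on M F integrands B" and A: "A \<in> class_on M F integrators B"
  shows "indist M (stopped (integral_on B H A) (\<tau> n)) (integral_process (stopped H (\<tau> n)) (stopped A (\<tau> n)))"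
proof -
  have *: "stopped (integral_on B H A) (\<tau> n) \<omega> t = path_integral (H \<omega>) (A \<omega>) (stop_at (\<tau> n \<omega>) t)"
    if "\<omega> \<in> space M" "0 \<le> t" for \<omega> t
    using stop_at_in_B[OF that, of n] by (simp add: stopped_eq_stop_at integral_on_def restr_def)
  show ?thesis
    using path_integral_stopped[OF H A] AE_space
    unfolding indist_def integral_process_def by eventually_elim (simp add: *)
qed

lemma indist_on_if_stopped:
  assumes "\<And>n. indist M (stopped X (\<tau> n)) (stopped Y (\<tau> n))"
  shows "indist_on M B X Y"
proof -
  have "AE \<omega> in M. \<forall>n. \<forall>t\<ge>0. stopped X (\<tau> n) \<omega> t = stopped Y (\<tau> n) \<omega> t"
    using assms unfolding indist_def AE_all_countable by blast
  then show ?thesis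
    unfolding indist_on_def indist_def using AE_space
  proof eventually_elim
    case (elim \<omega>)
    show ?case
    proof (intro allI impI)
      fix t :: real assume t: "0 \<le> t"
      show "restr X B \<omega> t = restr Y B \<omega> t"
      proof (cases "(\<omega>, t) \<in> B")
        case True
        then obtain n where n: "ennreal t \<le> \<tau> n \<omega>" using elim(2) by (auto simp: mem_B)
        then have "X \<omega> t = Y \<omega> t" using elim(1) t by (metis stopped_def)
        then show ?thesis by (simp add: restr_def)
      qed (simp add: restr_def)
    qed
  qed
qed

text \<open>Leaving \<open>Y\<close> free up to indistinguishability lets iterated integrals of
  stopped processes serve as coupled sequences for both sides of the associativity law.\<close>

lemma fundamental_coupled_seq_integral_on:
  assumes H: "H \<in> class_on M F integrands B" and A: "A \<in> class_on M F integrators B"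
    and HA: "integrable_on_wrt M F B H A"
    and Y: "\<And>n. indist M (integral_process (stopped H (\<tau> n)) (stopped A (\<tau> n))) (Y n)"
  shows "fundamental_coupled_seq M F integrators B (integral_on B H A) \<tau> Y"
proof (rule fundamental_coupled_seqI)
  note HA' = HA[unfolded integrable_on_wrt_iff[OF H A]]
  show "stopped (integral_on B H A) (\<tau> n) \<in> integrators" for n
    by (rule integrators_closed[OF integral_process_integrable stopped_integral_on[OF H A]])
       (use HA' stopped_integrand[OF H] stopped_integrator[OF A] in auto)
  show "indist M (stopped (integral_on B H A) (\<tau> n)) (Y n)" for n
    using stopped_integral_on[OF H A] Y by (rule indist_trans)
qed (auto intro: integrators_process integrators_closed)

lemma integral_on_class:
  assumes "H \<in> class_on M F integrands B" "A \<in> class_on M F integrators B" "integrable_on_wrt M F B H A"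
  shows "integral_on B H A \<in> class_on M F integrators B"
  using fundamental_coupled_seq_integral_on[OF assms indist_refl] by (auto simp: class_on_def)

end

section \<open>Linearity and associativity of integrals on \<open>B\<close>\<close>

lemma indist_lin_comb:
  assumes "indist M X X'" "indist M Y Y'"
  shows "indist M (lin_comb a X b Y) (lin_comb a X' b Y')"
  using assms unfolding indist_def by eventually_elim (auto simp: lin_comb_def)

context progressive_interval
begin

context
  fixes H A :: "'a process"
  assumes H: "H \<in> class_on M F integrands B" and A: "A \<in> class_on M F integrators B"
    and HA: "integrable_on_wrt M F B H A"
begin

lemma integrable_stopped: "integrable_wrt M (stopped H (\<tau> n)) (stopped A (\<tau> n))"
  using HA by (simp add: integrable_on_wrt_iff[OF H A])

lemma integral_on_lin_comb_left:
  assumes K: "K \<in> class_on M F integrands B" and KA: "integrable_on_wrt M F B K A"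
  shows "integrable_on_wrt M F B (lin_comb a H b K) A \<and>
    indist_on M B (integral_on B (lin_comb a H b K) A)
                  (lin_comb a (integral_on B H A) b (integral_on B K A)) \<and>
    (\<forall>n. integrable_wrt M (stopped H (\<tau> n)) (stopped A (\<tau> n)) \<and>
         integrable_wrt M (stopped K (\<tau> n)) (stopped A (\<tau> n)) \<and>
         integrable_wrt M (lin_comb a (stopped H (\<tau> n)) b (stopped K (\<tau> n))) (stopped A (\<tau> n)) \<and>
         indist M
           (integral_process (lin_comb a (stopped H (\<tau> n)) b (stopped K (\<tau> n))) (stopped A (\<tau> n)))
           (lin_comb a (integral_process (stopped H (\<tau> n)) (stopped A (\<tau> n)))
                     b (integral_process (stopped K (\<tau> n)) (stopped A (\<tau> n))))) \<and>
    integral_on B (lin_comb a H b K) A \<in> class_on M F integrators B \<and>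
    fundamental_coupled_seq M F integrators B (integral_on B (lin_comb a H b K) A) \<tau>
      (\<lambda>n. integral_process (lin_comb a (stopped H (\<tau> n)) b (stopped K (\<tau> n))) (stopped A (\<tau> n)))"
proof -
  note Hn = stopped_integrand[OF H] and Kn = stopped_integrand[OF K] and An = stopped_integrator[OF A]
  have HAn: "integrable_wrt M (stopped H (\<tau> n)) (stopped A (\<tau> n))"
    and KAn: "integrable_wrt M (stopped K (\<tau> n)) (stopped A (\<tau> n))" for n
    using integrable_stopped KA by (simp_all add: integrable_on_wrt_iff[OF K A])
  have L: "lin_comb a H b K \<in> class_on M F integrands B"
    by (simp add: class_on_integrands_iff stopped_lin_comb integrands_lin_comb Hn Kn)
  note lin = integrable_wrt_lin_comb_left[OF Hn Kn An HAn KAn]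
    integral_process_lin_comb_left[OF Hn Kn An HAn KAn]
  have LA: "integrable_on_wrt M F B (lin_comb a H b K) A"
    by (simp add: integrable_on_wrt_iff[OF L A] stopped_lin_comb lin)
  have "indist_on M B (integral_on B (lin_comb a H b K) A)
      (lin_comb a (integral_on B H A) b (integral_on B K A))"
  proof (rule indist_on_if_stopped)
    fix n
    have "indist M (stopped (integral_on B (lin_comb a H b K) A) (\<tau> n))
        (integral_process (lin_comb a (stopped H (\<tau> n)) b (stopped K (\<tau> n))) (stopped A (\<tau> n)))"
      using stopped_integral_on[OF L A, of n] by (simp only: stopped_lin_comb)
    also note lin(2)
    also have "indist M (lin_comb a (integral_process (stopped H (\<tau> n)) (stopped A (\<tau> n)))
          b (integral_process (stopped K (\<tau> n)) (stopped A (\<tau> n))))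
        (stopped (lin_comb a (integral_on B H A) b (integral_on B K A)) (\<tau> n))"
      unfolding stopped_lin_comb
      by (intro indist_lin_comb indist_sym[OF stopped_integral_on] H K A)
    finally show "indist M (stopped (integral_on B (lin_comb a H b K) A) (\<tau> n))
        (stopped (lin_comb a (integral_on B H A) b (integral_on B K A)) (\<tau> n))" .
  qed
  moreover have "fundamental_coupled_seq M F integrators B (integral_on B (lin_comb a H b K) A) \<tau>
      (\<lambda>n. integral_process (lin_comb a (stopped H (\<tau> n)) b (stopped K (\<tau> n))) (stopped A (\<tau> n)))"
    by (rule fundamental_coupled_seq_integral_on[OF L A LA]) (simp add: stopped_lin_comb indist_refl)
  ultimately show ?thesis
    using LA HAn KAn lin integral_on_class[OF L A LA] by blast
qed

lemma integral_on_lin_comb_right: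
  assumes V: "V \<in> class_on M F integrators B" and HV: "integrable_on_wrt M F B H V"
  shows "integrable_on_wrt M F B H (lin_comb a A b V) \<and>
    indist_on M B (integral_on B H (lin_comb a A b V))
                  (lin_comb a (integral_on B H A) b (integral_on B H V)) \<and>
    (\<forall>n. integrable_wrt M (stopped H (\<tau> n)) (stopped A (\<tau> n)) \<and>
         integrable_wrt M (stopped H (\<tau> n)) (stopped V (\<tau> n)) \<and>
         integrable_wrt M (stopped H (\<tau> n)) (lin_comb a (stopped A (\<tau> n)) b (stopped V (\<tau> n))) \<and>
         indist M
           (integral_process (stopped H (\<tau> n)) (lin_comb a (stopped A (\<tau> n)) b (stopped V (\<tau> n))))
           (lin_comb a (integral_process (stopped H (\<tau> n)) (stopped A (\<tau> n)))
                     b (integral_process (stopped H (\<tau> n)) (stopped V (\<tau> n))))) \<and>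
    integral_on B H (lin_comb a A b V) \<in> class_on M F integrators B \<and>
    fundamental_coupled_seq M F integrators B (integral_on B H (lin_comb a A b V)) \<tau>
      (\<lambda>n. integral_process (stopped H (\<tau> n)) (lin_comb a (stopped A (\<tau> n)) b (stopped V (\<tau> n))))"
proof -
  note Hn = stopped_integrand[OF H] and Vn = stopped_integrator[OF V] and An = stopped_integrator[OF A]
  have HAn: "integrable_wrt M (stopped H (\<tau> n)) (stopped A (\<tau> n))"
    and HVn: "integrable_wrt M (stopped H (\<tau> n)) (stopped V (\<tau> n))" for n
    using integrable_stopped HV by (simp_all add: integrable_on_wrt_iff[OF H V])
  have L: "lin_comb a A b V \<in> class_on M F integrators B"
    by (simp add: class_on_integrators_iff stopped_lin_comb integrators_lin_comb An Vn)
  note lin = integrable_wrt_lin_comb_right[OF Hn An Vn HAn HVn]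
    integral_process_lin_comb_right[OF Hn An Vn HAn HVn]
  have HL: "integrable_on_wrt M F B H (lin_comb a A b V)"
    by (simp add: integrable_on_wrt_iff[OF H L] stopped_lin_comb lin)
  have "indist_on M B (integral_on B H (lin_comb a A b V))
      (lin_comb a (integral_on B H A) b (integral_on B H V))"
  proof (rule indist_on_if_stopped)
    fix n
    have "indist M (stopped (integral_on B H (lin_comb a A b V)) (\<tau> n))
        (integral_process (stopped H (\<tau> n)) (lin_comb a (stopped A (\<tau> n)) b (stopped V (\<tau> n))))"
      using stopped_integral_on[OF H L, of n] by (simp only: stopped_lin_comb)
    also note lin(2)
    also have "indist M (lin_comb a (integral_process (stopped H (\<tau> n)) (stopped A (\<tau> n)))
          b (integral_process (stopped H (\<tau> n)) (stopped V (\<tau> n))))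
        (stopped (lin_comb a (integral_on B H A) b (integral_on B H V)) (\<tau> n))"
      unfolding stopped_lin_comb
      by (intro indist_lin_comb indist_sym[OF stopped_integral_on] H V A)
    finally show "indist M (stopped (integral_on B H (lin_comb a A b V)) (\<tau> n))
        (stopped (lin_comb a (integral_on B H A) b (integral_on B H V)) (\<tau> n))" .
  qed
  moreover have "fundamental_coupled_seq M F integrators B (integral_on B H (lin_comb a A b V)) \<tau>
      (\<lambda>n. integral_process (stopped H (\<tau> n)) (lin_comb a (stopped A (\<tau> n)) b (stopped V (\<tau> n))))"
    by (rule fundamental_coupled_seq_integral_on[OF H L HL]) (simp add: stopped_lin_comb indist_refl)
  ultimately show ?thesis
    using HL HAn HVn lin integral_on_class[OF H L HL] by blast
qed

lemma integral_on_assoc: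
  assumes H': "H' \<in> class_on M F integrands B"
  shows "(integrable_on_wrt M F B H' (integral_on B H A) \<longleftrightarrow> integrable_on_wrt M F B (proc_mult H' H) A) \<and>
    (integrable_on_wrt M F B H' (integral_on B H A) \<or> integrable_on_wrt M F B (proc_mult H' H) A \<longrightarrow>
      indist_on M B (integral_on B (proc_mult H' H) A) (integral_on B H' (integral_on B H A)) \<and>
      (\<forall>n. integrable_wrt M (stopped H (\<tau> n)) (stopped A (\<tau> n)) \<and>
           integrable_wrt M (stopped H' (\<tau> n))
             (integral_process (stopped H (\<tau> n)) (stopped A (\<tau> n))) \<and>
           integrable_wrt M (proc_mult (stopped H' (\<tau> n)) (stopped H (\<tau> n))) (stopped A (\<tau> n)) \<and>
           indist M
             (integral_process (stopped H' (\<tau> n))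
               (integral_process (stopped H (\<tau> n)) (stopped A (\<tau> n))))
             (integral_process (proc_mult (stopped H' (\<tau> n)) (stopped H (\<tau> n))) (stopped A (\<tau> n)))) \<and>
      integral_on B (proc_mult H' H) A \<in> class_on M F integrators B \<and>
      integral_on B H' (integral_on B H A) \<in> class_on M F integrators B \<and>
      fundamental_coupled_seq M F integrators B (integral_on B (proc_mult H' H) A) \<tau>
        (\<lambda>n. integral_process (stopped H' (\<tau> n))
               (integral_process (stopped H (\<tau> n)) (stopped A (\<tau> n)))) \<and>
      fundamental_coupled_seq M F integrators B (integral_on B H' (integral_on B H A)) \<tau>
        (\<lambda>n. integral_process (stopped H' (\<tau> n))
               (integral_process (stopped H (\<tau> n)) (stopped A (\<tau> n)))))"
proof -
  let ?HA = "\<lambda>n. integral_process (stopped H (\<tau> n)) (stopped A (\<tau> n))"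
  note Hn = stopped_integrand[OF H] and Hn' = stopped_integrand[OF H'] and An = stopped_integrator[OF A]
  note HAn = integrable_stopped
  note IHA = integral_process_integrable[OF Hn An HAn]
  have P: "proc_mult H' H \<in> class_on M F integrands B"
    by (simp add: class_on_integrands_iff stopped_proc_mult integrands_proc_mult Hn Hn')
  note I = integral_on_class[OF H A HA]
  note In = stopped_integrator[OF I] and I_eq = stopped_integral_on[OF H A]
  \<comment> \<open>The stopped integral is first exchanged for its version, the integral of the
    stopped processes; only then does associativity over the half-line apply.\<close>
  have iff: "integrable_wrt M (stopped H' (\<tau> n)) (stopped (integral_on B H A) (\<tau> n)) \<longleftrightarrow>
      integrable_wrt M (stopped (proc_mult H' H) (\<tau> n)) (stopped A (\<tau> n))" for n
    unfolding stopped_proc_mult integrable_wrt_indist[OF Hn' In IHA I_eq]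
    by (rule integrable_wrt_assoc[OF Hn Hn' An HAn])
  then have equiv: "integrable_on_wrt M F B H' (integral_on B H A) \<longleftrightarrow> integrable_on_wrt M F B (proc_mult H' H) A"
    by (simp add: integrable_on_wrt_iff[OF H' I] integrable_on_wrt_iff[OF P A])
  {
    assume PA: "integrable_on_wrt M F B (proc_mult H' H) A"
    have HI: "integrable_on_wrt M F B H' (integral_on B H A)" using PA equiv by simp
    have PAn: "integrable_wrt M (proc_mult (stopped H' (\<tau> n)) (stopped H (\<tau> n))) (stopped A (\<tau> n))" for n
      using PA by (simp add: integrable_on_wrt_iff[OF P A] stopped_proc_mult)
    have HIn: "integrable_wrt M (stopped H' (\<tau> n)) (?HA n)" for n
      using PAn by (simp add: integrable_wrt_assoc[OF Hn Hn' An HAn])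
    note assoc = integral_process_assoc[OF Hn Hn' An HAn PAn]
    have 1: "indist M (integral_process (stopped (proc_mult H' H) (\<tau> n)) (stopped A (\<tau> n)))
        (integral_process (stopped H' (\<tau> n)) (?HA n))" for n
      unfolding stopped_proc_mult by (rule indist_sym[OF assoc])
    have 2: "indist M (integral_process (stopped H' (\<tau> n)) (stopped (integral_on B H A) (\<tau> n)))
        (integral_process (stopped H' (\<tau> n)) (?HA n))" for n
      by (rule integral_process_indist[OF Hn' In IHA I_eq])
    have "indist_on M B (integral_on B (proc_mult H' H) A) (integral_on B H' (integral_on B H A))"
      by (rule indist_on_if_stopped)
         (rule indist_trans[OF indist_trans[OF stopped_integral_on[OF P A] 1]
            indist_sym[OF indist_trans[OF stopped_integral_on[OF H' I] 2]]])
    moreover note fundamental_coupled_seq_integral_on[OF P A PA 1]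
      fundamental_coupled_seq_integral_on[OF H' I HI 2]
      integral_on_class[OF P A PA] integral_on_class[OF H' I HI]
    ultimately have "indist_on M B (integral_on B (proc_mult H' H) A) (integral_on B H' (integral_on B H A)) \<and>
      (\<forall>n. integrable_wrt M (stopped H (\<tau> n)) (stopped A (\<tau> n)) \<and>
           integrable_wrt M (stopped H' (\<tau> n)) (?HA n) \<and>
           integrable_wrt M (proc_mult (stopped H' (\<tau> n)) (stopped H (\<tau> n))) (stopped A (\<tau> n)) \<and>
           indist M (integral_process (stopped H' (\<tau> n)) (?HA n))
             (integral_process (proc_mult (stopped H' (\<tau> n)) (stopped H (\<tau> n))) (stopped A (\<tau> n)))) \<and>
      integral_on B (proc_mult H' H) A \<in> class_on M F integrators B \<and>
      integral_on B H' (integral_on B H A) \<in> class_on M F integrators B \<and>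
      fundamental_coupled_seq M F integrators B (integral_on B (proc_mult H' H) A) \<tau>
        (\<lambda>n. integral_process (stopped H' (\<tau> n)) (?HA n)) \<and>
      fundamental_coupled_seq M F integrators B (integral_on B H' (integral_on B H A)) \<tau>
        (\<lambda>n. integral_process (stopped H' (\<tau> n)) (?HA n))"
      using HAn HIn PAn assoc by blast
  }
  with equiv show ?thesis by blast
qed

end

end

subsection \<open>Measurable and predictable processes\<close>

text \<open>The strict form matches the generators ]s, u] and produces the event {s < T}, which is
  known at time \<open>s\<close>.\<close>

lemma stop_at_gt_iff: "0 \<le> s \<Longrightarrow> s < stop_at r t \<longleftrightarrow> s < t \<and> ennreal s < r"
  by (cases r) (auto simp: stop_at_ennreal ennreal_less_iff)

lemma space_predictable_sigma: "space (predictable_sigma M F) = space M \<times> {0..}"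
  unfolding predictable_sigma_def by (rule space_measure_of_conv)

context usual_filtered_space
begin

lemma subset_space_F: "A \<in> sets (F t) \<Longrightarrow> A \<subseteq> space M"
  using sets.sets_into_space[of A "F t"] by (simp add: space_F)

lemma predictable_generator_subset:
  "{A \<times> {0} |A. A \<in> sets (F 0)} \<union>
    {A \<times> {s<..t} |A s t. 0 \<le> s \<and> s \<le> t \<and> A \<in> sets (F (ennreal s))} \<subseteq> Pow (space M \<times> {0 :: real..})"
  using subset_space_F by fastforce

lemma predictable_sets_0: "A \<in> sets (F 0) \<Longrightarrow> A \<times> {0} \<in> sets (predictable_sigma M F)"
  unfolding predictable_sigma_def using predictable_generator_subset by (intro in_measure_of) auto

lemma predictable_sets_Ioc:
  "0 \<le> s \<Longrightarrow> s \<le> t \<Longrightarrow> A \<in> sets (F (ennreal s)) \<Longrightarrow> A \<times> {s<..t} \<in> sets (predictable_sigma M F)"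
  unfolding predictable_sigma_def using predictable_generator_subset by (intro in_measure_of) auto

lemma predictable_sets_Ioi:
  assumes "0 \<le> s" "A \<in> sets (F (ennreal s))"
  shows "A \<times> {s<..} \<in> sets (predictable_sigma M F)"
proof -
  have "A \<times> {s<..} = (\<Union>n. A \<times> {s<..s + real n})"
  proof -
    have "\<exists>n. x \<le> s + real n" for x using real_arch_simple[of "x - s"] by (auto simp: algebra_simps)
    then show ?thesis by auto
  qed
  also have "\<dots> \<in> sets (predictable_sigma M F)"
    using assms by (intro sets.countable_UN) (auto intro: predictable_sets_Ioc)
  finally show ?thesis .
qed

lemma measurable_predictable_sigma:
  assumes f: "f \<in> space N \<rightarrow> space M \<times> {0..}"
    and "\<And>A. A \<in> sets (F 0) \<Longrightarrow> f -` (A \<times> {0}) \<inter> space N \<in> sets N"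
    and "\<And>A s t. 0 \<le> s \<Longrightarrow> s \<le> t \<Longrightarrow> A \<in> sets (F (ennreal s)) \<Longrightarrow> f -` (A \<times> {s<..t}) \<inter> space N \<in> sets N"
  shows "f \<in> measurable N (predictable_sigma M F)"
  unfolding predictable_sigma_def
  by (rule measurable_measure_of[OF predictable_generator_subset f]) (use assms(2,3) in auto)

lemma stopping_time_sets: "stopping_time F T \<Longrightarrow> {\<omega> \<in> space M. T \<omega> \<le> t} \<in> sets (F t)"
  using stopping_timeD[of F T t] by (simp add: pred_def space_F)

lemma stopping_time_sets2: "stopping_time F T \<Longrightarrow> {\<omega> \<in> space M. t < T \<omega>} \<in> sets (F t)"
  using stopping_timeD2[of F T t] by (simp add: pred_def space_F)

text \<open>The preimage of A \<times> ]s, u] is the difference of two half-infinite rectangles,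
  with bases A \<inter> {s < T} and A \<inter> {u < T}. For A \<times> {0}, the stopped clock shows
  0 either at time 0 or, when T = 0, at all times.\<close>

lemma stop_predictable:
  assumes T: "stopping_time F T"
  shows "(\<lambda>(\<omega>, t). (\<omega>, stop_at (T \<omega>) t)) \<in> measurable (predictable_sigma M F) (predictable_sigma M F)"
proof (rule measurable_predictable_sigma)
  fix A assume A: "A \<in> sets (F 0)"
  let ?C = "A \<inter> {\<omega> \<in> space M. T \<omega> \<le> 0}"
  have C: "?C \<in> sets (F 0)" using A stopping_time_sets[OF T, of 0] by blast
  have "stop_at r t = 0 \<longleftrightarrow> t = 0 \<or> r \<le> 0" if "0 \<le> t" for r t
    using stop_at_gt_iff[of 0 r t] stop_at_nonneg[OF that, of r] that by (auto simp: not_less)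
  then have "(\<lambda>(\<omega>, t). (\<omega>, stop_at (T \<omega>) t)) -` (A \<times> {0}) \<inter> space (predictable_sigma M F) =
      A \<times> {0} \<union> ?C \<times> {0} \<union> ?C \<times> {0<..}"
    using subset_space_F[OF A] by (auto simp: space_predictable_sigma)
  also have "\<dots> \<in> sets (predictable_sigma M F)"
    using A C predictable_sets_0 predictable_sets_Ioi[of 0] by auto
  finally show "(\<lambda>(\<omega>, t). (\<omega>, stop_at (T \<omega>) t)) -` (A \<times> {0}) \<inter> space (predictable_sigma M F)
      \<in> sets (predictable_sigma M F)" .
next
  fix A and s u :: real assume su: "0 \<le> s" "s \<le> u" and A: "A \<in> sets (F (ennreal s))"
  have "sets (F (ennreal s)) \<subseteq> sets (F (ennreal u))" using su by (intro sets_F_mono ennreal_leI)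
  then have Au: "A \<in> sets (F (ennreal u))" using A by blast
  let ?C = "\<lambda>s. A \<inter> {\<omega> \<in> space M. ennreal s < T \<omega>}"
  have "(\<lambda>(\<omega>, t). (\<omega>, stop_at (T \<omega>) t)) -` (A \<times> {s<..u}) \<inter> space (predictable_sigma M F) =
      ?C s \<times> {s<..} - ?C u \<times> {u<..}"
    using subset_space_F[OF A] su stop_at_gt_iff[OF su(1)] stop_at_gt_iff[of u]
    by (auto simp: space_predictable_sigma not_less[symmetric])
  also have "\<dots> \<in> sets (predictable_sigma M F)"
    using A Au su stopping_time_sets2[OF T] by (intro sets.Diff predictable_sets_Ioi sets.Int) auto
  finally show "(\<lambda>(\<omega>, t). (\<omega>, stop_at (T \<omega>) t)) -` (A \<times> {s<..u}) \<inter> space (predictable_sigma M F)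
      \<in> sets (predictable_sigma M F)" .
qed (auto simp: space_predictable_sigma stop_at_nonneg)

text \<open>Predictable processes are progressive: a rectangle over ]s, u] that meets [0, t] has
  \<open>s < t\<close>, so its base is known at time \<open>t\<close>.\<close>

lemma clip_predictable:
  assumes t: "0 \<le> t"
  shows "(\<lambda>(\<omega>, s). (\<omega>, max 0 (min s t))) \<in> measurable (F (ennreal t) \<Otimes>\<^sub>M borel) (predictable_sigma M F)"
proof (rule measurable_predictable_sigma)
  fix A assume A: "A \<in> sets (F 0)"
  then have At: "A \<in> sets (F (ennreal t))" using sets_F_mono[of 0 "ennreal t"] by auto
  have "(\<lambda>(\<omega>, s). (\<omega>, max 0 (min s t))) -` (A \<times> {0}) \<inter> space (F (ennreal t) \<Otimes>\<^sub>M borel) =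
      A \<times> {s. max 0 (min s t) = 0}"
    using subset_space_F[OF A] by (auto simp: space_pair_measure space_F)
  also have "\<dots> \<in> sets (F (ennreal t) \<Otimes>\<^sub>M borel)"
    using At by (intro pair_measureI) auto
  finally show "(\<lambda>(\<omega>, s). (\<omega>, max 0 (min s t))) -` (A \<times> {0}) \<inter> space (F (ennreal t) \<Otimes>\<^sub>M borel)
      \<in> sets (F (ennreal t) \<Otimes>\<^sub>M borel)" .
next
  fix A and s u :: real assume su: "0 \<le> s" "s \<le> u" and A: "A \<in> sets (F (ennreal s))"
  have eq: "(\<lambda>(\<omega>, s). (\<omega>, max 0 (min s t))) -` (A \<times> {s<..u}) \<inter> space (F (ennreal t) \<Otimes>\<^sub>M borel) =
      A \<times> {r. s < max 0 (min r t) \<and> max 0 (min r t) \<le> u}"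
    using subset_space_F[OF A] by (auto simp: space_pair_measure space_F)
  show "(\<lambda>(\<omega>, s). (\<omega>, max 0 (min s t))) -` (A \<times> {s<..u}) \<inter> space (F (ennreal t) \<Otimes>\<^sub>M borel)
      \<in> sets (F (ennreal t) \<Otimes>\<^sub>M borel)"
  proof (cases "s < t")
    case True
    then have "A \<in> sets (F (ennreal t))" using A sets_F_mono[OF ennreal_leI, of s t] by auto
    then show ?thesis unfolding eq by (intro pair_measureI) auto
  next
    \<comment> \<open>Here \<open>A\<close> may fail to be known at time \<open>t\<close>, but the
      rectangle starts too late to be reached by the clipped time.\<close>
    case False
    then have "{r. s < max 0 (min r t) \<and> max 0 (min r t) \<le> u} = {}" using su t by auto
    then show ?thesis unfolding eq by (simp only: Sigma_empty2 sets.empty_sets)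
  qed
qed (auto simp: space_pair_measure space_F)

lemma stopping_time_measurable: "stopping_time F T \<Longrightarrow> T \<in> borel_measurable M"
  using measurable_stopping_time[of F T M] sets_F_subset space_F by auto

lemma progressive_setting_predictable:
  "progressive_setting M F (\<lambda>t. F (ennreal t)) (predictable_sigma M F)"
proof unfold_locales
  show "(\<lambda>x. x) \<in> measurable (M \<Otimes>\<^sub>M restrict_space borel {0..}) (predictable_sigma M F)"
  proof (rule measurable_predictable_sigma)
    fix A assume A: "A \<in> sets (F 0)"
    have "{0 :: real} \<in> sets (restrict_space borel {0..})" by (simp add: sets_restrict_space_iff)
    then have "A \<times> {0} \<in> sets (M \<Otimes>\<^sub>M restrict_space borel {0 :: real..})"
      using A sets_F_subset by (intro pair_measureI) auto
    then show "(\<lambda>x. x) -` (A \<times> {0}) \<inter> space (M \<Otimes>\<^sub>M restrict_space borel {0 :: real..})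
        \<in> sets (M \<Otimes>\<^sub>M restrict_space borel {0..})" unfolding vimage_ident by (rule sets.Int[OF _ sets.top])
  next
    fix A and s u :: real assume su: "0 \<le> s" "s \<le> u" and A: "A \<in> sets (F (ennreal s))"
    have "{s<..u} \<in> sets (restrict_space borel {0..})"
      using su by (subst sets_restrict_space_iff) auto
    then have "A \<times> {s<..u} \<in> sets (M \<Otimes>\<^sub>M restrict_space borel {0 :: real..})"
      using A sets_F_subset by (intro pair_measureI) auto
    then show "(\<lambda>x. x) -` (A \<times> {s<..u}) \<inter> space (M \<Otimes>\<^sub>M restrict_space borel {0 :: real..})
        \<in> sets (M \<Otimes>\<^sub>M restrict_space borel {0..})" unfolding vimage_ident by (rule sets.Int[OF _ sets.top])
  qed (auto simp: space_pair_measure space_restrict_space)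
  show "null_sets M \<subseteq> sets (F (ennreal t))" for t
    using null_sets_F sets_F_mono[of 0 "ennreal t"] by auto
qed (auto simp: space_F sets_F_subset[THEN subsetD] intro: stopping_time_sets clip_predictable stop_predictable
    stopping_time_measurable sets_F_mono[THEN subsetD, rotated] ennreal_leI)

lemma progressive_setting_measurable:
  "progressive_setting M F (\<lambda>_. M) (M \<Otimes>\<^sub>M restrict_space borel {0..})"
proof unfold_locales
  fix T assume T: "stopping_time F T"
  have [measurable]: "T \<in> borel_measurable M" by (rule stopping_time_measurable[OF T])
  show "T \<in> borel_measurable M" by fact
  show "{\<omega> \<in> space M. T \<omega> \<le> ennreal t} \<in> sets M" for t by measurable
  let ?S = "M \<Otimes>\<^sub>M restrict_space borel {0 :: real..}"
  have [measurable]: "snd \<in> borel_measurable ?S"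
    using measurable_compose[OF measurable_snd[of M "restrict_space borel {0..}"]
        measurable_restrict_space1[OF measurable_ident]] by (simp add: id_def)
  have "(\<lambda>x. stop_at (T (fst x)) (snd x)) \<in> borel_measurable ?S"
    unfolding stop_at_def by measurable
  then have "(\<lambda>x. (fst x, stop_at (T (fst x)) (snd x))) \<in> measurable ?S ?S"
    by (intro measurable_Pair measurable_restrict_space2)
       (auto simp: space_pair_measure space_restrict_space stop_at_nonneg)
  then show "(\<lambda>(\<omega>, t). (\<omega>, stop_at (T \<omega>) t)) \<in> measurable ?S ?S"
    by (simp add: case_prod_beta')
next
  fix t :: real
  have "(\<lambda>x. (fst x, max 0 (min (snd x) t))) \<in> measurable (M \<Otimes>\<^sub>M borel) (M \<Otimes>\<^sub>M restrict_space borel {0..})"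
    by (intro measurable_Pair measurable_restrict_space2) auto
  then show "(\<lambda>(\<omega>, s). (\<omega>, max 0 (min s t))) \<in> measurable (M \<Otimes>\<^sub>M borel) (M \<Otimes>\<^sub>M restrict_space borel {0..})"
    by (simp add: case_prod_beta')
qed auto

lemma progressive_setting_exists:
  assumes "(D, E) \<in> {(measurable_processes M, fv_processes M),
                    (predictable_processes M F, adapted_fv_processes M F)}"
  obtains G S where "progressive_setting M F G S" "D = progressive_setting.integrands M S"
    "E = progressive_setting.integrators M G"
proof -
  note m = progressive_setting_measurable and p = progressive_setting_predictable
  from assms consider "D = measurable_processes M" "E = fv_processes M"
    | "D = predictable_processes M F" "E = adapted_fv_processes M F" by auto
  then show ?thesis
  proof cases
    case 1
    show ?thesis
      by (rule that[OF m])
         (simp_all add: 1 progressive_setting.integrands_def[OF m] progressive_setting.integrators_def[OF m]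
            measurable_processes_def fv_processes_def is_process_def)
  next
    case 2
    show ?thesis
      by (rule that[OF p])
         (simp_all add: 2 progressive_setting.integrands_def[OF p] progressive_setting.integrators_def[OF p]
            predictable_processes_def adapted_fv_processes_def)
  qed
qed

end

theorem theorem3p10:
  fixes M :: "'a measure" and F :: "ennreal \<Rightarrow> 'a measure"
    and B :: "('a \<times> real) set" and D E :: "'a process set"
    and H K H' A V :: "'a process" and a b :: real
    and \<tau> :: "nat \<Rightarrow> 'a \<Rightarrow> ennreal"
  assumes "usual_filtered_space M F"
    and "psit M F B"
    and "(D, E) \<in> {(measurable_processes M, fv_processes M),
                    (predictable_processes M F, adapted_fv_processes M F)}"
    and "H \<in> class_on M F D B" and "K \<in> class_on M F D B" and "H' \<in> class_on M F D B"
    and "A \<in> class_on M F E B" and "V \<in> class_on M F E B"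
    and "fundamental_seq M F B \<tau>"
    and "integrable_on_wrt M F B H A" and "integrable_on_wrt M F B K A"
    and "integrable_on_wrt M F B H V"
  shows "
    (integrable_on_wrt M F B (lin_comb a H b K) A \<and>
     indist_on M B (integral_on B (lin_comb a H b K) A)
                   (lin_comb a (integral_on B H A) b (integral_on B K A)) \<and>
     (\<forall>n. integrable_wrt M (stopped H (\<tau> n)) (stopped A (\<tau> n)) \<and>
          integrable_wrt M (stopped K (\<tau> n)) (stopped A (\<tau> n)) \<and>
          integrable_wrt M (lin_comb a (stopped H (\<tau> n)) b (stopped K (\<tau> n))) (stopped A (\<tau> n)) \<and>
          indist M
            (integral_process (lin_comb a (stopped H (\<tau> n)) b (stopped K (\<tau> n))) (stopped A (\<tau> n)))
            (lin_comb a (integral_process (stopped H (\<tau> n)) (stopped A (\<tau> n)))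
                      b (integral_process (stopped K (\<tau> n)) (stopped A (\<tau> n))))) \<and>
     integral_on B (lin_comb a H b K) A \<in> class_on M F E B \<and>
     fundamental_coupled_seq M F E B (integral_on B (lin_comb a H b K) A) \<tau>
       (\<lambda>n. integral_process (lin_comb a (stopped H (\<tau> n)) b (stopped K (\<tau> n))) (stopped A (\<tau> n))))
    \<and>
    (integrable_on_wrt M F B H (lin_comb a A b V) \<and>
     indist_on M B (integral_on B H (lin_comb a A b V))
                   (lin_comb a (integral_on B H A) b (integral_on B H V)) \<and>
     (\<forall>n. integrable_wrt M (stopped H (\<tau> n)) (stopped A (\<tau> n)) \<and>
          integrable_wrt M (stopped H (\<tau> n)) (stopped V (\<tau> n)) \<and>
          integrable_wrt M (stopped H (\<tau> n)) (lin_comb a (stopped A (\<tau> n)) b (stopped V (\<tau> n))) \<and>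
          indist M
            (integral_process (stopped H (\<tau> n)) (lin_comb a (stopped A (\<tau> n)) b (stopped V (\<tau> n))))
            (lin_comb a (integral_process (stopped H (\<tau> n)) (stopped A (\<tau> n)))
                      b (integral_process (stopped H (\<tau> n)) (stopped V (\<tau> n))))) \<and>
     integral_on B H (lin_comb a A b V) \<in> class_on M F E B \<and>
     fundamental_coupled_seq M F E B (integral_on B H (lin_comb a A b V)) \<tau>
       (\<lambda>n. integral_process (stopped H (\<tau> n)) (lin_comb a (stopped A (\<tau> n)) b (stopped V (\<tau> n)))))
    \<and>
    ((integrable_on_wrt M F B H' (integral_on B H A) \<longleftrightarrow> integrable_on_wrt M F B (proc_mult H' H) A) \<and>
     (integrable_on_wrt M F B H' (integral_on B H A) \<or> integrable_on_wrt M F B (proc_mult H' H) A \<longrightarrow>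
      indist_on M B (integral_on B (proc_mult H' H) A) (integral_on B H' (integral_on B H A)) \<and>
      (\<forall>n. integrable_wrt M (stopped H (\<tau> n)) (stopped A (\<tau> n)) \<and>
           integrable_wrt M (stopped H' (\<tau> n))
             (integral_process (stopped H (\<tau> n)) (stopped A (\<tau> n))) \<and>
           integrable_wrt M (proc_mult (stopped H' (\<tau> n)) (stopped H (\<tau> n))) (stopped A (\<tau> n)) \<and>
           indist M
             (integral_process (stopped H' (\<tau> n))
               (integral_process (stopped H (\<tau> n)) (stopped A (\<tau> n))))
             (integral_process (proc_mult (stopped H' (\<tau> n)) (stopped H (\<tau> n))) (stopped A (\<tau> n)))) \<and>
      integral_on B (proc_mult H' H) A \<in> class_on M F E B \<and>
      integral_on B H' (integral_on B H A) \<in> class_on M F E B \<and>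
      fundamental_coupled_seq M F E B (integral_on B (proc_mult H' H) A) \<tau>
        (\<lambda>n. integral_process (stopped H' (\<tau> n))
               (integral_process (stopped H (\<tau> n)) (stopped A (\<tau> n)))) \<and>
      fundamental_coupled_seq M F E B (integral_on B H' (integral_on B H A)) \<tau>
        (\<lambda>n. integral_process (stopped H' (\<tau> n))
               (integral_process (stopped H (\<tau> n)) (stopped A (\<tau> n))))))"
proof -
  interpret usual_filtered_space M F by fact
  obtain G S where "progressive_setting M F G S"
    and D: "D = progressive_setting.integrands M S" and E: "E = progressive_setting.integrators M G"
    by (rule progressive_setting_exists[OF assms(3)])
  then interpret progressive_interval M F G S B \<tau>
    using assms(9) by (intro progressive_interval.intro progressive_interval_axioms.intro)
  note cls = assms(4-8)[unfolded D E]
  show ?thesis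
    unfolding D E
    by (intro conjI[OF _ conjI]
        integral_on_lin_comb_left[OF cls(1,4) assms(10) cls(2) assms(11)]
        integral_on_lin_comb_right[OF cls(1,4) assms(10) cls(5) assms(12)]
        integral_on_assoc[OF cls(1,4) assms(10) cls(3)])
qed

end
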